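(* Let $g\in L_1(\mathbb R;[\cosh(\pi\tau)]^{-1/2}d\tau)$, let $$(Gg)(t)=\sqrt\pi\,e^{-t/2}\int_{-\infty}^\infty\mathrm{Re}\left[I_{i\tau}\left(\frac t2\right)\right]\frac{g(\tau)\,d\tau}{\cosh(\pi\tau)},\qquad t>0,$$ and suppose that $Gg\in L_{\nu,1}(\mathbb R_+)$, $0<\nu<1/2$. Let $g(z/i)$ be an even analytic function in the strip $D=\{z\in\mathbb C:|\mathrm{Re}\,z|<\alpha<1\}$, with $g(0)=g'(0)=0$ and $g(z/i)=o(1)$ as $|\mathrm{Im}\,z|\to\infty$ uniformly in $D$. Then for all $x\in\mathbb R$ $$g(x)=\lim_{\varepsilon\to0}\frac{\cosh(\pi x)}{\sqrt\pi}\int_0^\infty\Bigg[\frac{|\Gamma(\varepsilon-1+ix)|^2\,x\sinh(\pi x)}{\pi\sqrt\pi\,\Gamma(\varepsilon-1/2)}\;{}_2F_2\left(1,\tfrac32-\varepsilon;\,2-\varepsilon-ix,\,2-\varepsilon+ix;\,t\right)$$ $$-\,x\,e^{t/2}\,t^{\varepsilon-1}\,\mathrm{Im}\left[\frac{I_{ix}(t/2)}{\sin(\pi(\varepsilon+ix))}\right]\Bigg](Gg)(t)\,dt,$$ where the limit (over $\varepsilon\in(0,1)$, $\varepsilon\to0$) is pointwise.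
   Context: $\mathbb R_+=(0,\infty)$. $L_1(\mathbb R;w(\tau)d\tau)$ is the space of functions $g$ with $\int_{-\infty}^\infty|g(\tau)|w(\tau)d\tau<\infty$. $L_{\nu,1}(\mathbb R_+)$ is the space of functions $h$ with $\int_0^\infty|h(x)|x^{\nu-1}dx<\infty$. $I_\nu(z)=\sum_{k\ge0}\frac{(z/2)^{2k+\nu}}{k!\,\Gamma(k+\nu+1)}$ is the modified Bessel function of the first kind. ${}_2F_2(a_1,a_2;b_1,b_2;t)=\sum_{k\ge0}\frac{(a_1)_k(a_2)_k}{(b_1)_k(b_2)_k}\frac{t^k}{k!}$ is the generalized hypergeometric function. The function $g$ on $\mathbb R$ is identified with its analytic continuation, so that $z\mapsto g(z/i)$ restricted to $z=i\tau$ equals $g(\tau)$. *)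

theory Defs
  imports "HOL-Complex_Analysis.Complex_Analysis"
begin

definition weighted_L1 :: "real set \<Rightarrow> (real \<Rightarrow> real) \<Rightarrow> (real \<Rightarrow> complex) set" where
  "weighted_L1 S w = {h. set_integrable lborel S (\<lambda>x. complex_of_real (w x) * h x)}"

text \<open>The power is the principal one, with branch cut along the negative real axis. The value at
  \<open>z = 0\<close> is a dummy one, since \<open>0 powr 0 = 0\<close>; below the argument is always positive. At a pole of
  \<open>Gamma\<close> the convention \<open>Gamma = 0\<close> makes the summand vanish, as it should.\<close>

definition bessel_I :: "complex \<Rightarrow> complex \<Rightarrow> complex" where
  "bessel_I \<nu> z =
     (\<Sum>k. (z / 2) powr (2 * of_nat k + \<nu>) / (fact k * Gamma (of_nat k + \<nu> + 1)))"

definition hyp_2F2 :: "complex \<Rightarrow> complex \<Rightarrow> complex \<Rightarrow> complex \<Rightarrow> complex \<Rightarrow> complex" where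
  "hyp_2F2 a1 a2 b1 b2 t =
     (\<Sum>k. (pochhammer a1 k * pochhammer a2 k) / (pochhammer b1 k * pochhammer b2 k)
          * (t ^ k / fact k))"

definition G_transform :: "(real \<Rightarrow> complex) \<Rightarrow> real \<Rightarrow> complex" where
  "G_transform g t = complex_of_real (sqrt pi * exp (- t / 2)) *
     (LBINT \<tau>. complex_of_real (Re (bessel_I (\<i> * of_real \<tau>) (of_real (t / 2))))
                * g \<tau> / complex_of_real (cosh (pi * \<tau>)))"

definition strip :: "real \<Rightarrow> complex set" where
  "strip \<alpha> = {z. \<bar>Re z\<bar> < \<alpha>}"

text \<open>For real arguments the \<open>hyp_2F2\<close> factor is real, its lower parameters being conjugate.\<close>

definition inversion_kernel :: "real \<Rightarrow> real \<Rightarrow> real \<Rightarrow> complex" where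
  "inversion_kernel \<epsilon> x t =
     complex_of_real ((cmod (Gamma (of_real (\<epsilon> - 1) + \<i> * of_real x)))\<^sup>2 * x * sinh (pi * x)
                        / (pi * sqrt pi * Gamma (\<epsilon> - 1 / 2)))
       * hyp_2F2 1 (of_real (3 / 2 - \<epsilon>))
           (of_real (2 - \<epsilon>) - \<i> * of_real x) (of_real (2 - \<epsilon>) + \<i> * of_real x) (of_real t)
     - complex_of_real (x * exp (t / 2) * t powr (\<epsilon> - 1)
         * Im (bessel_I (\<i> * of_real x) (of_real (t / 2))
               / sin (of_real pi * (of_real \<epsilon> + \<i> * of_real x))))"

end

theory Submission imports Defs begin

text \<open>
  Write \<open>K\<^bsub>iy\<^esub>\<close> for the Macdonald function (\<open>macdonald y\<close> below). Everything rests on two Stieltjes transforms.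
  The kernel of the inversion formula, an unwieldy difference of two functions that both grow exponentially
  in \<open>t\<close>, is in truth a tame object (\<open>inversion_kernel_stieltjes\<close>):
  \<open>inversion_kernel \<epsilon> x t = x sinh(\<pi>x)/\<pi>\<^sup>2 * \<integral>\<^sub>0\<^sup>\<infinity> e\<^bsup>-u/2\<^esup> K\<^bsub>ix\<^esub>(u/2) u\<^bsup>\<epsilon>-1\<^esup> / (t+u) du\<close>.
  The functions that \<open>G_transform\<close> superposes have a Stieltjes transform with the opposite exponential
  (\<open>bessel_stieltjes\<close>):
  \<open>\<integral>\<^sub>0\<^sup>\<infinity> e\<^bsup>-t/2\<^esup> Re I\<^bsub>i\<tau>\<^esub>(t/2) / (t+u) dt = e\<^bsup>u/2\<^esup> K\<^bsub>i\<tau>\<^esub>(u/2)\<close>.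
  Integrating the kernel against \<open>Gg\<close> and exchanging the integrals, the exponentials cancel, and what is
  left is \<open>g(\<tau>)/cosh(\<pi>\<tau>)\<close> integrated against the regularized Kontorovich-Lebedev kernel
  \<open>\<integral>\<^sub>0\<^sup>\<infinity> K\<^bsub>ix\<^esub>(u/2) K\<^bsub>i\<tau>\<^esub>(u/2) u\<^bsup>\<epsilon>-1\<^esup> du\<close> (\<open>inversion_kernel_G_transform\<close>).

  That kernel is a product of four Gamma values (\<open>macdonald_product\<close>), hence, up to a factor that stays
  continuous as \<open>\<epsilon> \<rightarrow> 0\<close>, the product of the Poisson kernels \<open>\<epsilon>/(\<epsilon>\<^sup>2+(x\<mp>\<tau>)\<^sup>2)\<close> divided by \<open>\<epsilon>\<close>.
  For \<open>x \<noteq> 0\<close> it concentrates at \<open>\<tau> = \<plusminus>x\<close> and tends to a multiple of a sum of two point masses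
  (\<open>KL_kernel_approximate_identity\<close>); evenness of \<open>g\<close> merges them. At \<open>x = 0\<close> the inversion kernel vanishes
  identically, and \<open>g(0) = 0\<close>.

  The identity for the inversion kernel is obtained by letting \<open>\<epsilon>\<close> become a complex variable \<open>s\<close>.
  The Stieltjes integral \<open>S(s)\<close> is holomorphic for \<open>Re s > 0\<close>, and \<open>S(s+1) + t S(s)\<close> is a Mellin transform,
  which is a quotient of Gamma values. The hypergeometric series satisfies the same first-order difference equation,
  so the difference of the two, multiplied by \<open>t\<^bsup>1-s\<^esup>\<close> and by a product of two sines that removes all poles,
  changes sign under \<open>s \<mapsto> s+1\<close>. Subtracting two multiples of sines, chosen so that the zeros of the sine product
  are zeros of the result, and dividing by that product leaves a bounded antiperiodic entire function, and that is zero by Liouville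
  (\<open>stieltjes_K_residue_series\<close>). Up to elementary factors the two multiples are values of the series at \<open>1 \<mp> ix\<close>, where
  Kummer's second formula turns it into a modified Bessel function (\<open>residue_series_bessel\<close>).

  The Stieltjes transform of the Bessel function comes from its Laplace transform (\<open>bessel_laplace\<close>), that is,
  from the generating function of the numbers \<open>\<Gamma>(2k+\<nu>+1)/(k! \<Gamma>(k+\<nu>+1))\<close>.

  Integrals over the half-line \<open>u > 0\<close> are written as integrals over \<open>\<real>\<close> with \<open>u = e\<^bsup>v\<^esup>\<close>: Mellin transforms become
  Fourier-Laplace integrals, scaling becomes translation, and no domain has to be carried along.
\<close>

section \<open>Exponential substitution and dominated Fubini\<close>

lemma exp_substitution_real:
  fixes F :: "real \<Rightarrow> real"
  assumes F [measurable]: "F \<in> borel_measurable borel"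
    and int: "integrable lborel (\<lambda>w. exp w * F (exp w))"
  shows "set_integrable lborel {0<..} F"
    and "(LBINT x:{0<..}. F x) = (LBINT w. exp w * F (exp w))"
proof -
  have rng: "exp ` UNIV = {0::real<..}"
    by (auto simp: image_iff) (metis exp_ln)
  have a: "(\<lambda>w. \<bar>exp w\<bar> * F (exp w)) absolutely_integrable_on UNIV"
    using int by (simp add: set_integrable_def integrable_completion)
  have b: "integral UNIV (\<lambda>w. \<bar>exp w\<bar> * F (exp w)) = (LBINT w. exp w * F (exp w))"
    using set_lebesgue_integral_eq_integral(2)[OF a] by (simp add: set_lebesgue_integral_def integral_completion)
  have "F absolutely_integrable_on (exp ` UNIV) \<and> integral (exp ` UNIV) F = (LBINT w. exp w * F (exp w))"
    using a b by (subst has_absolute_integral_change_of_variables_1'[of UNIV exp exp F, symmetric])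
      (auto intro!: derivative_eq_intros simp: inj_on_def)
  then have c: "set_integrable lebesgue {0<..} F" and d: "integral {0<..} F = (LBINT w. exp w * F (exp w))"
    unfolding rng by auto
  show "set_integrable lborel {0<..} F"
    using c unfolding set_integrable_def by (subst (asm) integrable_completion) auto
  have "(LBINT x:{0<..}. F x) = set_lebesgue_integral lebesgue {0<..} F"
    unfolding set_lebesgue_integral_def by (rule integral_completion[symmetric]) auto
  then show "(LBINT x:{0<..}. F x) = (LBINT w. exp w * F (exp w))"
    using set_lebesgue_integral_eq_integral(2)[OF c] d by simp
qed

lemma exp_substitution:
  fixes F :: "real \<Rightarrow> complex"
  assumes F [measurable]: "F \<in> borel_measurable borel"
    and int: "integrable lborel (\<lambda>w. exp w *\<^sub>R F (exp w))"
  shows "set_integrable lborel {0<..} F"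
    and "(LBINT x:{0<..}. F x) = (LBINT w. exp w *\<^sub>R F (exp w))"
proof -
  have re: "integrable lborel (\<lambda>w. exp w * Re (F (exp w)))"
    using integrable_Re[OF int] by simp
  have im: "integrable lborel (\<lambda>w. exp w * Im (F (exp w)))"
    using integrable_Im[OF int] by simp
  note R = exp_substitution_real[of "\<lambda>x. Re (F x)", OF _ re]
  note I = exp_substitution_real[of "\<lambda>x. Im (F x)", OF _ im]
  have e: "indicator {0<..} x *\<^sub>R F x = complex_of_real (indicator {0<..} x *\<^sub>R Re (F x)) +
     \<i> * complex_of_real (indicator {0<..} x *\<^sub>R Im (F x))" for x
    by (simp add: complex_eq_iff)
  show s: "set_integrable lborel {0<..} F"
    unfolding set_integrable_def e using R(1) I(1)
    by (intro Bochner_Integration.integrable_add integrable_mult_right integrable_of_real)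
       (auto simp: set_integrable_def)
  have "Re (LBINT x:{0<..}. F x) = (LBINT w. exp w * Re (F (exp w)))"
    using R(2) unfolding set_lebesgue_integral_def
    by (subst integral_Re[symmetric]) (use s in \<open>auto simp: set_integrable_def\<close>)
  moreover have "Im (LBINT x:{0<..}. F x) = (LBINT w. exp w * Im (F (exp w)))"
    using I(2) unfolding set_lebesgue_integral_def
    by (subst integral_Im[symmetric]) (use s in \<open>auto simp: set_integrable_def\<close>)
  ultimately show "(LBINT x:{0<..}. F x) = (LBINT w. exp w *\<^sub>R F (exp w))"
    using integral_Re[OF int] integral_Im[OF int] by (simp add: complex_eq_iff)
qed

lemma exp_substitution_iff:
  fixes F :: "real \<Rightarrow> complex"
  assumes F [measurable]: "F \<in> borel_measurable borel"
    and int: "set_integrable lborel {0<..} F"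
  shows "integrable lborel (\<lambda>w. exp w *\<^sub>R F (exp w))"
proof -
  have rng: "exp ` UNIV = {0::real<..}"
    by (auto simp: image_iff) (metis exp_ln)
  have *: "integrable lborel (\<lambda>w. exp w * G (exp w))" 
    if G [measurable]: "G \<in> borel_measurable borel" and i: "set_integrable lborel {0<..} G" for G :: "real \<Rightarrow> real"
  proof -
    have "G absolutely_integrable_on (exp ` UNIV)"
      using i unfolding rng set_integrable_def by (subst integrable_completion) auto
    then have "(\<lambda>w. \<bar>exp w\<bar> * G (exp w)) absolutely_integrable_on UNIV"
      using has_absolute_integral_change_of_variables_1'[of UNIV exp exp G "integral (exp ` UNIV) G"]
      by (auto intro!: derivative_eq_intros simp: inj_on_def)
    then show ?thesis by (simp add: set_integrable_def integrable_completion)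
  qed
  have 1: "integrable lborel (\<lambda>w. exp w * Re (F (exp w)))"
    by (rule *) (use int in \<open>auto simp: set_integrable_def dest!: integrable_Re\<close>)
  have 2: "integrable lborel (\<lambda>w. exp w * Im (F (exp w)))"
    by (rule *) (use int in \<open>auto simp: set_integrable_def dest!: integrable_Im\<close>)
  have "integrable lborel (\<lambda>w. complex_of_real (exp w * Re (F (exp w))) + \<i> * complex_of_real (exp w * Im (F (exp w))))"
    by (intro Bochner_Integration.integrable_add integrable_mult_right integrable_of_real 1 2)
  also have "(\<lambda>w. complex_of_real (exp w * Re (F (exp w))) + \<i> * complex_of_real (exp w * Im (F (exp w)))) =
    (\<lambda>w. exp w *\<^sub>R F (exp w))"
    by (auto simp: complex_eq_iff)
  finally show ?thesis .
qed

text \<open>Fubini's theorem in the form in which it is used throughout: absolute integrability is checked on a majorant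
  \<open>D\<close> whose inner integral is known or bounded by an integrable \<open>E\<close>.\<close>

lemma fubini_dominated:
  fixes f :: "real \<Rightarrow> real \<Rightarrow> 'a :: {banach, second_countable_topology}"
  assumes f [measurable]: "case_prod f \<in> borel_measurable (borel \<Otimes>\<^sub>M borel)"
    and D: "\<And>x. integrable lborel (D x)" "\<And>x y. norm (f x y) \<le> D x y"
    and E: "\<And>x. (LBINT y. D x y) \<le> E x" "integrable lborel E"
  shows "integrable lborel (\<lambda>x. LBINT y. f x y)"
    and "integrable lborel (\<lambda>y. LBINT x. f x y)"
    and "(LBINT x. LBINT y. f x y) = (LBINT y. LBINT x. f x y)"
proof -
  have m: "case_prod f \<in> borel_measurable (lborel \<Otimes>\<^sub>M lborel)" by simp
  have i2: "integrable lborel (\<lambda>y. f x y)" for x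
    by (rule Bochner_Integration.integrable_bound[OF D(1)[of x]]) (use order_trans[OF D(2)[of x] abs_ge_self] in auto)
  have i1: "integrable lborel (\<lambda>x. LBINT y. norm (f x y))"
  proof (rule Bochner_Integration.integrable_bound[OF E(2)])
    show "AE x in lborel. norm (LBINT y. norm (f x y)) \<le> norm (E x)"
    proof (rule AE_I2)
      fix x
      have "(LBINT y. norm (f x y)) \<le> (LBINT y. D x y)"
        by (rule integral_mono) (use i2 D in \<open>auto\<close>)
      also have "\<dots> \<le> E x" by (rule E)
      finally have a: "(LBINT y. norm (f x y)) \<le> E x" .
      have "0 \<le> (LBINT y. norm (f x y))" by (rule Bochner_Integration.integral_nonneg) auto
      with a show "norm (LBINT y. norm (f x y)) \<le> norm (E x)" by simp
    qed
  qed simp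
  have i: "integrable (lborel \<Otimes>\<^sub>M lborel) (case_prod f)"
    by (rule lborel_pair.Fubini_integrable[OF m]) (use i1 i2 in auto)
  show "integrable lborel (\<lambda>x. LBINT y. f x y)" using lborel_pair.integrable_fst[OF i] by simp
  show "integrable lborel (\<lambda>y. LBINT x. f x y)" using lborel_pair.integrable_snd[OF i] by simp
  show "(LBINT x. LBINT y. f x y) = (LBINT y. LBINT x. f x y)" using lborel_pair.Fubini_integral[OF i] by simp
qed

section \<open>Gamma and Beta integrals on the real line\<close>

lemma Re_pos_not_nonpos_Int:
  fixes z :: complex
  assumes "Re z > 0"
  shows "z \<notin> \<int>\<^sub>\<le>\<^sub>0"
proof
  assume "z \<in> \<int>\<^sub>\<le>\<^sub>0"
  then obtain n where "z = of_int n" "n \<le> 0" by (rule nonpos_Ints_cases)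
  with assms show False by simp
qed

lemma powr_exp_real: "complex_of_real (exp w) powr s = exp (s * of_real w)"
  unfolding powr_def Ln_of_real[OF exp_gt_zero] by simp

lemma Gamma_exp_integral_1:
  assumes p: "Re p > 0"
  shows "integrable lborel (\<lambda>v. exp (p * of_real v) * of_real (exp (- exp v)))"
    and "(LBINT v. exp (p * of_real v) * of_real (exp (- exp v))) = Gamma p"
proof -
  let ?F = "\<lambda>t. complex_of_real t powr (p - 1) / of_real (exp t)"
  have m [measurable]: "?F \<in> borel_measurable borel" unfolding powr_def by measurable
  have s: "set_integrable lborel {0<..} ?F"
    using absolutely_integrable_Gamma_integral'[OF p] unfolding set_integrable_def
    by (subst (asm) integrable_completion) auto
  have v: "(LBINT t:{0<..}. ?F t) = Gamma p"
    using Gamma_integral_complex'[OF p] set_borel_integral_eq_integral(2)[OF s] integral_unique by metis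
  have e: "exp v *\<^sub>R ?F (exp v) = exp (p * of_real v) * of_real (exp (- exp v))" for v
    unfolding powr_exp_real scaleR_conv_of_real
    by (simp add: exp_minus divide_inverse ring_distribs exp_diff exp_of_real)
  note i = exp_substitution_iff[OF m s]
  show "integrable lborel (\<lambda>v. exp (p * of_real v) * of_real (exp (- exp v)))"
    using i unfolding e .
  show "(LBINT v. exp (p * of_real v) * of_real (exp (- exp v))) = Gamma p"
    using exp_substitution(2)[OF m i] v unfolding e by simp
qed

lemma Gamma_exp_integral:
  assumes p: "Re p > 0" and a: "a > 0"
  shows "integrable lborel (\<lambda>v. exp (p * of_real v) * of_real (exp (- a * exp v)))"
    and "(LBINT v. exp (p * of_real v) * of_real (exp (- a * exp v))) = Gamma p * of_real a powr (- p)"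
proof -
  let ?f = "\<lambda>v. exp (p * of_real v) * complex_of_real (exp (- exp v))"
  have e: "exp (p * of_real v) * complex_of_real (exp (- a * exp v)) = of_real a powr (- p) * ?f (ln a + 1 * v)" for v
    using a by (simp add: exp_add powr_def Ln_of_real field_simps exp_minus)
  show "integrable lborel (\<lambda>v. exp (p * of_real v) * of_real (exp (- a * exp v)))"
    unfolding e by (intro integrable_mult_right lborel_integrable_real_affine Gamma_exp_integral_1 p) auto
  have "(LBINT v. exp (p * of_real v) * of_real (exp (- a * exp v))) = of_real a powr (- p) * (LBINT v. ?f (ln a + 1 * v))"
    unfolding e by simp
  also have "(LBINT v. ?f (ln a + 1 * v)) = (LBINT v. ?f v)"
    using lborel_integral_real_affine[of 1 ?f "ln a"] by simp
  finally show "(LBINT v. exp (p * of_real v) * of_real (exp (- a * exp v))) = Gamma p * of_real a powr (- p)"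
    using Gamma_exp_integral_1(2)[OF p] by simp
qed

lemma Gamma_exp_integral_real:
  fixes p a :: real
  assumes p: "p > 0" and a: "a > 0"
  shows "integrable lborel (\<lambda>v. exp (p * v) * exp (- a * exp v))"
    and "(LBINT v. exp (p * v) * exp (- a * exp v)) = Gamma p * a powr (- p)"
proof -
  have e: "exp (complex_of_real p * of_real v) * of_real (exp (- a * exp v)) = complex_of_real (exp (p * v) * exp (- a * exp v))" for v
    by (simp flip: exp_of_real)
  have "integrable lborel (\<lambda>v. complex_of_real (exp (p * v) * exp (- a * exp v)))"
    using Gamma_exp_integral(1)[of "of_real p", OF _ a] p unfolding e by simp
  then show "integrable lborel (\<lambda>v. exp (p * v) * exp (- a * exp v))"
    using complex_of_real_integrable_eq by blast
  have "complex_of_real (LBINT v. exp (p * v) * exp (- a * exp v)) = Gamma (of_real p) * of_real a powr (- of_real p)"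
    using Gamma_exp_integral(2)[of "of_real p", OF _ a] p unfolding e by (simp only: integral_complex_of_real) simp
  also have "\<dots> = of_real (Gamma p * a powr (-p))"
    using a by (simp add: Gamma_complex_of_real powr_of_real[symmetric])
  finally show "(LBINT v. exp (p * v) * exp (- a * exp v)) = Gamma p * a powr (- p)"
    using of_real_eq_iff by blast
qed

text \<open>The Beta integral \<open>\<integral>\<^sub>0\<^sup>\<infinity> w\<^bsup>p-1\<^esup> (1+w)\<^bsup>-p-q\<^esup> dw\<close> with \<open>w = e\<^bsup>s\<^esup>\<close>, for complex parameters. Expand \<open>\<Gamma>(p)\<Gamma>(q)\<close>
  as a double integral, shift the inner variable by the outer one, and integrate in the other order.\<close>

lemma Beta_exp_integral:
  assumes p: "Re p > 0" and q: "Re q > 0"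
  shows "integrable lborel (\<lambda>s. exp (p * of_real s) * of_real (1 + exp s) powr (- (p + q)))" (is ?i)
    and "(LBINT s. exp (p * of_real s) * of_real (1 + exp s) powr (- (p + q))) = Gamma p * Gamma q / Gamma (p + q)"
proof -
  define f where "f = (\<lambda>v s. exp ((p + q) * of_real v) * exp (p * of_real s) * complex_of_real (exp (- (1 + exp s) * exp v)))"
  define D where "D = (\<lambda>v s. exp ((Re p + Re q) * v) * exp (Re p * s) * exp (- (1 + exp s) * exp v))"
  have m: "case_prod f \<in> borel_measurable (borel \<Otimes>\<^sub>M borel)"
    unfolding f_def by (simp add: case_prod_beta) measurable
  have Dn: "norm (f v s) \<le> D v s" for v s
    by (simp add: f_def D_def norm_mult)
  have De: "D v s = exp ((Re p + Re q) * v) * exp (- exp v) * (exp (Re p * s) * exp (- exp v * exp s))" for v s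
    by (simp add: D_def exp_add[symmetric] algebra_simps)
  have Di: "integrable lborel (D v)" for v
    unfolding De by (intro integrable_mult_right Gamma_exp_integral_real p) auto
  have DE: "(LBINT s. D v s) = Gamma (Re p) * (exp (Re q * v) * exp (- 1 * exp v))" for v
  proof -
    have "exp ((Re p + Re q) * v) * exp v powr - Re p = exp (Re q * v)"
      unfolding exp_powr_real exp_add[symmetric] by (simp add: algebra_simps)
    then show ?thesis
      unfolding De integral_mult_right_zero Gamma_exp_integral_real(2)[OF p exp_gt_zero]
      by (simp add: mult_ac)
  qed
  have Ei: "integrable lborel (\<lambda>v. Gamma (Re p) * (exp (Re q * v) * exp (- 1 * exp v)))"
    by (intro integrable_mult_right Gamma_exp_integral_real q) auto
  note fub = fubini_dominated[OF m Di Dn eq_refl[OF DE] Ei]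
  have fs: "(LBINT s. f v s) = Gamma p * (exp (q * of_real v) * of_real (exp (- exp v)))" for v
  proof -
    have "f v s = exp ((p + q) * of_real v) * of_real (exp (- exp v)) * (exp (p * of_real s) * of_real (exp (- exp v * exp s)))" for s
    proof -
      have "exp (- (1 + exp s) * exp v) = exp (- exp v) * exp (- exp v * exp s)"
        unfolding exp_add[symmetric] by (simp add: algebra_simps)
      then show ?thesis by (simp add: f_def mult_ac del: of_real_exp mult_minus_left)
    qed
    then have "(LBINT s. f v s) = exp ((p + q) * of_real v) * of_real (exp (- exp v)) * (Gamma p * of_real (exp v) powr (- p))"
      using Gamma_exp_integral(2)[OF p, of "exp v"] by simp
    also have "\<dots> = Gamma p * ((exp ((p + q) * of_real v) * exp (- p * of_real v)) * of_real (exp (- exp v)))"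
      unfolding powr_exp_real by (simp only: mult_ac)
    also have "exp ((p + q) * of_real v) * exp (- p * of_real v) = exp (q * of_real v)"
      unfolding exp_add[symmetric] by (simp add: algebra_simps)
    finally show ?thesis .
  qed
  have fv: "(LBINT v. f v s) = Gamma (p + q) * (exp (p * of_real s) * of_real (1 + exp s) powr (- (p + q)))" for s
  proof -
    have "f v s = exp (p * of_real s) * (exp ((p + q) * of_real v) * of_real (exp (- (1 + exp s) * exp v)))" for v
      by (simp add: f_def)
    then have "(LBINT v. f v s) = exp (p * of_real s) * (Gamma (p + q) * of_real (1 + exp s) powr (- (p + q)))"
      using Gamma_exp_integral(2)[of "p + q" "1 + exp s"] p q by (simp add: add_pos_pos)
    then show ?thesis by simp
  qed
  have nz: "Gamma (p + q) \<noteq> 0"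
    using Re_pos_not_nonpos_Int[of "p + q"] p q by (simp add: Gamma_eq_zero_iff)
  have "integrable lborel (\<lambda>s. 1 / Gamma (p + q) * (Gamma (p + q) * (exp (p * of_real s) * of_real (1 + exp s) powr (- (p + q)))))"
    using fub(2) unfolding fv by (rule integrable_mult_right)
  then show ?i using nz by simp
  show "(LBINT s. exp (p * of_real s) * of_real (1 + exp s) powr (- (p + q))) = Gamma p * Gamma q / Gamma (p + q)"
    using fub(3) Gamma_exp_integral_1(2)[OF q] nz unfolding fv fs by (simp add: field_simps)
qed

text \<open>The Beta integral with parameters \<open>s \<plusminus> iy\<close>: the factor \<open>e\<^bsup>sa\<^esup>\<close> makes \<open>(1+e\<^bsup>a\<^esup>)\<^bsup>-2s\<^esup>\<close> symmetric, so this is the Fourier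
  transform of a power of the hyperbolic secant. All Gamma quotients of this development arise from it.\<close>

lemma sech_fourier:
  assumes s: "Re s > 0"
  shows "integrable lborel (\<lambda>a. exp (\<i> * of_real (y * a)) * of_real (2 * cosh (a / 2)) powr (- 2 * s))" (is ?i)
    and "(LBINT a. exp (\<i> * of_real (y * a)) * of_real (2 * cosh (a / 2)) powr (- 2 * s))
          = Gamma (s + \<i> * of_real y) * Gamma (s - \<i> * of_real y) / Gamma (2 * s)"
proof -
  let ?p = "s + \<i> * of_real y" and ?q = "s - \<i> * of_real y"
  have pq: "?p + ?q = 2 * s" by simp
  have e: "exp (?p * of_real a) * of_real (1 + exp a) powr (- (2 * s)) =
     exp (\<i> * of_real (y * a)) * of_real (2 * cosh (a / 2)) powr (- 2 * s)" for a :: real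
  proof -
    have ln: "ln (1 + exp a) = a / 2 + ln (2 * cosh (a / 2))"
    proof -
      have "1 + exp a = exp (a / 2) * (2 * cosh (a / 2))"
        by (simp add: cosh_def exp_add[symmetric] algebra_simps)
      then show ?thesis using cosh_real_pos[of "a/2"] by (simp add: ln_mult)
    qed
    have "of_real (1 + exp a) powr (- (2 * s)) = exp (- (2 * s) * of_real (ln (1 + exp a)))"
      using Ln_of_real[of "1 + exp a"] by (simp add: powr_def add_pos_pos)
         (metis add_pos_pos exp_gt_zero less_irrefl of_real_1 of_real_add of_real_eq_0_iff zero_less_one)
    also have "\<dots> = exp (- s * of_real a) * exp (- (2 * s) * of_real (ln (2 * cosh (a / 2))))"
      unfolding ln by (simp add: exp_add[symmetric] algebra_simps)
    also have "exp (- (2 * s) * of_real (ln (2 * cosh (a / 2)))) = of_real (2 * cosh (a / 2)) powr (- (2 * s))"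
      using cosh_real_pos[of "a/2"] Ln_of_real[of "2 * cosh (a/2)"] by (simp add: powr_def)
    finally show ?thesis
      by (simp add: algebra_simps exp_add exp_minus)
  qed
  have "Re ?p > 0" "Re ?q > 0" using s by auto
  from Beta_exp_integral[OF this, unfolded pq e] show ?i
    "(LBINT a. exp (\<i> * of_real (y * a)) * of_real (2 * cosh (a / 2)) powr (- 2 * s))
          = Gamma (s + \<i> * of_real y) * Gamma (s - \<i> * of_real y) / Gamma (2 * s)" by auto
qed

section \<open>The Macdonald function and its Mellin transform\<close>

lemma measurable_real_trig [measurable]:
  fixes f :: "'a \<Rightarrow> real"
  assumes [measurable]: "f \<in> borel_measurable M"
  shows "(\<lambda>x. cosh (f x)) \<in> borel_measurable M" "(\<lambda>x. sinh (f x)) \<in> borel_measurable M"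
    "(\<lambda>x. cos (f x)) \<in> borel_measurable M"
proof -
  have [measurable]: "cosh \<in> borel_measurable (borel :: real measure)" "sinh \<in> borel_measurable (borel :: real measure)"
    "cos \<in> borel_measurable (borel :: real measure)"
    by (auto intro!: borel_measurable_continuous_onI continuous_intros)
  show "(\<lambda>x. cosh (f x)) \<in> borel_measurable M" "(\<lambda>x. sinh (f x)) \<in> borel_measurable M"
    "(\<lambda>x. cos (f x)) \<in> borel_measurable M" by measurable
qed

text \<open>\<open>macdonald \<tau> z\<close> is \<open>K\<^bsub>i\<tau>\<^esub>(z)\<close>, the Macdonald function (modified Bessel function of the second kind) of imaginary order.
  The integral over the whole line, instead of twice the one over the half-line, allows \<open>cos(\<tau>s)\<close> to be replaced by
  \<open>e\<^bsup>i\<tau>s\<^esup>\<close> and allows translations of \<open>s\<close>.\<close>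

definition macdonald :: "real \<Rightarrow> real \<Rightarrow> real" where
  "macdonald \<tau> z = (LBINT s. exp (- z * cosh s) * cos (\<tau> * s)) / 2"

lemma measurable_macdonald [measurable]:
  assumes [measurable]: "f \<in> borel_measurable M" "g \<in> borel_measurable M"
  shows "(\<lambda>w. macdonald (f w) (g w)) \<in> borel_measurable M"
  unfolding macdonald_def by measurable

lemma integrable_reflect_real:
  fixes f :: "real \<Rightarrow> 'a :: {banach, second_countable_topology}"
  assumes "integrable lborel f"
  shows "integrable lborel (\<lambda>x. f (- x))"
  using lborel_integrable_real_affine[OF assms, of "-1" 0] by simp

lemma integral_odd_eq_0:
  fixes f :: "real \<Rightarrow> real"
  assumes "\<And>x. f (- x) = - f x"
  shows "(LBINT x. f x) = 0"
  using lborel_integral_real_affine[of "-1" f 0] assms by simp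

text \<open>On the half-line \<open>s \<ge> 0\<close> the function lies below \<open>e\<^sup>s exp(-(z/2) e\<^sup>s)\<close>, an integrand of \<open>\<Gamma>(1)\<close>; the other
  half-line is its mirror image.\<close>

lemma integrable_exp_minus_cosh:
  fixes z :: real
  assumes z: "z > 0"
  shows "integrable lborel (\<lambda>s. exp (- z * cosh s))"
proof -
  define f where "f = (\<lambda>s::real. exp (1 * s) * exp (- (z / 2) * exp s))"
  have f: "integrable lborel f"
    unfolding f_def using z by (intro Gamma_exp_integral_real) auto
  have b: "exp (- z * cosh s) \<le> f s + f (- s)" for s
  proof -
    have *: "exp (- z * cosh s) \<le> f s" if "s \<ge> 0" for s
    proof -
      have "exp s / 2 \<le> cosh s" by (simp add: cosh_def)
      then have "- z * cosh s \<le> - z * (exp s / 2)" using z by simp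
      then have "exp (- z * cosh s) \<le> 1 * exp (- (z / 2) * exp s)" by simp
      also have "\<dots> \<le> f s" unfolding f_def using that by (intro mult_right_mono) auto
      finally show ?thesis .
    qed
    have pos: "f s \<ge> 0" for s by (simp add: f_def)
    show ?thesis using *[of s] *[of "- s"] pos[of s] pos[of "- s"] by (cases "s \<ge> 0") (auto simp: )
  qed
  show ?thesis
    by (rule Bochner_Integration.integrable_bound[OF Bochner_Integration.integrable_add[OF f integrable_reflect_real[OF f]]])
      (use order_trans[OF b abs_ge_self] in auto)
qed

lemma macdonald_complex:
  assumes z: "z > 0"
  shows "integrable lborel (\<lambda>s. exp (\<i> * of_real (\<tau> * s)) * of_real (exp (- z * cosh s)))"
    and "complex_of_real (macdonald \<tau> z) = (LBINT s. exp (\<i> * of_real (\<tau> * s)) * of_real (exp (- z * cosh s))) / 2"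
proof -
  let ?f = "\<lambda>s. exp (\<i> * of_real (\<tau> * s)) * complex_of_real (exp (- z * cosh s))"
  show i: "integrable lborel ?f"
    by (rule Bochner_Integration.integrable_bound[OF integrable_exp_minus_cosh[OF z]]) (auto simp: norm_mult)
  have "Re (LBINT s. ?f s) = 2 * macdonald \<tau> z"
    unfolding integral_Re[OF i, symmetric] by (simp add: macdonald_def Re_exp mult.commute)
  moreover have "Im (LBINT s. ?f s) = 0"
    unfolding integral_Im[OF i, symmetric] by (rule integral_odd_eq_0) (simp add: Im_exp)
  ultimately show "complex_of_real (macdonald \<tau> z) = (LBINT s. ?f s) / 2"
    by (simp add: complex_eq_iff)
qed

lemma macdonald_0_nonneg: "macdonald 0 z \<ge> 0"
  unfolding macdonald_def by (auto intro!: Bochner_Integration.integral_nonneg)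

lemma abs_macdonald_le:
  assumes z: "z > 0"
  shows "\<bar>macdonald \<tau> z\<bar> \<le> macdonald 0 z"
proof -
  have "norm (LBINT s. exp (\<i> * of_real (\<tau> * s)) * complex_of_real (exp (- z * cosh s)))
      \<le> (LBINT s. norm (exp (\<i> * of_real (\<tau> * s)) * complex_of_real (exp (- z * cosh s))))"
    by (rule integral_norm_bound)
  also have "\<dots> = (LBINT s. exp (- z * cosh s))" by (simp add: norm_mult)
  finally have "norm (complex_of_real (macdonald \<tau> z)) \<le> (LBINT s. exp (- z * cosh s)) / 2"
    unfolding macdonald_complex(2)[OF z] norm_divide by simp
  then show ?thesis by (simp add: macdonald_def)
qed

lemma cosh_half: "(1 + cosh s) / 2 = (2 * cosh (s / 2))\<^sup>2 / 4" for s :: real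
proof -
  have "cosh s = cosh (s/2 + s/2)" by simp
  also have "\<dots> = 2 * (cosh (s/2))\<^sup>2 - 1"
    unfolding cosh_add using cosh_square_eq[of "s/2"] by (simp add: power2_eq_square)
  finally show ?thesis by (simp add: power_mult_distrib)
qed

lemma cosh_half_powr:
  "complex_of_real ((1 + cosh s) / 2) powr (- S) = 4 powr S * of_real (2 * cosh (s / 2)) powr (- 2 * S)"
proof -
  let ?c = "2 * cosh (s / 2)"
  have c: "?c > 0" by simp
  have "complex_of_real ((1 + cosh s) / 2) powr (- S) = exp (- S * of_real (ln (?c\<^sup>2 / 4)))"
    unfolding cosh_half using c Ln_of_real[of "?c\<^sup>2/4"] by (simp add: powr_def del: of_real_mult of_real_divide of_real_power)
  also have "ln (?c\<^sup>2 / 4) = 2 * ln ?c - ln 4"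
    using c ln_realpow[of ?c 2] by (subst ln_div) (auto simp del: power_mult_distrib)
  also have "exp (- S * of_real (2 * ln ?c - ln 4)) = exp (S * of_real (ln 4)) * exp (- 2 * S * of_real (ln ?c))"
    unfolding exp_add[symmetric] by (simp add: algebra_simps)
  also have "\<dots> = 4 powr S * of_real ?c powr (- 2 * S)"
    using c Ln_of_real[OF c] Ln_of_real[of 4] by (simp add: powr_def del: of_real_mult)
  finally show ?thesis .
qed

lemma sech_integrable_real:
  fixes \<sigma> :: real
  assumes s: "\<sigma> > 0"
  shows "integrable lborel (\<lambda>a. ((1 + cosh a) / 2) powr (- \<sigma>))"
proof -
  have "integrable lborel (\<lambda>a. 4 powr (complex_of_real \<sigma>) * (exp (\<i> * of_real (0 * a)) * of_real (2 * cosh (a / 2)) powr (- 2 * complex_of_real \<sigma>)))"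
    by (intro integrable_mult_right sech_fourier) (use s in simp)
  also have "(\<lambda>a. 4 powr (complex_of_real \<sigma>) * (exp (\<i> * of_real (0 * a)) * of_real (2 * cosh (a / 2)) powr (- 2 * complex_of_real \<sigma>)))
    = (\<lambda>a. complex_of_real (((1 + cosh a) / 2) powr (- \<sigma>)))"
  proof
    fix a :: real
    have "0 \<le> (1 + cosh a) / 2" using cosh_real_ge_1[of a] by simp
    from powr_of_real[OF this, of "- \<sigma>"] cosh_half_powr[of a "of_real \<sigma>"]
    show "4 powr (complex_of_real \<sigma>) * (exp (\<i> * of_real (0 * a)) * of_real (2 * cosh (a / 2)) powr (- 2 * complex_of_real \<sigma>))
      = complex_of_real (((1 + cosh a) / 2) powr (- \<sigma>))" by simp
  qed
  finally show ?thesis using complex_of_real_integrable_eq by blast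
qed

text \<open>Insert the integral for \<open>K\<^bsub>ix\<^esub>\<close> and integrate over \<open>v\<close> first, which is a Gamma integral. The parameter \<open>c\<close>
  serves two purposes: \<open>c = 1/2\<close> gives the Mellin transform of \<open>e\<^bsup>-u/2\<^esup>K\<^bsub>ix\<^esub>(u/2)\<close>, and \<open>c = cosh(s)/2\<close> is the inner integral
  of the product of two Macdonald functions.\<close>

lemma macdonald_mellin_exp:
  assumes S: "Re S > 0" and c: "c \<ge> 1 / 2"
  shows "integrable lborel (\<lambda>v. exp (S * of_real v) * of_real (exp (- c * exp v)) * of_real (macdonald x (exp v / 2)))"
    and "(LBINT v. exp (S * of_real v) * of_real (exp (- c * exp v)) * of_real (macdonald x (exp v / 2)))
      = Gamma S / 2 * (LBINT s. exp (\<i> * of_real (x * s)) * of_real (c + cosh s / 2) powr (- S))"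
    and "integrable lborel (\<lambda>s. exp (\<i> * of_real (x * s)) * of_real (c + cosh s / 2) powr (- S))"
proof -
  define f where "f = (\<lambda>s v. exp (S * of_real v) * exp (\<i> * of_real (x * s)) * complex_of_real (exp (- (c + cosh s / 2) * exp v)))"
  define D where "D = (\<lambda>s v. exp (Re S * v) * exp (- (c + cosh s / 2) * exp v))"
  have pos: "c + cosh s / 2 > 0" for s using c cosh_real_ge_1[of s] by linarith
  have m: "case_prod f \<in> borel_measurable (borel \<Otimes>\<^sub>M borel)"
    unfolding f_def by (simp add: case_prod_beta) measurable
  have Dn: "norm (f s v) \<le> D s v" for v s
    by (simp add: f_def D_def norm_mult)
  have Di: "integrable lborel (D s)" for s
    unfolding D_def by (intro Gamma_exp_integral_real S pos)
  have DE: "(LBINT v. D s v) \<le> Gamma (Re S) * ((1 + cosh s) / 2) powr (- Re S)" for s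
  proof -
    have "(LBINT v. D s v) = Gamma (Re S) * (c + cosh s / 2) powr (- Re S)"
      unfolding D_def by (rule Gamma_exp_integral_real(2)[OF S pos])
    also have "\<dots> \<le> Gamma (Re S) * ((1 + cosh s) / 2) powr (- Re S)"
      using S c cosh_real_ge_1[of s] Gamma_real_pos[OF S] by (intro mult_left_mono powr_mono2') (auto simp: add_divide_distrib)
    finally show ?thesis .
  qed
  have Ei: "integrable lborel (\<lambda>s. Gamma (Re S) * ((1 + cosh s) / 2) powr (- Re S))"
    by (intro integrable_mult_right sech_integrable_real S)
  note fub = fubini_dominated[OF m Di Dn DE Ei]
  have fv: "(LBINT v. f s v) = Gamma S * (exp (\<i> * of_real (x * s)) * of_real (c + cosh s / 2) powr (- S))" for s
  proof -
    have "(LBINT v. f s v) = (LBINT v. exp (\<i> * of_real (x * s)) * (exp (S * of_real v) * of_real (exp (- (c + cosh s / 2) * exp v))))"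
      by (simp add: f_def mult_ac)
    also have "\<dots> = exp (\<i> * of_real (x * s)) * (Gamma S * of_real (c + cosh s / 2) powr (- S))"
      unfolding integral_mult_right_zero Gamma_exp_integral(2)[OF S pos] ..
    finally show ?thesis by (simp add: mult_ac)
  qed
  have fs: "(LBINT s. f s v) = 2 * (exp (S * of_real v) * of_real (exp (- c * exp v)) * of_real (macdonald x (exp v / 2)))" for v
  proof -
    have p: "exp v / 2 > 0" by simp
    have "exp (- (c + cosh s / 2) * exp v) = exp (- c * exp v) * exp (- (exp v / 2) * cosh s)" for s
      unfolding exp_add[symmetric] by (simp add: algebra_simps)
    then have "(LBINT s. f s v) = (LBINT s. (exp (S * of_real v) * of_real (exp (- c * exp v))) * (exp (\<i> * of_real (x * s)) * of_real (exp (- (exp v / 2) * cosh s))))"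
      by (simp add: f_def mult_ac del: of_real_exp)
    also have "\<dots> = (exp (S * of_real v) * of_real (exp (- c * exp v))) * (2 * of_real (macdonald x (exp v / 2)))"
      unfolding integral_mult_right_zero macdonald_complex(2)[OF p] by simp
    finally show ?thesis by (simp add: mult_ac)
  qed
  have nz: "Gamma S \<noteq> 0" using Re_pos_not_nonpos_Int[OF S] by (simp add: Gamma_eq_zero_iff)
  from fub(2) have "integrable lborel (\<lambda>v. 1/2 * (2 * (exp (S * of_real v) * of_real (exp (- c * exp v)) * of_real (macdonald x (exp v / 2)))))"
    unfolding fs by (rule integrable_mult_right)
  then show "integrable lborel (\<lambda>v. exp (S * of_real v) * of_real (exp (- c * exp v)) * of_real (macdonald x (exp v / 2)))"
    by simp
  from fub(1) have "integrable lborel (\<lambda>s. 1 / Gamma S * (Gamma S * (exp (\<i> * of_real (x * s)) * of_real (c + cosh s / 2) powr (- S))))"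
    unfolding fv by (rule integrable_mult_right)
  then show "integrable lborel (\<lambda>s. exp (\<i> * of_real (x * s)) * of_real (c + cosh s / 2) powr (- S))"
    using nz by simp
  show "(LBINT v. exp (S * of_real v) * of_real (exp (- c * exp v)) * of_real (macdonald x (exp v / 2)))
      = Gamma S / 2 * (LBINT s. exp (\<i> * of_real (x * s)) * of_real (c + cosh s / 2) powr (- S))"
    using fub(3) unfolding fv fs integral_mult_right_zero by simp
qed

text \<open>The Mellin transform of \<open>e\<^bsup>-u/2\<^esup> K\<^bsub>ix\<^esub>(u/2)\<close>; see \<open>macdonald_mellin\<close>.\<close>

definition mellin_K :: "real \<Rightarrow> complex \<Rightarrow> complex" where
  "mellin_K x S = of_real (sqrt pi) * Gamma (S + \<i> * of_real x) * Gamma (S - \<i> * of_real x) * rGamma (S + 1 / 2)"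

text \<open>The integral left by \<open>macdonald_mellin_exp\<close> is \<open>sech_fourier\<close>, because \<open>(1 + cosh s)/2 = cosh\<^sup>2(s/2)\<close>;
  Legendre's duplication formula absorbs \<open>\<Gamma>(2S)\<close>.\<close>

lemma macdonald_mellin:
  assumes S: "Re S > 0"
  shows "(LBINT v. exp (S * of_real v) * of_real (exp (- (1 / 2) * exp v)) * of_real (macdonald x (exp v / 2))) = mellin_K x S"
proof -
  have "(LBINT v. exp (S * of_real v) * of_real (exp (- (1 / 2) * exp v)) * of_real (macdonald x (exp v / 2)))
      = Gamma S / 2 * (LBINT s. exp (\<i> * of_real (x * s)) * of_real (1 / 2 + cosh s / 2) powr (- S))"
    by (rule macdonald_mellin_exp(2)[OF S]) simp
  also have "(LBINT s. exp (\<i> * of_real (x * s)) * of_real (1 / 2 + cosh s / 2) powr (- S))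
     = (LBINT s. 4 powr S * (exp (\<i> * of_real (x * s)) * of_real (2 * cosh (s / 2)) powr (- 2 * S)))"
    using cosh_half_powr[of _ S] by (simp add: add_divide_distrib mult_ac)
  also have "\<dots> = 4 powr S * (Gamma (S + \<i> * of_real x) * Gamma (S - \<i> * of_real x) / Gamma (2 * S))"
    unfolding integral_mult_right_zero sech_fourier(2)[OF S] ..
  also have "Gamma S / 2 * (4 powr S * (Gamma (S + \<i> * of_real x) * Gamma (S - \<i> * of_real x) / Gamma (2 * S))) = mellin_K x S"
  proof -
    have a: "S \<notin> \<int>\<^sub>\<le>\<^sub>0" "S + 1/2 \<notin> \<int>\<^sub>\<le>\<^sub>0" "2 * S \<notin> \<int>\<^sub>\<le>\<^sub>0"
      using S by (auto intro!: Re_pos_not_nonpos_Int)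
    have n: "Gamma (S + 1/2) \<noteq> 0" "Gamma (2 * S) \<noteq> 0" using a by (simp_all add: Gamma_eq_zero_iff)
    have "Gamma S * Gamma (S + 1 / 2) = exp ((1 - 2 * S) * of_real (ln 2)) * of_real (sqrt pi) * Gamma (2 * S)"
      by (rule Gamma_legendre_duplication) (use a in auto)
    then have d: "Gamma S / Gamma (2 * S) = exp ((1 - 2 * S) * of_real (ln 2)) * of_real (sqrt pi) * rGamma (S + 1 / 2)"
      using n by (simp add: rGamma_inverse_Gamma field_simps)
    have l4: "ln 4 = 2 * ln (2::real)" using ln_realpow[of 2 2] by simp
    have "4 powr S = exp (S * of_real (2 * ln 2))"
      using Ln_of_real[of 4] l4 by (simp add: powr_def)
    then have "4 powr S * exp ((1 - 2 * S) * of_real (ln 2)) = exp (of_real (ln 2))"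
      by (simp add: exp_add[symmetric] algebra_simps)
    also have "\<dots> = 2" by (simp add: exp_of_real)
    finally have e: "4 powr S * exp ((1 - 2 * S) * of_real (ln 2)) = 2" .
    have "Gamma S / 2 * (4 powr S * (Gamma (S + \<i> * of_real x) * Gamma (S - \<i> * of_real x) / Gamma (2 * S)))
      = Gamma S / Gamma (2 * S) * (4 powr S / 2) * Gamma (S + \<i> * of_real x) * Gamma (S - \<i> * of_real x)"
      by (simp add: mult_ac)
    also have "\<dots> = (4 powr S * exp ((1 - 2 * S) * of_real (ln 2))) / 2 * of_real (sqrt pi) * rGamma (S + 1 / 2) * Gamma (S + \<i> * of_real x) * Gamma (S - \<i> * of_real x)"
      unfolding d by simp
    also have "\<dots> = mellin_K x S" unfolding e by (simp add: mellin_K_def)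
    finally show ?thesis .
  qed
  finally show ?thesis .
qed

lemma macdonald_0_mellin_integrable:
  fixes \<sigma> :: real
  assumes s: "\<sigma> > 0"
  shows "integrable lborel (\<lambda>v. exp (\<sigma> * v) * exp (- (1 / 2) * exp v) * macdonald 0 (exp v / 2))"
proof -
  have "integrable lborel (\<lambda>v. norm (exp (of_real \<sigma> * of_real v) * complex_of_real (exp (- (1 / 2) * exp v)) * of_real (macdonald 0 (exp v / 2))))"
    using s by (intro integrable_norm macdonald_mellin_exp(1)) auto
  then show ?thesis by (simp add: norm_mult macdonald_0_nonneg)
qed

section \<open>The Mellin transform of a product of Macdonald functions\<close>

lemma sech_fourier_real:
  fixes \<epsilon> y :: real
  assumes e: "\<epsilon> > 0"
  shows "integrable lborel (\<lambda>a. exp (\<i> * of_real (y * a)) * complex_of_real (cosh (a / 2) powr (- \<epsilon>)))"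
    and "(LBINT a. exp (\<i> * of_real (y * a)) * complex_of_real (cosh (a / 2) powr (- \<epsilon>))) =
      of_real (2 powr \<epsilon>) * (Gamma (of_real (\<epsilon> / 2) + \<i> * of_real y) * Gamma (of_real (\<epsilon> / 2) - \<i> * of_real y) / Gamma (of_real \<epsilon>))"
proof -
  have *: "complex_of_real (cosh (a / 2) powr (- \<epsilon>)) =
    of_real (2 powr \<epsilon>) * of_real (2 * cosh (a / 2)) powr (- 2 * of_real (\<epsilon> / 2))" for a :: real
  proof -
    have "complex_of_real (2 * cosh (a / 2)) powr (- 2 * of_real (\<epsilon> / 2)) = of_real ((2 * cosh (a / 2)) powr (- \<epsilon>))"
      using powr_of_real[of "2 * cosh (a / 2)" "- \<epsilon>"] by (simp add: less_imp_le)
    moreover have "2 powr \<epsilon> * (2 * cosh (a / 2)) powr (- \<epsilon>) = cosh (a / 2) powr (- \<epsilon>)"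
      by (simp add: powr_mult powr_minus less_imp_le)
    ultimately show ?thesis by (metis of_real_mult)
  qed
  have **: "exp (\<i> * of_real (y * a)) * complex_of_real (cosh (a / 2) powr (- \<epsilon>)) =
    of_real (2 powr \<epsilon>) * (exp (\<i> * of_real (y * a)) * of_real (2 * cosh (a / 2)) powr (- 2 * of_real (\<epsilon> / 2)))" for a
    unfolding * by simp
  have e': "Re (of_real (\<epsilon> / 2)) > 0" using e by simp
  show "integrable lborel (\<lambda>a. exp (\<i> * of_real (y * a)) * complex_of_real (cosh (a / 2) powr (- \<epsilon>)))"
    unfolding ** by (intro integrable_mult_right sech_fourier e')
  show "(LBINT a. exp (\<i> * of_real (y * a)) * complex_of_real (cosh (a / 2) powr (- \<epsilon>))) =
      of_real (2 powr \<epsilon>) * (Gamma (of_real (\<epsilon> / 2) + \<i> * of_real y) * Gamma (of_real (\<epsilon> / 2) - \<i> * of_real y) / Gamma (of_real \<epsilon>))"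
    unfolding ** integral_mult_right_zero sech_fourier(2)[OF e'] by simp
qed

lemma sech_powr_integrable:
  fixes \<epsilon> :: real
  assumes e: "\<epsilon> > 0"
  shows "integrable lborel (\<lambda>a. cosh (a / 2) powr (- \<epsilon>))"
proof -
  have "integrable lborel (\<lambda>a. complex_of_real (cosh (a / 2) powr (- \<epsilon>)))"
    using sech_fourier_real(1)[OF e, of 0] by simp
  then show ?thesis by (simp only: complex_of_real_integrable_eq)
qed

lemma cosh_sum_product: "(cosh s + cosh (s + b)) / 2 = cosh (s + b / 2) * cosh (b / 2)" for s b :: real
proof -
  have "cosh s = cosh ((s + b / 2) - b / 2)" "cosh (s + b) = cosh ((s + b / 2) + b / 2)" by simp_all
  then show ?thesis unfolding cosh_add cosh_diff by (simp add: algebra_simps)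
qed

text \<open>Arithmetic-geometric mean. The majorant separates the variables, which makes the double integral over \<open>s\<close> and \<open>t\<close> converge.\<close>

lemma cosh_sum_powr_le:
  fixes \<epsilon> s t :: real
  assumes e: "\<epsilon> > 0"
  shows "(cosh s / 2 + cosh t / 2) powr (- \<epsilon>) \<le> ((1 + cosh s) / 2) powr (- (\<epsilon> / 2)) * ((1 + cosh t) / 2) powr (- (\<epsilon> / 2))"
proof -
  define A B where "A = (1 + cosh s) / 2" and "B = (1 + cosh t) / 2"
  have AB: "A \<ge> 1" "B \<ge> 1" using cosh_real_ge_1[of s] cosh_real_ge_1[of t] by (simp_all add: A_def B_def)
  have "sqrt (A * B) \<le> (A + B) / 2" using arith_geo_mean_sqrt[of A B] AB by simp
  also have "\<dots> \<le> cosh s / 2 + cosh t / 2" using AB by (simp add: A_def B_def add_divide_distrib)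
  finally have le: "(A * B) powr (1/2) \<le> cosh s / 2 + cosh t / 2" using AB by (simp add: powr_half_sqrt)
  have "(cosh s / 2 + cosh t / 2) powr (- \<epsilon>) \<le> ((A * B) powr (1/2)) powr (- \<epsilon>)"
    using le e AB by (intro powr_mono2') auto
  also have "\<dots> = A powr (- (\<epsilon> / 2)) * B powr (- (\<epsilon> / 2))"
    using AB by (simp add: powr_powr powr_mult)
  finally show ?thesis by (simp add: A_def B_def)
qed

text \<open>The identity \<open>cosh s + cosh t = 2 cosh((s+t)/2) cosh((t-s)/2)\<close> splits the double integral into a product of two
  one-dimensional ones in the variables \<open>a = s + t\<close> and \<open>b = t - s\<close>. The change of variables is done as two successive
  substitutions, \<open>t = s + b\<close> and then \<open>s = (a - b)/2\<close>.\<close>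

lemma double_cosh_fourier:
  fixes \<epsilon> x y :: real
  assumes e: "\<epsilon> > 0"
  shows "(LBINT s. exp (\<i> * of_real (y * s)) * (LBINT t. exp (\<i> * of_real (x * t)) * complex_of_real ((cosh s / 2 + cosh t / 2) powr (- \<epsilon>))))
    = of_real (4 powr \<epsilon> / 2)
      * (Gamma (of_real (\<epsilon> / 2) + \<i> * of_real ((x + y) / 2)) * Gamma (of_real (\<epsilon> / 2) - \<i> * of_real ((x + y) / 2)) / Gamma (of_real \<epsilon>))
      * (Gamma (of_real (\<epsilon> / 2) + \<i> * of_real ((x - y) / 2)) * Gamma (of_real (\<epsilon> / 2) - \<i> * of_real ((x - y) / 2)) / Gamma (of_real \<epsilon>))"
    (is "?lhs = _ * ?P * ?M")
proof -
  define f where "f = (\<lambda>b s. exp (\<i> * of_real (y * s + x * (s + b))) * complex_of_real ((cosh (s + b / 2) * cosh (b / 2)) powr (- \<epsilon>)))"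
  define C where "C = (LBINT a. cosh (a / 2) powr (- \<epsilon>))"
  have inner: "(LBINT t. exp (\<i> * of_real (x * t)) * complex_of_real ((cosh s / 2 + cosh t / 2) powr (- \<epsilon>)))
     = (LBINT b. exp (\<i> * of_real (x * (s + b))) * complex_of_real ((cosh (s + b / 2) * cosh (b / 2)) powr (- \<epsilon>)))" for s
    unfolding cosh_sum_product[symmetric] add_divide_distrib
    using lborel_integral_real_affine[of 1 "\<lambda>t. exp (\<i> * of_real (x * t)) * complex_of_real ((cosh s / 2 + cosh t / 2) powr (- \<epsilon>))" s]
    by (simp only: abs_one scaleR_one mult_1_left one_neq_zero not_False_eq_True)
  have l: "?lhs = (LBINT s. LBINT b. f b s)"
  proof -
    have "f b s = exp (\<i> * of_real (y * s)) * (exp (\<i> * of_real (x * (s + b))) * complex_of_real ((cosh (s + b / 2) * cosh (b / 2)) powr (- \<epsilon>)))" for b s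
      unfolding f_def by (simp add: exp_add distrib_left)
    then show ?thesis unfolding inner by simp
  qed
  have m: "case_prod f \<in> borel_measurable (borel \<Otimes>\<^sub>M borel)"
    unfolding f_def by (simp add: case_prod_beta) measurable
  have aff: "cosh (- (b / 2) + (1 / 2) * a + b / 2) = cosh (a / 2)" for a b :: real by simp
  define D where "D = (\<lambda>b s::real. (cosh (s + b / 2) * cosh (b / 2)) powr (- \<epsilon>))"
  have Dn: "norm (f b s) \<le> D b s" for b s by (simp add: f_def D_def norm_mult)
  have D1: "D b s = cosh ((b + 2 * s) / 2) powr (- \<epsilon>) * cosh (b / 2) powr (- \<epsilon>)" for b s :: real
    by (simp add: D_def powr_mult less_imp_le add_divide_distrib add.commute)
  have Di: "integrable lborel (D b)" for b
    unfolding D1 using lborel_integrable_real_affine[OF sech_powr_integrable[OF e], of 2 b]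
    by (intro integrable_mult_left) simp
  have DE: "(LBINT s. D b s) = C / 2 * cosh (b / 2) powr (- \<epsilon>)" for b
    unfolding D1 C_def using lborel_integral_real_affine[of 2 "\<lambda>a. cosh (a / 2) powr (- \<epsilon>)" b] by simp
  have Ei: "integrable lborel (\<lambda>b. C / 2 * cosh (b / 2) powr (- \<epsilon>))"
    by (intro integrable_mult_right sech_powr_integrable e)
  note fub = fubini_dominated[OF m Di Dn eq_refl[OF DE] Ei]
  have fs: "(LBINT s. f b s) = (of_real (2 powr \<epsilon>) * ?P / 2) * (exp (\<i> * of_real ((x - y) / 2 * b)) * of_real (cosh (b / 2) powr (- \<epsilon>)))" for b
  proof -
    have "(LBINT s. f b s) = (1/2) *\<^sub>R (LBINT a. f b (- (b / 2) + (1 / 2) * a))"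
      using lborel_integral_real_affine[of "1/2" "f b" "- (b / 2)"] by simp
    also have "(LBINT a. f b (- (b / 2) + (1 / 2) * a)) = (LBINT a. (exp (\<i> * of_real ((x - y) / 2 * b)) * of_real (cosh (b / 2) powr (- \<epsilon>)))
        * (exp (\<i> * of_real ((x + y) / 2 * a)) * complex_of_real (cosh (a / 2) powr (- \<epsilon>))))"
    proof (rule Bochner_Integration.integral_cong[OF refl])
      fix a
      have "exp (\<i> * of_real (y * (- (b / 2) + (1 / 2) * a) + x * (- (b / 2) + (1 / 2) * a + b))) = 
        exp (\<i> * of_real ((x - y) / 2 * b)) * exp (\<i> * of_real ((x + y) / 2 * a))"
        unfolding exp_add[symmetric] by (simp add: field_simps)
      then show "f b (- (b / 2) + (1 / 2) * a) = (exp (\<i> * of_real ((x - y) / 2 * b)) * of_real (cosh (b / 2) powr (- \<epsilon>)))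
        * (exp (\<i> * of_real ((x + y) / 2 * a)) * complex_of_real (cosh (a / 2) powr (- \<epsilon>)))"
        unfolding f_def aff by (simp add: powr_mult less_imp_le mult_ac)
    qed
    also have "\<dots> = (exp (\<i> * of_real ((x - y) / 2 * b)) * of_real (cosh (b / 2) powr (- \<epsilon>))) * (of_real (2 powr \<epsilon>) * ?P)"
      unfolding integral_mult_right_zero sech_fourier_real(2)[OF e] ..
    finally show ?thesis by (simp add: scaleR_conv_of_real mult_ac)
  qed
  have tt: "complex_of_real (2 powr \<epsilon>) * of_real (2 powr \<epsilon>) = of_real (4 powr \<epsilon>)"
    using powr_mult[of 2 2 \<epsilon>] by (simp flip: of_real_mult)
  have opaque: "(t * P / 2) * (t * M) = of_real (c / 2) * P * M" if "t * t = of_real c" for t P M :: complex and c :: real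
  proof -
    have "(t * P / 2) * (t * M) = (t * t) / 2 * P * M" by simp
    then show ?thesis unfolding that by simp
  qed
  have "?lhs = (of_real (2 powr \<epsilon>) * ?P / 2) * (of_real (2 powr \<epsilon>) * ?M)"
    unfolding l fub(3)[symmetric] fs integral_mult_right_zero sech_fourier_real(2)[OF e] ..
  also have "\<dots> = of_real (4 powr \<epsilon> / 2) * ?P * ?M" by (rule opaque[OF tt])
  finally show ?thesis .
qed

text \<open>Insert the integral for \<open>K\<^bsub>iy\<^esub>\<close>, integrate over \<open>v\<close> first by \<open>macdonald_mellin_exp\<close>, and evaluate the remaining
  double integral by \<open>double_cosh_fourier\<close>.\<close>

lemma macdonald_product:
  fixes \<epsilon> x y :: real
  assumes e: "\<epsilon> > 0"
  shows "integrable lborel (\<lambda>v. exp (\<epsilon> * v) * macdonald x (exp v / 2) * macdonald y (exp v / 2))" (is ?I)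
    and "complex_of_real (LBINT v. exp (\<epsilon> * v) * macdonald x (exp v / 2) * macdonald y (exp v / 2))
     = of_real (4 powr \<epsilon> / 8) * Gamma (of_real \<epsilon>)
      * (Gamma (of_real (\<epsilon> / 2) + \<i> * of_real ((x + y) / 2)) * Gamma (of_real (\<epsilon> / 2) - \<i> * of_real ((x + y) / 2)) / Gamma (of_real \<epsilon>))
      * (Gamma (of_real (\<epsilon> / 2) + \<i> * of_real ((x - y) / 2)) * Gamma (of_real (\<epsilon> / 2) - \<i> * of_real ((x - y) / 2)) / Gamma (of_real \<epsilon>))"
    (is "_ = _ * _ * ?P * ?M")
proof -
  define f where "f = (\<lambda>s v. exp (\<i> * of_real (y * s)) * (exp (of_real \<epsilon> * of_real v) * complex_of_real (exp (- (cosh s / 2) * exp v)) * of_real (macdonald x (exp v / 2))))"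
  define D where "D = (\<lambda>s v. exp (\<epsilon> * v) * exp (- (cosh s / 2) * exp v) * macdonald 0 (exp v / 2))"
  have e': "Re (of_real \<epsilon>) > 0" using e by simp
  have c: "cosh s / 2 \<ge> 1 / 2" for s :: real using cosh_real_ge_1[of s] by simp
  have m: "case_prod f \<in> borel_measurable (borel \<Otimes>\<^sub>M borel)"
    unfolding f_def by (simp add: case_prod_beta) measurable
  have Dn: "norm (f s v) \<le> D s v" for v s
    using abs_macdonald_le[of "exp v / 2" x] by (auto simp: f_def D_def norm_mult intro!: mult_left_mono)
  have Dc: "complex_of_real (D s v) = exp (of_real \<epsilon> * of_real v) * complex_of_real (exp (- (cosh s / 2) * exp v)) * of_real (macdonald 0 (exp v / 2))" for s v
    by (simp add: D_def flip: exp_of_real)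
  have Di: "integrable lborel (D s)" for s
    using macdonald_mellin_exp(1)[OF e' c, of s 0] unfolding Dc[symmetric] complex_of_real_integrable_eq .
  define C where "C = (LBINT t. ((1 + cosh t) / 2) powr (- (\<epsilon> / 2)))"
  have DE: "(LBINT v. D s v) \<le> Gamma \<epsilon> / 2 * (C * ((1 + cosh s) / 2) powr (- (\<epsilon> / 2)))" for s
  proof -
    have pw: "complex_of_real (cosh s / 2 + cosh t / 2) powr (- of_real \<epsilon>) = of_real ((cosh s / 2 + cosh t / 2) powr (- \<epsilon>))" for t
      using powr_of_real[of "cosh s / 2 + cosh t / 2" "- \<epsilon>"] by (simp add: less_imp_le add_pos_pos)
    have int: "integrable lborel (\<lambda>t. (cosh s / 2 + cosh t / 2) powr (- \<epsilon>))"
    proof -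
      have "integrable lborel (\<lambda>t. exp (\<i> * of_real (0 * t)) * of_real (cosh s / 2 + cosh t / 2) powr (- complex_of_real \<epsilon>))"
        by (rule macdonald_mellin_exp(3)[OF e' c])
      then show ?thesis
        unfolding pw mult_zero_left of_real_0 mult_zero_right exp_zero mult_1_left complex_of_real_integrable_eq .
    qed
    have "complex_of_real (LBINT v. D s v) = Gamma (of_real \<epsilon>) / 2 * (LBINT t. exp (\<i> * of_real (0 * t)) * of_real (cosh s / 2 + cosh t / 2) powr (- of_real \<epsilon>))"
      using macdonald_mellin_exp(2)[OF e' c, of s 0] unfolding Dc[symmetric] integral_complex_of_real .
    also have "\<dots> = of_real (Gamma \<epsilon> / 2 * (LBINT t. (cosh s / 2 + cosh t / 2) powr (- \<epsilon>)))"
      unfolding pw by (simp add: Gamma_complex_of_real)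
    finally have "(LBINT v. D s v) = Gamma \<epsilon> / 2 * (LBINT t. (cosh s / 2 + cosh t / 2) powr (- \<epsilon>))"
      using of_real_eq_iff by blast
    also have "\<dots> \<le> Gamma \<epsilon> / 2 * (LBINT t. ((1 + cosh s) / 2) powr (- (\<epsilon> / 2)) * ((1 + cosh t) / 2) powr (- (\<epsilon> / 2)))"
      by (intro mult_left_mono integral_mono int integrable_mult_right sech_integrable_real cosh_sum_powr_le)
        (use e Gamma_real_pos[OF e] in auto)
    finally show ?thesis by (simp add: C_def mult.commute)
  qed
  have Ei: "integrable lborel (\<lambda>s. Gamma \<epsilon> / 2 * (C * ((1 + cosh s) / 2) powr (- (\<epsilon> / 2))))"
    by (intro integrable_mult_right sech_integrable_real) (use e in auto)
  note fub = fubini_dominated[OF m Di Dn DE Ei]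
  have fs: "(LBINT s. f s v) = 2 * of_real (exp (\<epsilon> * v) * macdonald x (exp v / 2) * macdonald y (exp v / 2))" for v
  proof -
    have "(LBINT s. f s v) = (LBINT s. (exp (of_real \<epsilon> * of_real v) * of_real (macdonald x (exp v / 2))) * (exp (\<i> * of_real (y * s)) * complex_of_real (exp (- (exp v / 2) * cosh s))))"
      unfolding f_def by (intro Bochner_Integration.integral_cong) (auto simp: mult_ac)
    also have "\<dots> = (exp (of_real \<epsilon> * of_real v) * of_real (macdonald x (exp v / 2))) * (2 * of_real (macdonald y (exp v / 2)))"
      unfolding integral_mult_right_zero macdonald_complex(2)[of "exp v / 2", OF half_gt_zero[OF exp_gt_zero]] by simp
    finally show ?thesis by (simp add: mult_ac flip: exp_of_real)
  qed
  have fv: "(LBINT v. f s v) = Gamma (of_real \<epsilon>) / 2 * (exp (\<i> * of_real (y * s)) * (LBINT t. exp (\<i> * of_real (x * t)) * complex_of_real ((cosh s / 2 + cosh t / 2) powr (- \<epsilon>))))" for s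
  proof -
    have pw: "complex_of_real (cosh s / 2 + cosh t / 2) powr (- of_real \<epsilon>) = of_real ((cosh s / 2 + cosh t / 2) powr (- \<epsilon>))" for t
      using powr_of_real[of "cosh s / 2 + cosh t / 2" "- \<epsilon>"] by (simp add: less_imp_le add_pos_pos)
    show ?thesis unfolding f_def integral_mult_right_zero macdonald_mellin_exp(2)[OF e' c] pw by simp
  qed
  have "integrable lborel (\<lambda>v. (1/2) * (2 * complex_of_real (exp (\<epsilon> * v) * macdonald x (exp v / 2) * macdonald y (exp v / 2))))"
    using fub(2) unfolding fs by (rule integrable_mult_right)
  then have "integrable lborel (\<lambda>v. complex_of_real (exp (\<epsilon> * v) * macdonald x (exp v / 2) * macdonald y (exp v / 2)))"
    by simp
  then show ?I by (simp only: complex_of_real_integrable_eq)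
  have opaque: "N = of_real (c / 8) * G * P * M" if "2 * N = G / 2 * (of_real (c / 2) * P * M)" for N G P M :: complex and c :: real
    using that by (simp add: field_simps)
  have "2 * complex_of_real (LBINT v. exp (\<epsilon> * v) * macdonald x (exp v / 2) * macdonald y (exp v / 2))
    = Gamma (of_real \<epsilon>) / 2 * (of_real (4 powr \<epsilon> / 2) * ?P * ?M)"
    using fub(3) unfolding fs fv integral_mult_right_zero double_cosh_fourier[OF e] integral_complex_of_real by (rule sym)
  then show "complex_of_real (LBINT v. exp (\<epsilon> * v) * macdonald x (exp v / 2) * macdonald y (exp v / 2))
     = of_real (4 powr \<epsilon> / 8) * Gamma (of_real \<epsilon>) * ?P * ?M"
    by (rule opaque)
qed

section \<open>A generating function of binomial type\<close>

text \<open>The generalized binomial coefficient \<open>2k+\<nu>\<close> over \<open>k\<close>.\<close>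

definition gen_coeff :: "complex \<Rightarrow> nat \<Rightarrow> complex" where
  "gen_coeff \<nu> k = Gamma (2 * of_nat k + \<nu> + 1) / (fact k * Gamma (of_nat k + \<nu> + 1))"

lemma gen_coeff_0: "Re \<nu> \<ge> 0 \<Longrightarrow> gen_coeff \<nu> 0 = 1"
  using Re_pos_not_nonpos_Int[of "\<nu> + 1"] by (simp add: gen_coeff_def Gamma_eq_zero_iff)

lemma gen_coeff_Suc:
  assumes nu: "Re \<nu> \<ge> 0"
  shows "of_nat (Suc k) * (of_nat (Suc k) + \<nu>) * gen_coeff \<nu> (Suc k) =
     (2 * of_nat (Suc k) + \<nu>) * (2 * of_nat (Suc k) - 1 + \<nu>) * gen_coeff \<nu> k"
proof -
  define z w where "z = 2 * of_nat k + \<nu> + 1" and "w = of_nat k + \<nu> + 1"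
  have n: "z \<notin> \<int>\<^sub>\<le>\<^sub>0" "z + 1 \<notin> \<int>\<^sub>\<le>\<^sub>0" "w \<notin> \<int>\<^sub>\<le>\<^sub>0"
    using nu by (auto intro!: Re_pos_not_nonpos_Int simp: z_def w_def)
  have w0: "w \<noteq> 0" using n(3) by auto
  have e: "2 * of_nat (Suc k) + \<nu> + 1 = z + 1 + 1" "of_nat (Suc k) + \<nu> + 1 = w + 1"
    by (simp_all add: z_def w_def)
  have g: "Gamma (z + 1 + 1) = (z + 1) * (z * Gamma z)"
    unfolding Gamma_plus1[OF n(2)] Gamma_plus1[OF n(1)] ..
  have s: "gen_coeff \<nu> (Suc k) = (z + 1) * (z * Gamma z) / (of_nat (Suc k) * fact k * (w * Gamma w))"
    unfolding gen_coeff_def e g Gamma_plus1[OF n(3)] fact_Suc by simp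
  have 0: "gen_coeff \<nu> k = Gamma z / (fact k * Gamma w)" by (simp add: gen_coeff_def z_def w_def)
  have opaque: "N * w * (y * (z * g) / (N * f * (w * h))) = y * z * (g / (f * h))" if "N \<noteq> 0" "w \<noteq> 0" for N w y z g f h :: complex
    using that by simp
  have c: "of_nat (Suc k) + \<nu> = w" "2 * of_nat (Suc k) + \<nu> = z + 1" "2 * of_nat (Suc k) - 1 + \<nu> = z"
    by (simp_all add: z_def w_def)
  have "of_nat (Suc k) \<noteq> (0::complex)" by (metis nat.distinct(1) of_nat_eq_0_iff)
  then show ?thesis unfolding s 0 c by (intro opaque w0)
qed

lemma gen_coeff_algebra:
  fixes R n e :: complex
  assumes R: "R \<noteq> 0" "1 + R \<noteq> 0"
  shows "(1 + R) * (1 - R) / 4 * (2 * n * e / (R * (1 + R))) = n / 2 * (e / R - e)"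
    and "R ^ 2 * (2 * n * e / (R * (1 + R)) / R + 2 * e / R ^ 3) = 2 * n * e / (1 + R) + 2 * (e / R)"
    and "(1 + R) * (1 - R) / 4 * (2 * n * e / (1 + R)) = n / 2 * (e - R ^ 2 * (e / R))"
proof -
  show "(1 + R) * (1 - R) / 4 * (2 * n * e / (R * (1 + R))) = n / 2 * (e / R - e)"
    using R by (simp add: divide_simps) (simp add: algebra_simps)
  have "R ^ 2 * (2 * n * e / (R * q) / R + 2 * e / R ^ 3) = 2 * n * e / q + 2 * (e / R)" for q
    using R(1) by (simp add: distrib_left power2_eq_square power3_eq_cube)
  then show "R ^ 2 * (2 * n * e / (R * (1 + R)) / R + 2 * e / R ^ 3) = 2 * n * e / (1 + R) + 2 * (e / R)" .
  have "q * (1 - R) / 4 * (2 * n * e / q) = n / 2 * (e - R * e)" if "q \<noteq> 0" for q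
    using that by (simp add: algebra_simps diff_divide_distrib)
  from this[OF R(2)] show "(1 + R) * (1 - R) / 4 * (2 * n * e / (1 + R)) = n / 2 * (e - R ^ 2 * (e / R))"
    using R(1) by (simp add: power2_eq_square)
qed

text \<open>With \<open>r = \<surd>(1-4z)\<close> put \<open>E = (2/(1+r))\<^sup>\<nu>\<close> and \<open>A = E/r\<close>. They satisfy
  \<open>z E' = (\<nu>/2)(A - E)\<close> and \<open>z(1-4z) A' = (\<nu>/2)(E - (1-4z) A) + 2zA\<close>. Comparing Taylor coefficients and eliminating those of \<open>E\<close> gives
  for \<open>A\<close> the two-term recursion of \<open>gen_coeff_Suc\<close>.\<close>

lemma gen_coeff_sums:
  assumes nu: "Re \<nu> \<ge> 0" and z: "norm z < 1 / 4"
  shows "(\<lambda>k. gen_coeff \<nu> k * z ^ k) sums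
    (exp (- \<nu> * Ln ((1 + csqrt (1 - 4 * z)) / 2)) / csqrt (1 - 4 * z))"
proof -
  define r where "r = (\<lambda>z. csqrt (1 - 4 * z))"
  define E where "E = (\<lambda>z. exp (- \<nu> * Ln ((1 + r z) / 2)))"
  define A where "A = (\<lambda>z. E z / r z)"
  let ?B = "ball (0::complex) (1/4)"
  have re: "Re (1 - 4 * z) > 0" if "z \<in> ?B" for z
    using that complex_Re_le_cmod[of z] by simp
  have r2: "r z ^ 2 = 1 - 4 * z" for z by (simp add: r_def)
  have rre: "Re (r z) > 0" if "z \<in> ?B" for z
  proof -
    have "r z \<noteq> 0" using re[OF that] r2[of z] by (metis less_irrefl power_zero_numeral zero_complex.sel(1))
    moreover have "0 \<le> Re (r z)" using csqrt_principal[of "1 - 4 * z"] unfolding r_def by linarith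
    moreover have "Re (r z) \<noteq> 0"
    proof
      assume "Re (r z) = 0"
      then have "Re (r z ^ 2) \<le> 0" by (simp add: Re_power2)
      with re[OF that] r2 show False by simp
    qed
    ultimately show ?thesis by simp
  qed
  have r0: "r z \<noteq> 0" "1 + r z \<noteq> 0" "(1 + r z) / 2 \<notin> \<real>\<^sub>\<le>\<^sub>0" if "z \<in> ?B" for z
    using rre[OF that] by (auto simp: complex_eq_iff complex_nonpos_Reals_iff)
  have dr: "(r has_field_derivative (- 2 / r z)) (at z)" if "z \<in> ?B" for z
  proof -
    have "1 - 4 * z \<notin> \<real>\<^sub>\<le>\<^sub>0" using re[OF that] by (simp add: complex_nonpos_Reals_iff)
    then have "(r has_field_derivative inverse (2 * r z) * (- 4)) (at z)"
      unfolding r_def by (intro DERIV_chain2[OF has_field_derivative_csqrt]) (auto intro!: derivative_eq_intros)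
    moreover have "inverse (2 * r z) * (- 4) = - 2 / r z"
      using r0(1)[OF that] by (simp add: divide_simps)
    ultimately show ?thesis by simp
  qed
  have dE: "(E has_field_derivative (2 * \<nu> * E z / (r z * (1 + r z)))) (at z)" if "z \<in> ?B" for z
  proof -
    have "((\<lambda>z. (1 + r z) / 2) has_field_derivative (- 2 / r z) / 2) (at z)"
      by (rule DERIV_cong[OF DERIV_cdivide[OF DERIV_add[OF DERIV_const dr[OF that]]]]) simp
    then have "((\<lambda>z. Ln ((1 + r z) / 2)) has_field_derivative inverse ((1 + r z) / 2) * ((- 2 / r z) / 2)) (at z)"
      by (rule DERIV_chain2[where f = Ln and g = "\<lambda>z. (1 + r z) / 2", OF has_field_derivative_Ln[OF r0(3)[OF that]]])
    then have "((\<lambda>z. - \<nu> * Ln ((1 + r z) / 2)) has_field_derivative - \<nu> * (inverse ((1 + r z) / 2) * ((- 2 / r z) / 2))) (at z)"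
      by (rule DERIV_cmult)
    then have "(E has_field_derivative E z * (- \<nu> * (inverse ((1 + r z) / 2) * ((- 2 / r z) / 2)))) (at z)"
      unfolding E_def by (rule DERIV_chain2[where f = exp and g = "\<lambda>z. - \<nu> * Ln ((1 + r z) / 2)", OF DERIV_exp])
    then show ?thesis using r0(1,2)[OF that] by (simp add: divide_simps mult_ac)
  qed
  have dA: "(A has_field_derivative (2 * \<nu> * E z / (r z * (1 + r z)) / r z + 2 * E z / r z ^ 3)) (at z)" if "z \<in> ?B" for z
  proof -
    have "(A has_field_derivative (2 * \<nu> * E z / (r z * (1 + r z)) * r z - E z * (- 2 / r z)) / (r z * r z)) (at z)"
      unfolding A_def by (rule DERIV_divide[OF dE[OF that] dr[OF that] r0(1)[OF that]])
    moreover have "(2 * \<nu> * E z / (r z * (1 + r z)) * r z - E z * (- 2 / r z)) / (r z * r z) = 2 * \<nu> * E z / (r z * (1 + r z)) / r z + 2 * E z / r z ^ 3"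
      using r0(1,2)[OF that] by (simp add: add_divide_distrib diff_divide_distrib power3_eq_cube mult_ac)
    ultimately show ?thesis by simp
  qed
  have hE: "E holomorphic_on ?B" and hA: "A holomorphic_on ?B"
    unfolding holomorphic_on_open[OF open_ball] using dE dA by blast+
  have aE: "E has_fps_expansion fps_expansion E 0" and aA: "A has_fps_expansion fps_expansion A 0"
    by (rule analytic_at_imp_has_fps_expansion_0, unfold analytic_at_ball, rule exI[of _ "1/4"], use hE hA in simp)+
  define e where "e = fps_nth (fps_expansion E 0)"
  define a where "a = fps_nth (fps_expansion A 0)"
  have ev: "eventually (\<lambda>z. z \<in> ?B) (nhds 0)" by (intro eventually_nhds_in_open) auto
  have R1: "fps_X * fps_deriv (fps_expansion E 0) = fps_const (\<nu> / 2) * (fps_expansion A 0 - fps_expansion E 0)"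
  proof (rule fps_expansion_unique_complex)
    show "(\<lambda>z. z * deriv E z) has_fps_expansion fps_X * fps_deriv (fps_expansion E 0)"
      by (intro fps_expansion_intros has_fps_expansion_deriv aE)
    have F1: "(\<lambda>z. \<nu> / 2 * (A z - E z)) has_fps_expansion fps_const (\<nu> / 2) * (fps_expansion A 0 - fps_expansion E 0)"
      by (intro fps_expansion_intros aE aA)
    have F2: "eventually (\<lambda>z. \<nu> / 2 * (A z - E z) = z * deriv E z) (nhds 0)"
      using ev
    proof eventually_elim
      case (elim z)
      note r0 = r0(1,2)[OF elim]
      have e: "(1 + r z) * (1 - r z) = 1 - r z ^ 2" by (simp add: algebra_simps power2_eq_square)
      have z4: "(1 + r z) * (1 - r z) / 4 = z" unfolding e r2 by simp
      show ?case unfolding DERIV_imp_deriv[OF dE[OF elim]]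
        using gen_coeff_algebra(1)[OF r0, of \<nu> "E z"] unfolding z4 by (simp add: A_def)
    qed
    show "(\<lambda>z. z * deriv E z) has_fps_expansion fps_const (\<nu> / 2) * (fps_expansion A 0 - fps_expansion E 0)"
      by (rule iffD1[OF has_fps_expansion_cong[OF F2 refl] F1])
  qed
  have R2: "fps_X * (1 - fps_const 4 * fps_X) * fps_deriv (fps_expansion A 0) =
     fps_const (\<nu> / 2) * (fps_expansion E 0 - (1 - fps_const 4 * fps_X) * fps_expansion A 0) + fps_const 2 * fps_X * fps_expansion A 0"
    (is "_ = ?rhs")
  proof (rule fps_expansion_unique_complex)
    show "(\<lambda>z. z * (1 - 4 * z) * deriv A z) has_fps_expansion fps_X * (1 - fps_const 4 * fps_X) * fps_deriv (fps_expansion A 0)"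
      by (intro fps_expansion_intros has_fps_expansion_deriv aA)
    have F1: "(\<lambda>z. \<nu> / 2 * (E z - (1 - 4 * z) * A z) + 2 * z * A z) has_fps_expansion ?rhs"
      by (intro fps_expansion_intros aE aA)
    have F2: "eventually (\<lambda>z. \<nu> / 2 * (E z - (1 - 4 * z) * A z) + 2 * z * A z = z * (1 - 4 * z) * deriv A z) (nhds 0)"
      using ev
    proof eventually_elim
      case (elim z)
      note r0 = r0(1,2)[OF elim]
      have e: "(1 + r z) * (1 - r z) = 1 - r z ^ 2" by (simp add: algebra_simps power2_eq_square)
      have z4: "(1 + r z) * (1 - r z) / 4 = z" unfolding e r2 by simp
      have "z * (1 - 4 * z) * deriv A z = z * (2 * \<nu> * E z / (1 + r z) + 2 * (E z / r z))"
        unfolding DERIV_imp_deriv[OF dA[OF elim]] r2[symmetric] mult.assoc[of z]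
        by (subst gen_coeff_algebra(2)[OF r0]) (rule refl)
      also have "\<dots> = z * (2 * \<nu> * E z / (1 + r z)) + 2 * z * A z"
        unfolding distrib_left A_def by (simp add: mult_ac)
      also have "z * (2 * \<nu> * E z / (1 + r z)) = \<nu> / 2 * (E z - (1 - 4 * z) * A z)"
        using gen_coeff_algebra(3)[OF r0, of \<nu> "E z"] unfolding z4 r2 A_def .
      finally show ?case by (rule sym)
    qed
    show "(\<lambda>z. z * (1 - 4 * z) * deriv A z) has_fps_expansion ?rhs"
      by (rule iffD1[OF has_fps_expansion_cong[OF F2 refl] F1])
  qed
  have s1: "(2 * of_nat (Suc n) + \<nu>) * e (Suc n) = \<nu> * a (Suc n)" for n
    using arg_cong[OF R1, of "\<lambda>F. 2 * fps_nth F (Suc n)"] by (simp add: e_def a_def algebra_simps del: of_nat_Suc)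
  have s2: "of_nat (Suc n) * a (Suc n) - 4 * (of_nat n * a n) = \<nu> / 2 * (e (Suc n) - (a (Suc n) - 4 * a n)) + 2 * a n" for n
  proof -
    have l: "fps_X * (1 - fps_const 4 * fps_X) * F = fps_X * F - fps_const 4 * (fps_X * (fps_X * F))" for F :: "complex fps"
      by (simp add: algebra_simps)
    have r: "(1 - fps_const 4 * fps_X) * F = F - fps_const 4 * (fps_X * F)" "fps_const 2 * fps_X * F = fps_const 2 * (fps_X * F)" for F :: "complex fps"
      by (simp_all add: algebra_simps)
    have "fps_nth (fps_X * (fps_X * fps_deriv (fps_expansion A 0))) (Suc n) = of_nat n * a n"
      by (cases n) (auto simp: a_def)
    then show ?thesis
      using arg_cong[OF R2, of "\<lambda>F. fps_nth F (Suc n)"] unfolding l r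
      by (simp add: e_def a_def del: of_nat_Suc)
  qed
  have a_Suc: "of_nat (Suc n) * (of_nat (Suc n) + \<nu>) * a (Suc n) = (2 * of_nat (Suc n) + \<nu>) * (2 * of_nat (Suc n) - 1 + \<nu>) * a n" for n
  proof -
    define N where "N = complex_of_nat (Suc n)"
    have n: "of_nat n = N - 1" by (simp add: N_def)
    have 1: "(2 * N + \<nu>) * e (Suc n) = \<nu> * a (Suc n)" using s1[of n] by (simp add: N_def)
    have 2: "N * a (Suc n) - 4 * ((N - 1) * a n) = \<nu> / 2 * (e (Suc n) - (a (Suc n) - 4 * a n)) + 2 * a n"
      using s2[of n] unfolding n N_def[symmetric] .
    have "2 * (2 * N + \<nu>) * (N * a (Suc n) - 4 * ((N - 1) * a n)) = \<nu> * ((2 * N + \<nu>) * e (Suc n)) - (2 * N + \<nu>) * \<nu> * (a (Suc n) - 4 * a n) + 4 * (2 * N + \<nu>) * a n"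
      unfolding 2 by (simp add: field_simps)
    then have "4 * (N * (N + \<nu>) * a (Suc n)) = 4 * ((2 * N + \<nu>) * (2 * N - 1 + \<nu>) * a n)"
      unfolding 1 by (simp add: algebra_simps)
    then show ?thesis by (simp add: N_def)
  qed
  have "a n = gen_coeff \<nu> n" for n
  proof (induction n)
    case 0
    have "a 0 = A 0" using aA by (simp add: a_def has_fps_expansion_imp_0_eq_fps_nth_0)
    also have "\<dots> = 1" by (simp add: A_def E_def r_def)
    finally show ?case using gen_coeff_0[OF nu] by simp
  next
    case (Suc n)
    have nz: "of_nat (Suc n) * (of_nat (Suc n) + \<nu>) \<noteq> 0"
      using nu by (auto simp: complex_eq_iff)
    have "of_nat (Suc n) * (of_nat (Suc n) + \<nu>) * a (Suc n) = of_nat (Suc n) * (of_nat (Suc n) + \<nu>) * gen_coeff \<nu> (Suc n)"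
      unfolding a_Suc gen_coeff_Suc[OF nu] Suc ..
    then show ?case using nz by (metis mult_cancel_left)
  qed
  moreover have "(\<lambda>n. a n * z ^ n) sums A z"
  proof -
    have eb: "eball (0::complex) (ereal q) = ball 0 q" for q
      by (auto simp: eball_def)
    have "ereal (norm z) < ereal (1 / 4)" using z by (simp only: less_ereal.simps)
    then show ?thesis
      unfolding a_def using has_fps_expansion_imp_sums_complex[OF aA, of "ereal (1 / 4)" z] hA unfolding eb by blast
  qed
  ultimately show ?thesis by (simp add: A_def E_def r_def)
qed

section \<open>The Laplace transform of the modified Bessel function\<close>

text \<open>The \<open>k\<close>-th term of the series of \<open>I\<^bsub>i\<tau>\<^esub>(e\<^bsup>w\<^esup>/2)\<close>, with the complex power written as an exponential.\<close>

definition bessel_term :: "real \<Rightarrow> nat \<Rightarrow> real \<Rightarrow> complex" where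
  "bessel_term \<tau> k w = exp ((2 * of_nat k + \<i> * of_real \<tau>) * of_real (w - ln 4)) * rGamma (of_nat k + \<i> * of_real \<tau> + 1) / fact k"

definition bessel_exp :: "real \<Rightarrow> real \<Rightarrow> complex" where
  "bessel_exp \<tau> w = bessel_I (\<i> * of_real \<tau>) (of_real (exp w / 2))"

lemma bessel_exp_suminf: "bessel_exp \<tau> w = (\<Sum>k. bessel_term \<tau> k w)"
proof -
  have "complex_of_real (exp w / 2) / 2 = of_real (exp (w - ln 4))" by (simp add: exp_diff)
  then have "(complex_of_real (exp w / 2) / 2) powr s = exp (s * of_real (w - ln 4))" for s
    using powr_exp_real by metis
  then have "(complex_of_real (exp w / 2) / 2) powr (2 * of_nat k + \<i> * of_real \<tau>) / (fact k * Gamma (of_nat k + \<i> * of_real \<tau> + 1)) = bessel_term \<tau> k w" for k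
    unfolding bessel_term_def by (simp only: rGamma_inverse_Gamma divide_inverse inverse_mult_distrib mult_ac)
  then show ?thesis unfolding bessel_exp_def bessel_I_def by (simp only:)
qed

lemma measurable_bessel_term [measurable]:
  assumes [measurable]: "f \<in> borel_measurable M" "g \<in> borel_measurable M"
  shows "(\<lambda>x. bessel_term (f x) k (g x)) \<in> borel_measurable M"
proof -
  have [measurable]: "(rGamma :: complex \<Rightarrow> complex) \<in> borel_measurable borel"
    by (intro borel_measurable_continuous_onI continuous_intros)
  show ?thesis unfolding bessel_term_def by measurable
qed

lemma measurable_bessel_exp [measurable]:
  assumes [measurable]: "f \<in> borel_measurable M" "g \<in> borel_measurable M"
  shows "(\<lambda>x. bessel_exp (f x) (g x)) \<in> borel_measurable M"
  unfolding bessel_exp_suminf by measurable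

lemma norm_rGamma_imaginary_le:
  "norm (rGamma (of_nat k + \<i> * of_real \<tau> + 1)) \<le> norm (rGamma (1 + \<i> * of_real \<tau>)) / fact k"
proof (induction k)
  case 0
  show ?case by (simp add: add.commute)
next
  case (Suc k)
  let ?z = "of_nat k + \<i> * of_real \<tau> + 1"
  have "?z * rGamma (?z + 1) = rGamma ?z" by (rule rGamma_plus1)
  then have "norm ?z * norm (rGamma (?z + 1)) = norm (rGamma ?z)" by (metis norm_mult)
  moreover have "real (Suc k) \<le> norm ?z" using complex_Re_le_cmod[of ?z] by simp
  ultimately have "real (Suc k) * norm (rGamma (?z + 1)) \<le> norm (rGamma (1 + \<i> * of_real \<tau>)) / fact k"
    using Suc mult_right_mono[of "real (Suc k)" "norm ?z" "norm (rGamma (?z + 1))"] by simp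
  then have "norm (rGamma (?z + 1)) \<le> norm (rGamma (1 + \<i> * of_real \<tau>)) / fact k / real (Suc k)"
    by (simp add: field_simps del: of_nat_Suc)
  then show ?case by (simp add: add_ac field_simps)
qed

lemma norm_bessel_term_le:
  "norm (bessel_term \<tau> k w) \<le> norm (rGamma (1 + \<i> * of_real \<tau>)) * (exp (2 * real k * (w - ln 4)) / (fact k)\<^sup>2)"
proof -
  have "norm (bessel_term \<tau> k w) = exp (2 * real k * (w - ln 4)) * norm (rGamma (of_nat k + \<i> * of_real \<tau> + 1)) / fact k"
    by (simp add: bessel_term_def norm_mult norm_divide)
  also have "\<dots> \<le> exp (2 * real k * (w - ln 4)) * (norm (rGamma (1 + \<i> * of_real \<tau>)) / fact k) / fact k"
    by (intro divide_right_mono mult_left_mono norm_rGamma_imaginary_le) auto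
  finally show ?thesis by (simp add: power2_eq_square mult_ac)
qed

lemma bessel_term_0: "bessel_term 0 k w = of_real (exp (2 * real k * (w - ln 4)) / (fact k)\<^sup>2)"
proof -
  have "rGamma (of_nat k + 1) = (1 / fact k :: complex)"
    using Gamma_fact[of k, where 'a = complex] by (simp add: rGamma_inverse_Gamma add.commute divide_inverse)
  then show ?thesis by (simp add: bessel_term_def power2_eq_square flip: exp_of_real)
qed

lemma bessel_majorant_summable: "summable (\<lambda>k. exp (2 * real k * c) / (fact k)\<^sup>2)"
proof (rule summable_comparison_test)
  show "summable (\<lambda>k. exp (2 * c) ^ k / fact k)"
    using summable_exp_generic[of "exp (2 * c)"] by (simp add: divide_inverse mult.commute)
  have "exp (2 * real k * c) / (fact k)\<^sup>2 \<le> exp (2 * c) ^ k / fact k" for k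
  proof -
    have "exp (2 * real k * c) = exp (2 * c) ^ k" by (simp add: exp_of_nat_mult[symmetric] mult_ac)
    moreover have "fact k * 1 \<le> fact k * (fact k :: real)"
      by (intro mult_left_mono) (auto simp: fact_ge_1)
    ultimately show ?thesis by (simp add: frac_le power2_eq_square)
  qed
  then show "\<exists>N. \<forall>n\<ge>N. norm (exp (2 * real n * c) / (fact n)\<^sup>2) \<le> exp (2 * c) ^ n / fact n"
    by simp
qed

lemma bessel_term_summable_norm: "summable (\<lambda>k. norm (bessel_term \<tau> k w))"
  by (rule summable_comparison_test[OF _ summable_mult[OF bessel_majorant_summable[of "w - ln 4"]]])
    (use norm_bessel_term_le in auto)

lemma bessel_exp_0: "bessel_exp 0 w = of_real (\<Sum>k. exp (2 * real k * (w - ln 4)) / (fact k)\<^sup>2)"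
  unfolding bessel_exp_suminf bessel_term_0 by (rule suminf_of_real[symmetric, OF bessel_majorant_summable])

lemma Re_bessel_exp_0_nonneg: "Re (bessel_exp 0 w) \<ge> 0"
  unfolding bessel_exp_0 by (simp add: suminf_nonneg bessel_majorant_summable)

text \<open>Domination by \<open>I\<^sub>0\<close>, from \<open>|\<Gamma>(k+1+i\<tau>)| \<ge> k! |\<Gamma>(1+i\<tau>)|\<close>.\<close>

lemma norm_bessel_exp_le: "norm (bessel_exp \<tau> w) \<le> norm (rGamma (1 + \<i> * of_real \<tau>)) * Re (bessel_exp 0 w)"
proof -
  have "norm (bessel_exp \<tau> w) \<le> (\<Sum>k. norm (bessel_term \<tau> k w))"
    unfolding bessel_exp_suminf by (rule summable_norm[OF bessel_term_summable_norm])
  also have "\<dots> \<le> (\<Sum>k. norm (rGamma (1 + \<i> * of_real \<tau>)) * (exp (2 * real k * (w - ln 4)) / (fact k)\<^sup>2))"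
    by (intro suminf_le norm_bessel_term_le bessel_term_summable_norm summable_mult bessel_majorant_summable)
  also have "\<dots> = norm (rGamma (1 + \<i> * of_real \<tau>)) * Re (bessel_exp 0 w)"
    unfolding bessel_exp_0 Re_complex_of_real by (rule suminf_mult[OF bessel_majorant_summable])
  finally show ?thesis .
qed

text \<open>The reflection formula \<open>|\<Gamma>(1+i\<tau>)|\<^sup>2 = \<pi>\<tau>/sinh(\<pi>\<tau>)\<close>, free of divisions so that it holds at \<open>\<tau> = 0\<close>.\<close>

lemma norm_rGamma_imaginary: "(norm (rGamma (1 + \<i> * of_real \<tau>)))\<^sup>2 * (pi * \<tau>) = sinh (pi * \<tau>)"
proof -
  let ?z = "\<i> * complex_of_real \<tau>"
  have c: "rGamma (1 - ?z) = cnj (rGamma (1 + ?z))" by (simp add: cnj_rGamma)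
  have "complex_of_real ((norm (rGamma (1 + ?z)))\<^sup>2) = rGamma (1 + ?z) * rGamma (1 - ?z)"
    unfolding c complex_norm_square ..
  then have "?z * complex_of_real ((norm (rGamma (1 + ?z)))\<^sup>2) = (?z * rGamma (?z + 1)) * rGamma (1 - ?z)"
    by (simp add: add.commute)
  also have "\<dots> = sin (of_real pi * ?z) / of_real pi"
    unfolding rGamma_plus1 by (rule rGamma_reflection_complex)
  also have "of_real pi * ?z = \<i> * of_real (pi * \<tau>)" by simp
  also have "sin (\<i> * of_real (pi * \<tau>)) = \<i> * of_real (sinh (pi * \<tau>))"
    by (simp add: sin_i_times sinh_def scaleR_conv_of_real exp_minus flip: exp_of_real)
  finally have "\<i> * of_real pi * (of_real \<tau> * complex_of_real ((norm (rGamma (1 + ?z)))\<^sup>2)) = \<i> * of_real (sinh (pi * \<tau>))"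
    by (simp add: field_simps)
  then have "of_real (pi * (\<tau> * (norm (rGamma (1 + ?z)))\<^sup>2)) = complex_of_real (sinh (pi * \<tau>))"
    by simp
  then have "pi * (\<tau> * (norm (rGamma (1 + ?z)))\<^sup>2) = sinh (pi * \<tau>)" using of_real_eq_iff by blast
  then show ?thesis by (simp add: mult_ac)
qed

lemma sinh_le_mult_cosh:
  fixes y :: real
  assumes "y \<ge> 0"
  shows "sinh y \<le> y * cosh y"
proof -
  have "(\<lambda>y. y * cosh y - sinh y) 0 \<le> (\<lambda>y. y * cosh y - sinh y) y"
    by (rule DERIV_nonneg_imp_nondecreasing[OF assms])
      (auto intro!: exI derivative_eq_intros)
  then show ?thesis by simp
qed

text \<open>This is why \<open>(cosh \<pi>\<tau>)\<^bsup>-1/2\<^esup>\<close> is the right weight for \<open>g\<close>: the index transform divides by \<open>cosh(\<pi>\<tau>)\<close>, and the Bessel function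
  of order \<open>i\<tau>\<close> costs at most the square root of that.\<close>

lemma norm_rGamma_imaginary_bound: "norm (rGamma (1 + \<i> * of_real \<tau>)) \<le> cosh (pi * \<tau>) powr (1 / 2)"
proof -
  let ?r = "norm (rGamma (1 + \<i> * of_real \<tau>))"
  have "?r\<^sup>2 \<le> cosh (pi * \<tau>)"
  proof (cases "\<tau> = 0")
    case True then show ?thesis by simp
  next
    case False
    have "?r\<^sup>2 * (pi * \<bar>\<tau>\<bar>) = sinh (pi * \<bar>\<tau>\<bar>)"
      using norm_rGamma_imaginary[of \<tau>] by (cases "\<tau> \<ge> 0") auto
    also have "\<dots> \<le> pi * \<bar>\<tau>\<bar> * cosh (pi * \<bar>\<tau>\<bar>)" by (rule sinh_le_mult_cosh) simp
    also have "cosh (pi * \<bar>\<tau>\<bar>) = cosh (pi * \<tau>)" by (cases "\<tau> \<ge> 0") auto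
    finally show ?thesis using False by (simp add: mult.commute)
  qed
  then have "sqrt (?r\<^sup>2) \<le> sqrt (cosh (pi * \<tau>))" by (rule real_sqrt_le_mono)
  then show ?thesis by (simp add: powr_half_sqrt less_imp_le)
qed

lemma central_binomial_le: "fact (2 * k) / (fact k)\<^sup>2 \<le> (4::real) ^ k"
proof -
  have "fact (2 * k) / (fact k)\<^sup>2 = real ((2 * k) choose k)"
    by (subst binomial_fact) (auto simp: power2_eq_square)
  also have "\<dots> \<le> real (2 ^ (2 * k))" using binomial_le_pow2 of_nat_le_iff by blast
  also have "\<dots> = 4 ^ k" by (simp add: power_mult)
  finally show ?thesis .
qed

text \<open>Integrate the series term by term; every term is a Gamma integral. With \<open>z = 1/(4 cosh\<^sup>2 \<xi>)\<close> the sum is \<open>gen_coeff_sums\<close>,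
  where \<open>\<surd>(1-4z) = tanh \<xi>\<close>. Sum and integral may be interchanged because the coefficients are, up to a constant factor, at most the central binomial
  coefficients, thus \<open>4\<^sup>k\<close>, and because \<open>cosh \<xi> > 1\<close>.\<close>

lemma bessel_laplace:
  assumes xi: "\<xi> > 0"
  shows "integrable lborel (\<lambda>w. of_real (exp w * exp (- (cosh \<xi> / 2) * exp w)) * bessel_exp \<tau> w)"
    and "(LBINT w. of_real (exp w * exp (- (cosh \<xi> / 2) * exp w)) * bessel_exp \<tau> w) = 2 * exp (- \<i> * of_real (\<tau> * \<xi>)) / of_real (sinh \<xi>)"
proof -
  define p where "p = cosh \<xi>"
  have p: "p > 1" using xi cosh_real_strict_mono[of 0 \<xi>] by (simp add: p_def)
  define f where "f = (\<lambda>k w. of_real (exp w * exp (- (p / 2) * exp w)) * bessel_term \<tau> k w)"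
  define s where "s = (\<lambda>k. 2 * of_nat k + \<i> * complex_of_real \<tau> + 1)"
  have sre: "Re (s k) > 0" for k by (simp add: s_def)
  define c where "c = (\<lambda>k. exp (- (2 * of_nat k + \<i> * of_real \<tau>) * of_real (ln 4)) * rGamma (of_nat k + \<i> * of_real \<tau> + 1) / fact k)"
  have f: "f k w = c k * (exp (s k * of_real w) * of_real (exp (- (p / 2) * exp w)))" for k w
  proof -
    have "exp ((2 * of_nat k + \<i> * of_real \<tau>) * of_real (w - ln 4)) * exp (of_real w) =
       exp (- (2 * of_nat k + \<i> * of_real \<tau>) * of_real (ln 4)) * exp (s k * of_real w)"
      unfolding exp_add[symmetric] s_def by (simp add: algebra_simps)
    then show ?thesis unfolding f_def bessel_term_def c_def
      by (simp add: mult_ac exp_of_real[symmetric] del: of_real_diff)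
  qed
  have p2: "p / 2 > 0" using p by simp
  have fi: "integrable lborel (f k)" for k
    unfolding f by (intro integrable_mult_right Gamma_exp_integral sre p2)
  define R where "R = norm (rGamma (1 + \<i> * of_real \<tau>))"
  have nf: "(LBINT w. norm (f k w)) \<le> R * (2 / p) * (1 / p\<^sup>2) ^ k" for k
  proof -
    have e4: "exp (- (2 * real k) * ln 4) = (1 / 16) ^ k"
    proof -
      have "exp (- (2 * real k) * ln 4) = exp (- 2 * ln 4) ^ k" by (simp add: exp_of_nat_mult[symmetric] mult_ac)
      also have "exp (- 2 * ln 4) = (1 / 16 :: real)" using exp_add[of "- ln 4" "- ln (4::real)"] by (simp add: exp_minus)
      finally show ?thesis .
    qed
    have "(LBINT w. norm (f k w)) = (LBINT w. norm (c k) * (exp ((2 * real k + 1) * w) * exp (- (p / 2) * exp w)))"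
      unfolding f by (intro Bochner_Integration.integral_cong) (auto simp: norm_mult s_def)
    also have "\<dots> = norm (c k) * (Gamma (2 * real k + 1) * (p / 2) powr (- (2 * real k + 1)))"
      unfolding integral_mult_right_zero by (subst Gamma_exp_integral_real(2)) (use p2 in auto)
    also have "norm (c k) \<le> (1 / 16) ^ k * (R / fact k) / fact k"
    proof -
      have "norm (c k) = exp (- (2 * real k) * ln 4) * norm (rGamma (of_nat k + \<i> * of_real \<tau> + 1)) / fact k"
        by (simp add: c_def norm_mult norm_divide)
      also have "\<dots> \<le> exp (- (2 * real k) * ln 4) * (R / fact k) / fact k"
        unfolding R_def by (intro divide_right_mono mult_left_mono norm_rGamma_imaginary_le) auto
      finally show ?thesis unfolding e4 .
    qed
    also have "Gamma (2 * real k + 1) = fact (2 * k)"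
      using Gamma_fact[of "2 * k", where 'a = real] by (simp add: add.commute)
    also have "(p / 2) powr (- (2 * real k + 1)) = (2 / p) * (4 / p\<^sup>2) ^ k"
    proof -
      have "(p / 2) powr (- (2 * real k + 1)) = inverse ((p / 2) powr real (2 * k + 1))"
        unfolding powr_minus[symmetric] by (simp add: algebra_simps)
      also have "(p / 2) powr real (2 * k + 1) = (p / 2) ^ (2 * k + 1)" using p2 by (rule powr_realpow)
      also have "inverse ((p / 2) ^ (2 * k + 1)) = inverse (p / 2) * (inverse ((p / 2)\<^sup>2)) ^ k"
        unfolding power_add power_mult power_inverse inverse_mult_distrib power_one_right by (rule mult.commute)
      also have "inverse ((p / 2)\<^sup>2) = 4 / p\<^sup>2" by (simp add: power_divide)
      also have "inverse (p / 2) = 2 / p" by simp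
      finally show ?thesis .
    qed
    also have "(1 / 16) ^ k * (R / fact k) / fact k * (fact (2 * k) * ((2 / p) * (4 / p\<^sup>2) ^ k))
      = (fact (2 * k) / (fact k)\<^sup>2) * (R * (2 / p) * ((1 / 16) ^ k * (4 / p\<^sup>2) ^ k))"
      by (simp add: power2_eq_square)
    also have "\<dots> \<le> 4 ^ k * (R * (2 / p) * ((1 / 16) ^ k * (4 / p\<^sup>2) ^ k))"
      using p by (intro mult_right_mono central_binomial_le) (auto simp: R_def)
    also have "\<dots> = R * (2 / p) * (4 * (1/16) * (4 / p\<^sup>2)) ^ k" by (simp only: power_mult_distrib mult_ac)
    also have "4 * (1/16) * (4 / p\<^sup>2) = 1 / p\<^sup>2" by simp
    finally show ?thesis using p by (simp add: mult_right_mono)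
  qed
  have p1: "1 / p\<^sup>2 < 1" using p by (simp add: power2_eq_square less_1_mult)
  have sm: "summable (\<lambda>k. LBINT w. norm (f k w))"
  proof (rule summable_comparison_test)
    show "summable (\<lambda>k. R * (2 / p) * (1 / p\<^sup>2) ^ k)"
      using p p1 by (intro summable_mult summable_geometric) auto
    show "\<exists>N. \<forall>k\<ge>N. norm (LBINT w. norm (f k w)) \<le> R * (2 / p) * (1 / p\<^sup>2) ^ k"
      using nf by (auto intro: Bochner_Integration.integral_nonneg)
  qed
  have ae: "AE w in lborel. summable (\<lambda>k. norm (f k w))"
    unfolding f_def norm_mult by (intro AE_I2 summable_mult bessel_term_summable_norm)
  have fsum: "(\<Sum>k. f k w) = of_real (exp w * exp (- (cosh \<xi> / 2) * exp w)) * bessel_exp \<tau> w" for w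
    unfolding f_def p_def bessel_exp_suminf
    by (rule suminf_mult[OF summable_norm_cancel[OF bessel_term_summable_norm]])
  show "integrable lborel (\<lambda>w. of_real (exp w * exp (- (cosh \<xi> / 2) * exp w)) * bessel_exp \<tau> w)"
    using integrable_suminf[OF fi ae sm] unfolding fsum .
  define z where "z = complex_of_real (1 / (4 * p\<^sup>2))"
  define A where "A = of_real (2 / p) * exp (- \<i> * of_real \<tau> * of_real (ln (2 * p)))"
  have lnp: "ln (p / 2) = ln (2 * p) - ln 4" "ln p = ln (2 * p) - ln 2"
    using p ln_div[of "2 * p" 4] ln_div[of "2 * p" 2] by simp_all
  have trm: "(LBINT w. f k w) = A * (gen_coeff (\<i> * of_real \<tau>) k * z ^ k)" for k
  proof -
    have "(LBINT w. f k w) = c k * (Gamma (s k) * of_real (p / 2) powr (- s k))"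
      unfolding f integral_mult_right_zero Gamma_exp_integral(2)[OF sre p2] ..
    also have "of_real (p / 2) powr (- s k) = exp (- s k * of_real (ln (p / 2)))"
      using p2 Ln_of_real[OF p2] by (simp add: powr_def del: of_real_divide)
    also have "c k * (Gamma (s k) * exp (- s k * of_real (ln (p / 2)))) = 
      (exp (- (2 * of_nat k + \<i> * of_real \<tau>) * of_real (ln 4)) * exp (- s k * of_real (ln (p / 2)))) * gen_coeff (\<i> * of_real \<tau>) k"
      unfolding c_def gen_coeff_def s_def rGamma_inverse_Gamma divide_inverse inverse_mult_distrib by (simp only: mult_ac)
    also have "exp (- (2 * of_nat k + \<i> * of_real \<tau>) * of_real (ln 4)) * exp (- s k * of_real (ln (p / 2))) = 
       exp (- of_real (ln (p / 2))) * exp (- \<i> * of_real \<tau> * of_real (ln (2 * p))) * exp (of_nat k * of_real (- (2 * ln (2 * p))))"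
      unfolding exp_add[symmetric] s_def lnp(1) by (simp add: algebra_simps)
    also have "exp (of_nat k * complex_of_real (- (2 * ln (2 * p)))) = z ^ k"
    proof -
      have "exp (ln (2 * p)) = 2 * p" using p by simp
      moreover have "exp (- (2 * ln (2 * p))) = inverse (exp (ln (2 * p)) * exp (ln (2 * p)))"
        unfolding mult_2 exp_minus exp_add ..
      ultimately have "exp (- (2 * ln (2 * p))) = inverse (2 * p * (2 * p))" by (simp only:)
      also have "\<dots> = 1 / (4 * p\<^sup>2)" using p by (simp add: power2_eq_square field_simps)
      finally have "exp (- (2 * ln (2 * p))) = 1 / (4 * p\<^sup>2)" .
      then show ?thesis unfolding z_def exp_of_nat_mult exp_of_real by simp
    qed
    also have "exp (- complex_of_real (ln (p / 2))) = of_real (2 / p)"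
      using p by (simp add: exp_minus exp_of_real)
    finally show ?thesis by (simp add: A_def)
  qed
  have "norm z = 1 / 4 * (1 / p\<^sup>2)" unfolding z_def norm_of_real by simp
  then have nz: "norm z < 1 / 4" using p1 by linarith
  have "(\<lambda>k. LBINT w. f k w) sums (A * (exp (- (\<i> * of_real \<tau>) * Ln ((1 + csqrt (1 - 4 * z)) / 2)) / csqrt (1 - 4 * z)))"
    unfolding trm by (intro sums_mult gen_coeff_sums nz) simp
  moreover have "(\<lambda>k. LBINT w. f k w) sums (LBINT w. of_real (exp w * exp (- (cosh \<xi> / 2) * exp w)) * bessel_exp \<tau> w)"
    using sums_integral[OF fi ae sm] unfolding fsum .
  ultimately have "(LBINT w. of_real (exp w * exp (- (cosh \<xi> / 2) * exp w)) * bessel_exp \<tau> w) = 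
    A * (exp (- (\<i> * of_real \<tau>) * Ln ((1 + csqrt (1 - 4 * z)) / 2)) / csqrt (1 - 4 * z))"
    using sums_unique2 by blast
  also have "csqrt (1 - 4 * z) = of_real (sinh \<xi> / p)"
  proof -
    have "1 - 4 * z = of_real ((sinh \<xi> / p)\<^sup>2)"
      using p sinh_square_eq[of \<xi>] by (simp add: z_def p_def[symmetric] power_divide diff_divide_distrib)
    then have "csqrt (1 - 4 * z) = of_real (sqrt ((sinh \<xi> / p)\<^sup>2))"
      by (simp only: of_real_sqrt zero_le_power2)
    then show ?thesis using xi p by (simp add: real_sqrt_abs)
  qed
  also have "Ln ((1 + complex_of_real (sinh \<xi> / p)) / 2) = of_real (\<xi> - ln (2 * p))"
  proof -
    have "(1 + sinh \<xi> / p) / 2 = exp \<xi> / (2 * p)"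
      using p sinh_plus_cosh[of \<xi>] by (simp add: p_def[symmetric] divide_simps)
    also have "\<dots> = exp (\<xi> - ln (2 * p))" using p by (simp add: exp_diff)
    finally have "(1 + complex_of_real (sinh \<xi> / p)) / 2 = of_real (exp (\<xi> - ln (2 * p)))"
      by (metis of_real_1 of_real_add of_real_divide of_real_numeral)
    then show ?thesis by (simp only: Ln_of_real[OF exp_gt_zero] ln_exp)
  qed
  also have "A * (exp (- (\<i> * of_real \<tau>) * of_real (\<xi> - ln (2 * p))) / of_real (sinh \<xi> / p)) =
     (exp (- \<i> * of_real \<tau> * of_real (ln (2 * p))) * exp (- (\<i> * of_real \<tau>) * of_real (\<xi> - ln (2 * p)))) * (of_real (2 / p) / of_real (sinh \<xi> / p))"
    unfolding A_def by simp
  also have "exp (- \<i> * of_real \<tau> * of_real (ln (2 * p))) * exp (- (\<i> * of_real \<tau>) * of_real (\<xi> - ln (2 * p))) = exp (- \<i> * of_real (\<tau> * \<xi>))"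
    unfolding exp_add[symmetric] by (simp add: algebra_simps)
  also have "complex_of_real (2 / p) / of_real (sinh \<xi> / p) = 2 / of_real (sinh \<xi>)"
    using p by simp
  finally show "(LBINT w. of_real (exp w * exp (- (cosh \<xi> / 2) * exp w)) * bessel_exp \<tau> w) = 2 * exp (- \<i> * of_real (\<tau> * \<xi>)) / of_real (sinh \<xi>)"
    by simp
qed

section \<open>The Stieltjes transform of the modified Bessel function\<close>

text \<open>A continuous decomposition of \<open>1/c\<close> that is adapted to the Laplace transform of the Bessel function: it is
  \<open>\<integral> e\<^bsup>-yc\<^esup> dy = 1/c\<close> with \<open>y = cosh \<xi> - 1\<close>, extended evenly in \<open>\<xi>\<close>.\<close>

lemma integral_cosh_reciprocal:
  fixes c :: real
  assumes c: "c > 0"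
  shows "integrable lborel (\<lambda>\<xi>. exp (- ((cosh \<xi> - 1) * c)) * \<bar>sinh \<xi>\<bar>)"
    and "(LBINT \<xi>. exp (- ((cosh \<xi> - 1) * c)) * \<bar>sinh \<xi>\<bar>) = 2 / c"
proof -
  let ?f = "\<lambda>\<xi>. exp (- ((cosh \<xi> - 1) * c)) * \<bar>sinh \<xi>\<bar>"
  have "has_bochner_integral lborel (\<lambda>\<xi>. indicator {0..} \<xi> *\<^sub>R ?f \<xi>) (1 / c)"
  proof -
    have "(\<integral>\<^sup>+ \<xi>. ennreal (?f \<xi>) * indicator {0..} \<xi> \<partial>lborel) = ennreal (0 - (- exp (- ((cosh 0 - 1) * c)) / c))"
    proof (rule nn_integral_FTC_atLeast)
      show "?f \<in> borel_measurable borel" by measurable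
      fix \<xi> :: real assume xi: "0 \<le> \<xi>"
      have "((\<lambda>\<xi>. - exp (- ((cosh \<xi> - 1) * c)) / c) has_field_derivative exp (- ((cosh \<xi> - 1) * c)) * sinh \<xi>) (at \<xi>)"
        using c by (auto intro!: derivative_eq_intros)
      moreover have "\<bar>sinh \<xi>\<bar> = sinh \<xi>" using xi by simp
      ultimately show "((\<lambda>\<xi>. - exp (- ((cosh \<xi> - 1) * c)) / c) has_field_derivative ?f \<xi>) (at \<xi>)" by simp
      show "0 \<le> ?f \<xi>" by simp
    next
      have "filterlim (\<lambda>\<xi>::real. c * (- 1 + cosh \<xi>)) at_top at_top"
        by (intro filterlim_tendsto_pos_mult_at_top[OF tendsto_const c] filterlim_tendsto_add_at_top[OF tendsto_const] cosh_real_at_top)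
      then have "filterlim (\<lambda>\<xi>::real. (cosh \<xi> - 1) * c) at_top at_top"
        by (simp add: mult.commute)
      then have "((\<lambda>\<xi>. exp (- ((cosh \<xi> - 1) * c))) \<longlongrightarrow> 0) at_top"
        by (intro filterlim_compose[OF exp_at_bot] filterlim_compose[OF filterlim_uminus_at_bot_at_top])
      then show "((\<lambda>\<xi>. - exp (- ((cosh \<xi> - 1) * c)) / c) \<longlongrightarrow> 0) at_top"
        using tendsto_divide[OF tendsto_minus tendsto_const, of _ 0 at_top c] c by simp
    qed
    also have "\<dots> = ennreal (1 / c)" by simp
    finally have n: "(\<integral>\<^sup>+ \<xi>. ennreal (indicator {0..} \<xi> *\<^sub>R ?f \<xi>) \<partial>lborel) = ennreal (1 / c)"
      by (subst (asm) nn_integral_cong[where v = "\<lambda>\<xi>. ennreal (indicator {0..} \<xi> *\<^sub>R ?f \<xi>)"]) (auto split: split_indicator)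
    show ?thesis
      by (rule has_bochner_integral_nn_integral[OF _ _ _ n]) (use c in auto)
  qed
  from has_bochner_integral_even_function[OF this] have h: "has_bochner_integral lborel ?f (2 * (1 / c))" by simp
  show "integrable lborel ?f" "(LBINT \<xi>. ?f \<xi>) = 2 / c"
    using h by (auto simp: has_bochner_integral_iff)
qed

lemma bessel_laplace_Re:
  assumes xi: "\<xi> \<noteq> 0"
  shows "integrable lborel (\<lambda>w. exp w * exp (- (cosh \<xi> / 2) * exp w) * Re (bessel_exp \<tau> w))"
    and "(LBINT w. exp w * exp (- (cosh \<xi> / 2) * exp w) * Re (bessel_exp \<tau> w)) = 2 * cos (\<tau> * \<xi>) / \<bar>sinh \<xi>\<bar>"
proof -
  have p: "\<bar>\<xi>\<bar> > 0" using xi by simp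
  have c: "cosh \<bar>\<xi>\<bar> = cosh \<xi>" "sinh \<bar>\<xi>\<bar> = \<bar>sinh \<xi>\<bar>" "cos (\<tau> * \<bar>\<xi>\<bar>) = cos (\<tau> * \<xi>)" by (cases "\<xi> \<ge> 0"; simp)+
  note i = bessel_laplace(1)[OF p, of \<tau>, unfolded c]
  show "integrable lborel (\<lambda>w. exp w * exp (- (cosh \<xi> / 2) * exp w) * Re (bessel_exp \<tau> w))"
    using integrable_Re[OF i] by simp
  have "(LBINT w. exp w * exp (- (cosh \<xi> / 2) * exp w) * Re (bessel_exp \<tau> w)) = Re (2 * exp (- \<i> * of_real (\<tau> * \<bar>\<xi>\<bar>)) / of_real \<bar>sinh \<xi>\<bar>)"
    using integral_Re[OF i] unfolding bessel_laplace(2)[OF p, of \<tau>, unfolded c] by simp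
  also have "\<dots> = 2 * cos (\<tau> * \<xi>) / \<bar>sinh \<xi>\<bar>"
    by (simp add: Re_divide_of_real Re_exp c del: of_real_mult)
  finally show "(LBINT w. exp w * exp (- (cosh \<xi> / 2) * exp w) * Re (bessel_exp \<tau> w)) = 2 * cos (\<tau> * \<xi>) / \<bar>sinh \<xi>\<bar>" .
qed

text \<open>Write \<open>1/(t+u)\<close> by \<open>integral_cosh_reciprocal\<close> and integrate over \<open>t\<close> first. The Laplace transform contributes
  \<open>1/|sinh \<xi>|\<close>, which cancels the \<open>|sinh \<xi>|\<close> of the decomposition, and the integral for \<open>K\<^bsub>i\<tau>\<^esub>\<close> remains. The majorant is the
  same computation for \<open>\<tau> = 0\<close>, where everything is nonnegative.\<close>

lemma bessel_stieltjes:
  fixes u :: real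
  assumes u: "u > 0"
  shows "integrable lborel (\<lambda>w. exp w * exp (- (exp w / 2)) * Re (bessel_exp \<tau> w) / (exp w + u))"
    and "(LBINT w. exp w * exp (- (exp w / 2)) * Re (bessel_exp \<tau> w) / (exp w + u)) = exp (u / 2) * macdonald \<tau> (u / 2)"
proof -
  define S where "S = (\<lambda>\<xi>. exp (- ((cosh \<xi> - 1) * (u / 2))) * \<bar>sinh \<xi>\<bar>)"
  define f where "f = (\<lambda>\<xi> w. S \<xi> * (exp w * exp (- (cosh \<xi> / 2) * exp w) * Re (bessel_exp \<tau> w)))"
  define R where "R = norm (rGamma (1 + \<i> * of_real \<tau>))"
  define D where "D = (\<lambda>\<xi> w. S \<xi> * (exp w * exp (- (cosh \<xi> / 2) * exp w) * (R * Re (bessel_exp 0 w))))"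
  have S0: "S \<xi> \<ge> 0" for \<xi> by (simp add: S_def)
  have m: "case_prod f \<in> borel_measurable (borel \<Otimes>\<^sub>M borel)"
    unfolding f_def S_def by (simp add: case_prod_beta) measurable
  have Dn: "norm (f \<xi> w) \<le> D \<xi> w" for \<xi> w
    using order_trans[OF abs_Re_le_cmod norm_bessel_exp_le[of \<tau> w]] S0
    unfolding f_def D_def R_def by (auto simp: abs_mult intro!: mult_left_mono)
  have expS: "exp (- ((cosh \<xi> - 1) * (u / 2))) = exp (u / 2) * exp (- (u / 2) * cosh \<xi>)" for \<xi>
    unfolding exp_add[symmetric] by (simp add: field_simps)
  have lap: "(LBINT w. S \<xi> * (exp w * exp (- (cosh \<xi> / 2) * exp w) * (c * Re (bessel_exp t w)))) = (if \<xi> = 0 then 0 else 2 * c * exp (u / 2) * (exp (- (u / 2) * cosh \<xi>) * cos (t * \<xi>)))" for \<xi> t c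
  proof (cases "\<xi> = 0")
    case True then show ?thesis by (simp add: S_def)
  next
    case False
    have "(LBINT w. S \<xi> * (exp w * exp (- (cosh \<xi> / 2) * exp w) * (c * Re (bessel_exp t w)))) = (LBINT w. (S \<xi> * c) * (exp w * exp (- (cosh \<xi> / 2) * exp w) * Re (bessel_exp t w)))"
      by (simp add: mult_ac)
    also have "\<dots> = (S \<xi> * c) * (2 * cos (t * \<xi>) / \<bar>sinh \<xi>\<bar>)"
      unfolding integral_mult_right_zero bessel_laplace_Re(2)[OF False] ..
    also have "\<dots> = 2 * c * (exp (- ((cosh \<xi> - 1) * (u / 2))) * cos (t * \<xi>))"
      using False by (simp add: S_def)
    finally show ?thesis using False unfolding expS by (simp add: mult_ac)
  qed
  have Di: "integrable lborel (D \<xi>)" for \<xi>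
  proof (cases "\<xi> = 0")
    case True then show ?thesis by (simp add: D_def S_def)
  next
    case False
    have "integrable lborel (\<lambda>w. (S \<xi> * R) * (exp w * exp (- (cosh \<xi> / 2) * exp w) * Re (bessel_exp 0 w)))"
      by (intro integrable_mult_right bessel_laplace_Re False)
    then show ?thesis by (simp add: D_def mult_ac)
  qed
  have DE: "(LBINT w. D \<xi> w) \<le> 2 * R * exp (u / 2) * exp (- (u / 2) * cosh \<xi>)" for \<xi>
    unfolding D_def lap by (simp add: R_def)
  have Ei: "integrable lborel (\<lambda>\<xi>. 2 * R * exp (u / 2) * exp (- (u / 2) * cosh \<xi>))"
    by (intro integrable_mult_right integrable_exp_minus_cosh) (use u in simp)
  note fub = fubini_dominated[OF m Di Dn DE Ei]
  have fxi: "(LBINT \<xi>. f \<xi> w) = 4 * (exp w * exp (- (exp w / 2)) * Re (bessel_exp \<tau> w) / (exp w + u))" for w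
  proof -
    have c: "(exp w + u) / 2 > 0" using u by (simp add: add_pos_pos)
    have "exp (- ((cosh \<xi> - 1) * (u / 2))) * exp (- (cosh \<xi> / 2) * exp w) = exp (- (exp w / 2)) * exp (- ((cosh \<xi> - 1) * ((exp w + u) / 2)))" for \<xi>
      unfolding exp_add[symmetric] by (simp add: algebra_simps add_divide_distrib diff_divide_distrib)
    then have "f \<xi> w = (exp w * exp (- (exp w / 2)) * Re (bessel_exp \<tau> w)) * (exp (- ((cosh \<xi> - 1) * ((exp w + u) / 2))) * \<bar>sinh \<xi>\<bar>)" for \<xi>
      unfolding f_def S_def by (simp add: mult_ac)
    then have "(LBINT \<xi>. f \<xi> w) = (exp w * exp (- (exp w / 2)) * Re (bessel_exp \<tau> w)) * (2 / ((exp w + u) / 2))"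
      using integral_cosh_reciprocal(2)[OF c] by simp
    then show ?thesis by simp
  qed
  show "integrable lborel (\<lambda>w. exp w * exp (- (exp w / 2)) * Re (bessel_exp \<tau> w) / (exp w + u))"
    using integrable_mult_right[OF fub(2)[unfolded fxi], of "1/4"] by simp
  \<comment> \<open>At \<open>\<xi> = 0\<close> the Laplace integral diverges, but this single point does not matter.\<close>
  have ae: "AE \<xi> in lborel. (if \<xi> = 0 then 0 else 2 * 1 * exp (u / 2) * (exp (- (u / 2) * cosh \<xi>) * cos (\<tau> * \<xi>))) = 2 * 1 * exp (u / 2) * (exp (- (u / 2) * cosh \<xi>) * cos (\<tau> * \<xi>))"
    using AE_lborel_singleton[of "0::real"] by eventually_elim auto
  have "(LBINT \<xi>. LBINT w. f \<xi> w) = (LBINT \<xi>. (if \<xi> = 0 then 0 else 2 * 1 * exp (u / 2) * (exp (- (u / 2) * cosh \<xi>) * cos (\<tau> * \<xi>))))"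
    unfolding f_def using lap[of _ 1 \<tau>] by simp
  also have "\<dots> = (LBINT \<xi>. 2 * 1 * exp (u / 2) * (exp (- (u / 2) * cosh \<xi>) * cos (\<tau> * \<xi>)))"
    by (rule integral_cong_AE[OF _ _ ae]) measurable
  also have "\<dots> = 4 * (exp (u / 2) * macdonald \<tau> (u / 2))"
    unfolding integral_mult_right_zero macdonald_def by simp
  finally show "(LBINT w. exp w * exp (- (exp w / 2)) * Re (bessel_exp \<tau> w) / (exp w + u)) = exp (u / 2) * macdonald \<tau> (u / 2)"
    using fub(3) unfolding fxi integral_mult_right_zero by simp
qed

section \<open>Antiperiodic holomorphic functions\<close>

lemma holomorphic_quotient_simple_zeros:
  assumes f: "f holomorphic_on UNIV" and g: "g holomorphic_on UNIV"
    and zeros: "\<And>z. g z = 0 \<Longrightarrow> f z = 0 \<and> deriv g z \<noteq> 0"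
  obtains V where "V holomorphic_on UNIV" "\<And>z. f z = V z * g z"
proof
  define V where "V = (\<lambda>z. if g z = 0 then deriv f z / deriv g z else f z / g z)"
  show "f z = V z * g z" for z using zeros[of z] by (simp add: V_def)
  have "V field_differentiable at z" for z
  proof (cases "g z = 0")
    case False
    define S where "S = {w. g w \<noteq> 0}"
    have S: "open S" "z \<in> S"
      using False continuous_open_preimage[OF holomorphic_on_imp_continuous_on[OF g], of "- {0}"]
      by (auto simp: S_def vimage_def)
    have "(\<lambda>w. f w / g w) holomorphic_on S"
      using f g by (auto intro!: holomorphic_intros intro: holomorphic_on_subset simp: S_def)
    then have "V holomorphic_on S"
      by (rule holomorphic_transform) (simp add: V_def S_def)
    then show ?thesis using S holomorphic_on_imp_differentiable_at by blast
  next
    case True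
    note z = zeros[OF True]
    define F where "F = (\<lambda>w. if w = z then deriv f z else (f w - f z) / (w - z))"
    define G where "G = (\<lambda>w. if w = z then deriv g z else (g w - g z) / (w - z))"
    have F: "F holomorphic_on UNIV" and G: "G holomorphic_on UNIV"
      unfolding F_def G_def using f g by (auto intro!: pole_lemma_open)
    define S where "S = {w. G w \<noteq> 0}"
    have S: "open S" "z \<in> S"
    proof -
      show "open S"
        using continuous_open_preimage[OF holomorphic_on_imp_continuous_on[OF G], of "- {0}"]
        by (auto simp: S_def vimage_def)
      show "z \<in> S" using z by (simp add: S_def G_def)
    qed
    have "(\<lambda>w. F w / G w) holomorphic_on S"
      using F G by (auto intro!: holomorphic_intros intro: holomorphic_on_subset simp: S_def)
    moreover have "F w / G w = V w" if "w \<in> S" for w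
      using that z True by (cases "w = z") (auto simp: S_def F_def G_def V_def)
    ultimately have "V holomorphic_on S" by (rule holomorphic_transform)
    then show ?thesis using S holomorphic_on_imp_differentiable_at by blast
  qed
  then show "V holomorphic_on UNIV" by (simp add: holomorphic_on_def)
qed

text \<open>Extend by \<open>F(s) = (-1)\<^sup>n f(s+n)\<close> for any \<open>n\<close> that moves \<open>s\<close> into the half-plane.\<close>

lemma antiperiodic_extension:
  assumes f: "f holomorphic_on {s. Re s > 0}" and anti: "\<And>s. Re s > 0 \<Longrightarrow> f (s + 1) = - f s"
  obtains F where "F holomorphic_on UNIV" "\<And>s. Re s > 0 \<Longrightarrow> F s = f s" "\<And>s. F (s + 1) = - F s"
proof
  define N where "N = (\<lambda>s. nat \<lceil>1 - Re s\<rceil>)"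
  define F where "F = (\<lambda>s. (- 1) ^ N s * f (s + of_nat (N s)))"
  have N: "Re s + real (N s) > 0" for s unfolding N_def by linarith
  have step: "f (s + of_nat k) = (- 1) ^ k * f s" if "Re s > 0" for s k
  proof (induction k)
    case (Suc k)
    have "f (s + of_nat (Suc k)) = f ((s + of_nat k) + 1)" by (simp add: add_ac)
    also have "\<dots> = - f (s + of_nat k)" using that by (intro anti) simp
    finally show ?case using Suc by simp
  qed simp
  have mono: "(- 1) ^ n * f (s + of_nat n) = (- 1) ^ m * f (s + of_nat m)" if "Re s + real m > 0" "m \<le> n" for s m n
  proof -
    have "f (s + of_nat n) = f ((s + of_nat m) + of_nat (n - m))" using that by (simp add: of_nat_diff)
    also have "\<dots> = (- 1) ^ (n - m) * f (s + of_nat m)" using that by (intro step) simp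
    finally have a: "(- 1) ^ n * f (s + of_nat n) = (- 1) ^ n * ((- 1) ^ (n - m) * f (s + of_nat m))" by simp
    have b: "(- 1 :: complex) ^ n = (- 1) ^ m * (- 1) ^ (n - m)" using that by (simp flip: power_add)
    have c: "(- 1 :: complex) ^ (n - m) * ((- 1) ^ (n - m) * X) = X" for X
      unfolding mult.assoc[symmetric] by (simp flip: power_mult_distrib)
    show ?thesis by (rule trans[OF a]) (simp only: b mult.assoc c)
  qed
  have F: "F s = (- 1) ^ n * f (s + of_nat n)" if "Re s + real n > 0" for s n
    unfolding F_def using mono[of s n "N s"] mono[of s "N s" n] N[of s] that by (cases "n \<le> N s") auto
  show "F s = f s" if "Re s > 0" for s using F[of s 0] that by simp
  show "F (s + 1) = - F s" for s
    using F[of "s + 1" "N s"] F[of s "Suc (N s)"] N[of s] by (simp add: add_ac)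
  have "F field_differentiable at s" for s
  proof -
    define n where "n = N s"
    define S where "S = {w. Re w > - real n}"
    have S: "open S" "s \<in> S" using N[of s] by (auto simp: S_def n_def open_halfspace_Re_gt)
    have "(f \<circ> (\<lambda>w. w + of_nat n)) holomorphic_on S"
      by (rule holomorphic_on_compose_gen[OF _ f]) (auto intro!: holomorphic_intros simp: S_def)
    then have "(\<lambda>w. (- 1) ^ n * f (w + of_nat n)) holomorphic_on S"
      by (auto intro!: holomorphic_intros simp: o_def)
    then have "F holomorphic_on S"
      by (rule holomorphic_transform) (subst F[of _ n], auto simp: S_def)
    then show ?thesis using S holomorphic_on_imp_differentiable_at by blast
  qed
  then show "F holomorphic_on UNIV" by (simp add: holomorphic_on_def)
qed

text \<open>This product has period 1, and its zeros, all simple when \<open>x \<noteq> 0\<close>, are the poles of the Gamma quotients \<open>\<Gamma>(s+ix)\<Gamma>(s-ix)\<close>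
  continued periodically.\<close>

definition sin_pair :: "real \<Rightarrow> complex \<Rightarrow> complex" where
  "sin_pair x s = sin (of_real pi * (s + \<i> * of_real x)) * sin (of_real pi * (s - \<i> * of_real x))"

lemma sin_pi_eq_0: "sin (of_real pi * w) = 0 \<longleftrightarrow> (\<exists>n::int. w = of_int n)" for w :: complex
proof -
  have "sin (of_real pi * w) = 0 \<longleftrightarrow> (\<exists>n::int. of_real pi * w = of_real (of_int n * pi))" by (rule sin_eq_0)
  also have "\<dots> \<longleftrightarrow> (\<exists>n::int. w = of_int n)"
    by (intro ex_cong1) (simp add: field_simps)
  finally show ?thesis .
qed

lemma sin_pi_plus_1: "sin (of_real pi * (w + 1)) = - sin (of_real pi * w)" for w :: complex
  by (simp add: distrib_left sin_add)

lemma sin_pair_plus_1: "sin_pair x (s + 1) = sin_pair x s"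
proof -
  have "s + 1 + c = (s + c) + 1" "s + 1 - c = (s - c) + 1" for c :: complex by simp_all
  then show ?thesis unfolding sin_pair_def by (simp only: sin_pi_plus_1) simp
qed

lemma norm_sin_ge: "norm (sin w) \<ge> \<bar>Im w\<bar>" for w :: complex
proof -
  have *: "norm (sin w) \<ge> Im w" for w :: complex
  proof -
    have s: "sin w = - (\<i> / 2) * (exp (\<i> * w) - exp (- (\<i> * w)))"
      by (simp add: sin_exp_eq field_simps)
    have "norm (sin w) = norm (exp (\<i> * w) - exp (- (\<i> * w))) / 2"
      unfolding s norm_mult by (simp add: norm_divide)
    moreover have "norm (exp (- (\<i> * w))) - norm (exp (\<i> * w)) \<le> norm (exp (\<i> * w) - exp (- (\<i> * w)))"
      by (metis norm_minus_commute norm_triangle_ineq2)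
    moreover have "norm (exp (- (\<i> * w))) = exp (Im w)" "norm (exp (\<i> * w)) = exp (- Im w)" by simp_all
    ultimately have "norm (sin w) \<ge> sinh (Im w)" by (simp add: sinh_def)
    moreover have "sinh y \<ge> y" if "y \<ge> 0" for y :: real
    proof -
      have "(\<lambda>y. sinh y - y) 0 \<le> (\<lambda>y. sinh y - y) y"
        by (rule DERIV_nonneg_imp_nondecreasing[OF that])
          (auto intro!: exI derivative_eq_intros simp: cosh_real_ge_1)
      then show ?thesis by simp
    qed
    ultimately show ?thesis by (cases "Im w \<ge> 0") (force intro: order_trans[OF _ norm_ge_zero])+
  qed
  from *[of w] *[of "- w"] show ?thesis by auto
qed

text \<open>Divide the antiperiodic extension of \<open>f\<close> by the sine product. The values at \<open>1 \<plusminus> ix\<close> determine those at all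
  zeros of the denominator, so the quotient \<open>V\<close> is entire; it is bounded on a period strip, hence everywhere, hence constant, and an
  antiperiodic constant is zero.\<close>

lemma antiperiodic_vanishes:
  assumes x: "x \<noteq> 0"
    and f: "f holomorphic_on {s. Re s > 0}" and anti: "\<And>s. Re s > 0 \<Longrightarrow> f (s + 1) = - f s"
    and f0: "f (1 + \<i> * of_real x) = 0" "f (1 - \<i> * of_real x) = 0"
    and bound: "\<And>s. 2 \<le> Re s \<Longrightarrow> Re s \<le> 3 \<Longrightarrow> \<bar>Im s\<bar> \<ge> Y \<Longrightarrow> norm (f s) \<le> C * norm (sin_pair x s)"
    and s: "Re s > 0"
  shows "f s = 0"
proof -
  obtain F where F: "F holomorphic_on UNIV" "\<And>s. Re s > 0 \<Longrightarrow> F s = f s" "\<And>s. F (s + 1) = - F s"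
    using antiperiodic_extension[OF f anti] by blast
  have int_shift: "norm (G (s + of_int n)) = norm (G s)" if "\<And>s. G (s + 1) = - G s" for G :: "complex \<Rightarrow> complex" and s n
  proof (induction n rule: int_induct[where k = 0])
    case (step1 i) then show ?case using that[of "s + of_int i"] by (simp add: add_ac)
  next
    case (step2 i)
    then show ?case using that[of "s + of_int (i - 1)"] by (simp add: add_ac)
  qed simp
  let ?Z = "sin_pair x"
  have Zh: "?Z holomorphic_on UNIV" unfolding sin_pair_def by (intro holomorphic_intros)
  have Z0: "?Z s = 0 \<longleftrightarrow> (\<exists>n::int. s = of_int n - \<i> * of_real x \<or> s = of_int n + \<i> * of_real x)" for s
    unfolding sin_pair_def mult_eq_0_iff sin_pi_eq_0 by (auto simp: algebra_simps)
  have Zim: "?Z s \<noteq> 0" if "\<bar>Im s\<bar> > \<bar>x\<bar>" for s using that unfolding Z0 by auto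
  have zeros: "F s = 0 \<and> deriv ?Z s \<noteq> 0" if "?Z s = 0" for s
  proof
    from that obtain n :: int where n: "s = of_int n - \<i> * of_real x \<or> s = of_int n + \<i> * of_real x" unfolding Z0 by blast
    have "F (1 + \<i> * of_real x) = 0" "F (1 - \<i> * of_real x) = 0" using F(2) f0 by simp_all
    then have "norm (F (1 + \<i> * of_real x + of_int (n - 1))) = 0" "norm (F (1 - \<i> * of_real x + of_int (n - 1))) = 0"
      by (simp_all only: int_shift[of F, OF F(3)] norm_zero)
    moreover have "1 + c + of_int (n - 1) = of_int n + c" "1 - c + of_int (n - 1) = of_int n - c" for c :: complex by simp_all
    ultimately show "F s = 0" using n by (auto simp: add_ac)
    have d: "(?Z has_field_derivative of_real pi * (cos (of_real pi * (s + \<i> * of_real x)) * sin (of_real pi * (s - \<i> * of_real x))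
        + sin (of_real pi * (s + \<i> * of_real x)) * cos (of_real pi * (s - \<i> * of_real x)))) (at s)"
      unfolding sin_pair_def by (auto intro!: derivative_eq_intros simp: algebra_simps)
    have nz: "sin (of_real pi * w) \<noteq> 0" if "Im w \<noteq> 0" for w
      unfolding sin_pi_eq_0 using that by auto
    have cz: "cos v \<noteq> 0" if "sin v = 0" for v :: complex
      using sin_cos_squared_add[of v] that by auto
    have "deriv ?Z s = of_real pi * (cos (of_real pi * (s + \<i> * of_real x)) * sin (of_real pi * (s - \<i> * of_real x))
        + sin (of_real pi * (s + \<i> * of_real x)) * cos (of_real pi * (s - \<i> * of_real x)))"
      using d by (rule DERIV_imp_deriv)
    moreover have "sin (of_real pi * (s + \<i> * of_real x)) = 0 \<and> sin (of_real pi * (s - \<i> * of_real x)) \<noteq> 0 \<or>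
      sin (of_real pi * (s + \<i> * of_real x)) \<noteq> 0 \<and> sin (of_real pi * (s - \<i> * of_real x)) = 0"
      using n
    proof
      assume "s = of_int n - \<i> * of_real x"
      then show ?thesis using x nz[of "s - \<i> * of_real x"] sin_pi_eq_0[of "s + \<i> * of_real x"] by auto
    next
      assume "s = of_int n + \<i> * of_real x"
      then show ?thesis using x nz[of "s + \<i> * of_real x"] sin_pi_eq_0[of "s - \<i> * of_real x"] by auto
    qed
    ultimately show "deriv ?Z s \<noteq> 0" using cz by auto
  qed
  obtain V where V: "V holomorphic_on UNIV" "\<And>s. F s = V s * ?Z s"
    using holomorphic_quotient_simple_zeros[OF F(1) Zh zeros] by blast
  \<comment> \<open>At the zeros of the denominator antiperiodicity of the quotient follows by analytic continuation from the upper half-plane.\<close>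
  have Vanti: "V (s + 1) = - V s" for s
  proof (rule analytic_continuation_open[of "{s. Im s > \<bar>x\<bar>}" UNIV "\<lambda>s. V (s + 1)" "\<lambda>s. - V s"])
    show "open {s. Im s > \<bar>x\<bar>}" by (rule open_halfspace_Im_gt)
    have "Complex 0 (\<bar>x\<bar> + 1) \<in> {s. Im s > \<bar>x\<bar>}" by simp
    then show "{s. Im s > \<bar>x\<bar>} \<noteq> {}" by blast
    have "(V \<circ> (\<lambda>s. s + 1)) holomorphic_on UNIV"
      by (rule holomorphic_on_compose_gen[OF _ V(1)]) (auto intro!: holomorphic_intros)
    then show "(\<lambda>s. V (s + 1)) holomorphic_on UNIV" by (simp add: o_def)
    show "(\<lambda>s. - V s) holomorphic_on UNIV" using V(1) by (intro holomorphic_intros)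
    fix z assume "z \<in> {s. Im s > \<bar>x\<bar>}"
    then have "?Z z \<noteq> 0" using Zim[of z] by simp
    moreover have "V (z + 1) * ?Z z = - V z * ?Z z"
      using V(2)[of "z + 1"] V(2)[of z] F(3)[of z] by (simp add: sin_pair_plus_1)
    ultimately show "V (z + 1) = - V z" by (metis mult_right_cancel)
  qed auto
  define Y' where "Y' = max Y (\<bar>x\<bar> + 1)"
  let ?K = "cbox (Complex 2 (- Y')) (Complex 3 Y')"
  have "compact (V ` ?K)"
    using V(1) by (intro compact_continuous_image holomorphic_on_imp_continuous_on compact_cbox) (auto intro: holomorphic_on_subset)
  then obtain B where B: "\<And>s. s \<in> ?K \<Longrightarrow> norm (V s) \<le> B" using compact_imp_bounded bounded_iff by (metis imageI)
  have strip: "norm (V s) \<le> max B C" if "2 \<le> Re s" "Re s \<le> 3" for s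
  proof (cases "\<bar>Im s\<bar> \<le> Y'")
    case True
    then have "s \<in> ?K" using that by (auto simp: in_cbox_complex_iff)
    then show ?thesis using B[of s] by simp
  next
    case False
    then have Y: "\<bar>Im s\<bar> \<ge> Y" "\<bar>Im s\<bar> > \<bar>x\<bar>" by (auto simp: Y'_def)
    have "norm (V s) * norm (?Z s) = norm (f s)" using V(2)[of s] F(2)[of s] that by (simp add: norm_mult)
    also have "\<dots> \<le> C * norm (?Z s)" by (rule bound[OF that Y(1)])
    finally have "norm (V s) \<le> C" using Zim[OF Y(2)] by simp
    then show ?thesis by simp
  qed
  have "norm (V s) \<le> max B C" for s
  proof -
    define n where "n = 2 - \<lfloor>Re s\<rfloor>"
    have "2 \<le> Re (s + of_int n)" "Re (s + of_int n) \<le> 3" unfolding n_def by (simp_all) linarith+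
    from strip[OF this] show ?thesis using int_shift[of V, OF Vanti] by simp
  qed
  then have "bounded (range V)" unfolding bounded_iff by blast
  then obtain c where c: "\<And>s. V s = c" using Liouville_theorem[OF V(1)] by (auto simp: constant_on_def)
  have "c = - c" using Vanti[of 0] c by simp
  then have "c = 0" by simp
  then show ?thesis using V(2)[of s] F(2)[OF s] c by simp
qed

section \<open>Holomorphic Laplace integrals and the hypergeometric series\<close>

text \<open>Differentiate under the integral. The difference quotient of \<open>e\<^bsup>hv\<^esup>\<close> is at most \<open>|v| e\<^bsup>\<delta>|v|\<^esup>\<close>, and \<open>|v|\<close> is absorbed
  into another \<open>e\<^bsup>\<delta>|v|\<^esup>\<close>, so the integrability on neighbouring vertical lines suffices.\<close>

lemma holomorphic_laplace_integral:
  fixes \<phi> :: "real \<Rightarrow> complex"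
  assumes [measurable]: "\<phi> \<in> borel_measurable borel"
    and int: "\<And>\<sigma>. \<sigma> > 0 \<Longrightarrow> integrable lborel (\<lambda>v. exp (\<sigma> * v) * norm (\<phi> v))"
  shows "(\<lambda>s. LBINT v. exp (s * of_real v) * \<phi> v) holomorphic_on {s. Re s > 0}"
proof (rule holomorphic_onI)
  fix s0 :: complex assume "s0 \<in> {s. Re s > 0}"
  then have s0: "Re s0 > 0" by simp
  \<comment> \<open>A quarter: the majorant below lives on the lines \<open>Re s0 \<plusminus> 2\<delta>\<close>, which must stay in the half-plane.\<close>
  define \<delta> where "\<delta> = Re s0 / 4"
  have d: "\<delta> > 0" using s0 by (simp add: \<delta>_def)
  let ?F = "\<lambda>s. LBINT v. exp (s * of_real v) * \<phi> v"
  let ?D = "LBINT v. of_real v * exp (s0 * of_real v) * \<phi> v"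
  have i: "integrable lborel (\<lambda>v. exp (s * of_real v) * \<phi> v)" if "Re s > 0" for s
    by (rule Bochner_Integration.integrable_bound[OF int[OF that]]) (auto simp: norm_mult)
  have "((\<lambda>s. (?F s - ?F s0) / (s - s0)) \<longlongrightarrow> ?D) (at s0)"
    unfolding tendsto_at_iff_sequentially
  proof (intro allI impI)
    fix X assume X: "\<forall>i. X i \<in> UNIV - {s0}" "X \<longlonglongrightarrow> s0"
    then obtain N where N: "\<And>n. n \<ge> N \<Longrightarrow> norm (X n - s0) < \<delta>"
      using d unfolding LIMSEQ_iff by blast
    \<comment> \<open>Dominated convergence needs the bound for all indices, so the first \<open>N\<close> are dropped.\<close>
    define Y where "Y = (\<lambda>n. X (n + N))"
    have Y: "Y \<longlonglongrightarrow> s0" "\<And>n. Y n \<noteq> s0" "\<And>n. norm (Y n - s0) < \<delta>"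
      using X N LIMSEQ_ignore_initial_segment[OF X(2), of N] by (auto simp: Y_def)
    have Yre: "Re (Y n) > 0" for n
    proof -
      have "\<bar>Re (Y n) - Re s0\<bar> < \<delta>" using Y(3)[of n] abs_Re_le_cmod[of "Y n - s0"] by simp
      then show ?thesis using s0 by (simp add: \<delta>_def abs_if split: if_splits)
    qed
    define G where "G = (\<lambda>n v. exp (s0 * of_real v) * \<phi> v * ((exp ((Y n - s0) * of_real v) - 1) / (Y n - s0)))"
    have Geq: "(?F (Y n) - ?F s0) / (Y n - s0) = (LBINT v. G n v)" for n
    proof -
      have "?F (Y n) - ?F s0 = (LBINT v. exp (Y n * of_real v) * \<phi> v - exp (s0 * of_real v) * \<phi> v)"
        by (rule Bochner_Integration.integral_diff[symmetric]) (intro i Yre s0)+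
      also have "\<dots> = (LBINT v. (Y n - s0) * G n v)"
      proof (rule Bochner_Integration.integral_cong[OF refl])
        fix v
        have "exp (Y n * of_real v) = exp (s0 * of_real v) * exp ((Y n - s0) * of_real v)"
          unfolding exp_add[symmetric] by (simp add: algebra_simps)
        moreover have "A * B * p - A * p = d * (A * p * ((B - 1) / d))" if "d \<noteq> 0" for A B p d :: complex
        proof -
          have "d * (A * p * ((B - 1) / d)) = A * p * (B - 1)" using that by simp
          then show ?thesis by (simp add: algebra_simps)
        qed
        ultimately show "exp (Y n * of_real v) * \<phi> v - exp (s0 * of_real v) * \<phi> v = (Y n - s0) * G n v"
          unfolding G_def using Y(2)[of n] by (simp only: right_minus_eq not_False_eq_True)
      qed
      finally show ?thesis using Y(2)[of n] by simp
    qed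
    have "(\<lambda>n. LBINT v. G n v) \<longlonglongrightarrow> (LBINT v. of_real v * exp (s0 * of_real v) * \<phi> v)"
    proof (rule integral_dominated_convergence[where w = "\<lambda>v. 1 / \<delta> * (exp ((Re s0 + 2 * \<delta>) * v) * norm (\<phi> v) + exp ((Re s0 - 2 * \<delta>) * v) * norm (\<phi> v))"])
      show "integrable lborel (\<lambda>v. 1 / \<delta> * (exp ((Re s0 + 2 * \<delta>) * v) * norm (\<phi> v) + exp ((Re s0 - 2 * \<delta>) * v) * norm (\<phi> v)))"
        using s0 by (intro integrable_mult_right Bochner_Integration.integrable_add int) (auto simp: \<delta>_def)
      show "AE v in lborel. (\<lambda>n. G n v) \<longlonglongrightarrow> of_real v * exp (s0 * of_real v) * \<phi> v"
      proof (rule AE_I2)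
        fix v
        have "((\<lambda>h::complex. exp (h * of_real v)) has_field_derivative of_real v) (at 0)"
          by (auto intro!: derivative_eq_intros)
        then have "((\<lambda>h::complex. (exp (h * of_real v) - 1) / h) \<longlongrightarrow> of_real v) (at 0)"
          by (simp add: has_field_derivative_iff)
        moreover have "filterlim (\<lambda>n. Y n - s0) (at 0) sequentially"
          using Y(2) tendsto_diff[OF Y(1) tendsto_const, of s0] by (auto simp: filterlim_at)
        ultimately have "(\<lambda>n. (exp ((Y n - s0) * of_real v) - 1) / (Y n - s0)) \<longlonglongrightarrow> of_real v"
          by (rule filterlim_compose)
        then have "(\<lambda>n. G n v) \<longlonglongrightarrow> exp (s0 * of_real v) * \<phi> v * of_real v"
          unfolding G_def by (intro tendsto_mult tendsto_const)
        then show "(\<lambda>n. G n v) \<longlonglongrightarrow> of_real v * exp (s0 * of_real v) * \<phi> v" by (simp add: mult_ac)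
      qed
      show "AE v in lborel. norm (G n v) \<le> 1 / \<delta> * (exp ((Re s0 + 2 * \<delta>) * v) * norm (\<phi> v) + exp ((Re s0 - 2 * \<delta>) * v) * norm (\<phi> v))" for n
      proof (rule AE_I2)
        fix v
        define h where "h = Y n - s0"
        have h: "h \<noteq> 0" "norm h \<le> \<delta>" using Y(2,3)[of n] by (auto simp: h_def less_imp_le)
        have "norm (exp (h * of_real v) - 1) \<le> exp \<bar>Re (h * of_real v)\<bar> * norm (h * of_real v)"
          using Taylor_exp[of "h * of_real v" 0] by simp
        also have "\<dots> \<le> exp (\<delta> * \<bar>v\<bar>) * (norm h * \<bar>v\<bar>)"
        proof -
          have "\<bar>Re h\<bar> * \<bar>v\<bar> \<le> \<delta> * \<bar>v\<bar>"
            using h(2) abs_Re_le_cmod[of h] by (intro mult_right_mono) auto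
          then show ?thesis by (simp add: norm_mult abs_mult mult_right_mono)
        qed
        finally have b1: "norm ((exp (h * of_real v) - 1) / h) \<le> exp (\<delta> * \<bar>v\<bar>) * \<bar>v\<bar>"
          using h(1) by (simp add: norm_divide field_simps)
        have "\<delta> * \<bar>v\<bar> \<le> exp (\<delta> * \<bar>v\<bar>)"
          using exp_ge_add_one_self[of "\<delta> * \<bar>v\<bar>"] by linarith
        then have b2: "\<bar>v\<bar> \<le> 1 / \<delta> * exp (\<delta> * \<bar>v\<bar>)" using d by (simp add: field_simps)
        have b3: "exp (2 * \<delta> * \<bar>v\<bar>) \<le> exp (2 * \<delta> * v) + exp (- 2 * \<delta> * v)"
          by (cases "v \<ge> 0") auto
        have "exp (\<delta> * \<bar>v\<bar>) * \<bar>v\<bar> \<le> exp (\<delta> * \<bar>v\<bar>) * (1 / \<delta> * exp (\<delta> * \<bar>v\<bar>))"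
          by (intro mult_left_mono b2) simp
        also have "\<dots> = 1 / \<delta> * exp (2 * \<delta> * \<bar>v\<bar>)"
          by (simp flip: exp_add)
        also have "\<dots> \<le> 1 / \<delta> * (exp (2 * \<delta> * v) + exp (- 2 * \<delta> * v))"
          using d by (intro mult_left_mono b3) simp
        finally have "norm ((exp (h * of_real v) - 1) / h) \<le> 1 / \<delta> * (exp (2 * \<delta> * v) + exp (- 2 * \<delta> * v))"
          using b1 by linarith
        then have "norm (G n v) \<le> exp (Re s0 * v) * norm (\<phi> v) * (1 / \<delta> * (exp (2 * \<delta> * v) + exp (- 2 * \<delta> * v)))"
          unfolding G_def h_def[symmetric] norm_mult by (intro mult_mono) auto
        also have "\<dots> = 1 / \<delta> * ((exp (Re s0 * v) * exp (2 * \<delta> * v)) * norm (\<phi> v) + (exp (Re s0 * v) * exp (- 2 * \<delta> * v)) * norm (\<phi> v))"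
          by (simp add: algebra_simps add_divide_distrib)
        also have "exp (Re s0 * v) * exp (2 * \<delta> * v) = exp ((Re s0 + 2 * \<delta>) * v)"
          unfolding exp_add[symmetric] by (simp add: algebra_simps)
        also have "exp (Re s0 * v) * exp (- 2 * \<delta> * v) = exp ((Re s0 - 2 * \<delta>) * v)"
          unfolding exp_add[symmetric] by (simp add: algebra_simps)
        finally show "norm (G n v) \<le> 1 / \<delta> * (exp ((Re s0 + 2 * \<delta>) * v) * norm (\<phi> v) + exp ((Re s0 - 2 * \<delta>) * v) * norm (\<phi> v))" .
      qed
    qed (auto simp: G_def)
    then have "(\<lambda>n. (?F (Y n) - ?F s0) / (Y n - s0)) \<longlonglongrightarrow> ?D" unfolding Geq .
    then have "(\<lambda>n. ((\<lambda>s. (?F s - ?F s0) / (s - s0)) \<circ> X) (n + N)) \<longlonglongrightarrow> ?D" by (simp add: Y_def o_def)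
    then show "((\<lambda>s. (?F s - ?F s0) / (s - s0)) \<circ> X) \<longlonglongrightarrow> ?D" by (rule LIMSEQ_offset)
  qed
  then have "(?F has_field_derivative ?D) (at s0)" by (simp add: has_field_derivative_iff)
  then show "?F field_differentiable at s0 within {s. Re s > 0}"
    using field_differentiable_at_within field_differentiable_def by blast
qed

text \<open>The Stieltjes transform \<open>\<integral>\<^sub>0\<^sup>\<infinity> e\<^bsup>-u/2\<^esup> K\<^bsub>ix\<^esub>(u/2) u\<^bsup>s-1\<^esup> / (t+u) du\<close> at the point \<open>t\<close>.\<close>

definition stieltjes_K :: "real \<Rightarrow> real \<Rightarrow> complex \<Rightarrow> complex" where
  "stieltjes_K x t s = (LBINT v. exp (s * of_real v) * of_real (exp (- (1 / 2) * exp v) * macdonald x (exp v / 2) / (t + exp v)))"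

text \<open>Formally \<open>\<integral> h(u) u\<^bsup>s-1\<^esup>/(t+u) du = \<Sum> (-t)\<^sup>j M(s-1-j)\<close>, \<open>M\<close> being the Mellin transform of \<open>h\<close>. These are the terms of that sum for
  \<open>M = mellin_K x\<close>, multiplied by the sine product and divided by \<open>\<pi>\<^sup>2\<surd>\<pi>\<close>, which turns the Gamma functions with their
  poles into entire reciprocal Gamma functions.\<close>

definition residue_term :: "real \<Rightarrow> real \<Rightarrow> nat \<Rightarrow> complex \<Rightarrow> complex" where
  "residue_term x t j s = (- of_real t) ^ j * rGamma (2 + of_nat j - s - \<i> * of_real x)
     * rGamma (2 + of_nat j - s + \<i> * of_real x) * rGamma (s - 1 / 2 - of_nat j)"

definition residue_series :: "real \<Rightarrow> real \<Rightarrow> complex \<Rightarrow> complex" where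
  "residue_series x t s = (\<Sum>j. residue_term x t j s)"

lemma residue_term_plus_1: "residue_term x t (Suc j) (s + 1) = - of_real t * residue_term x t j s"
proof -
  have "2 + of_nat (Suc j) - (s + 1) - c = 2 + of_nat j - s - c" "2 + of_nat (Suc j) - (s + 1) + c = 2 + of_nat j - s + c"
    "s + 1 - 1 / 2 - of_nat (Suc j) = s - 1 / 2 - of_nat j" for c :: complex by simp_all
  then show ?thesis unfolding residue_term_def power_Suc by (simp only: mult_ac)
qed

lemma residue_term_Suc:
  "residue_term x t (Suc j) s * ((2 + of_nat j - s - \<i> * of_real x) * (2 + of_nat j - s + \<i> * of_real x))
    = - of_real t * (s - 3 / 2 - of_nat j) * residue_term x t j s"
proof -
  let ?a = "2 + of_nat j - s - \<i> * of_real x" and ?b = "2 + of_nat j - s + \<i> * of_real x" and ?c = "s - 3 / 2 - of_nat j"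
  have e: "2 + of_nat (Suc j) - s - \<i> * of_real x = ?a + 1" "2 + of_nat (Suc j) - s + \<i> * of_real x = ?b + 1"
    "s - 1 / 2 - of_nat (Suc j) = ?c" by (simp_all add: algebra_simps)
  have f: "s - 1 / 2 - of_nat j = ?c + 1" by (simp add: algebra_simps)
  have "residue_term x t (Suc j) s * (?a * ?b) = (- of_real t) ^ Suc j * (?a * rGamma (?a + 1)) * (?b * rGamma (?b + 1)) * rGamma ?c"
    unfolding residue_term_def e by (simp only: mult_ac)
  also have "\<dots> = (- of_real t) ^ Suc j * rGamma ?a * rGamma ?b * (?c * rGamma (?c + 1))"
    unfolding rGamma_plus1 ..
  also have "\<dots> = - of_real t * ?c * residue_term x t j s"
    unfolding residue_term_def f power_Suc by (simp only: mult_ac)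
  finally show ?thesis .
qed

text \<open>Consecutive terms have the ratio \<open>-t (s-3/2-j) / ((2+j-s-ix)(2+j-s+ix))\<close>. One factor of the denominator
  compensates the numerator up to 2, the other one is at least \<open>4t\<close>. The condition holds for large \<open>j\<close> locally uniformly in \<open>s\<close>, and also for
  all \<open>j\<close> at once if \<open>|Im s|\<close> is large; both cases are used.\<close>

lemma residue_term_halves:
  assumes t: "t > 0" and L: "L \<ge> 4 * t" "L \<ge> 1 / 2 + \<bar>x\<bar>"
    and a: "norm (2 + of_nat j - s - \<i> * of_real x) \<ge> L" and b: "norm (2 + of_nat j - s + \<i> * of_real x) \<ge> L"
  shows "norm (residue_term x t (Suc j) s) \<le> norm (residue_term x t j s) / 2"
proof -
  let ?a = "2 + of_nat j - s - \<i> * of_real x" and ?b = "2 + of_nat j - s + \<i> * of_real x" and ?c = "s - 3 / 2 - of_nat j"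
  have "?c = - ?b + (1 / 2 + \<i> * of_real x)" by (simp add: algebra_simps)
  then have "norm ?c \<le> norm ?b + norm (1 / 2 + \<i> * of_real x)" by (metis norm_minus_cancel norm_triangle_ineq)
  also have "norm (1 / 2 + \<i> * of_real x) \<le> 1 / 2 + \<bar>x\<bar>"
    using norm_triangle_ineq[of "1/2" "\<i> * of_real x"] by (simp add: norm_mult)
  finally have c: "norm ?c \<le> 2 * norm ?b" using b L by simp
  have "norm (residue_term x t (Suc j) s) * (norm ?a * norm ?b) = t * norm ?c * norm (residue_term x t j s)"
    using arg_cong[OF residue_term_Suc[of x t j s], of norm] t by (simp add: norm_mult)
  also have "\<dots> \<le> t * (2 * norm ?b) * norm (residue_term x t j s)"
    using c t by (intro mult_right_mono mult_left_mono) auto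
  finally have "(norm (residue_term x t (Suc j) s) * norm ?a) * norm ?b \<le> (2 * t * norm (residue_term x t j s)) * norm ?b"
    by (simp add: mult_ac)
  moreover have "norm ?b > 0" using b L t by linarith
  ultimately have "norm (residue_term x t (Suc j) s) * norm ?a \<le> 2 * t * norm (residue_term x t j s)"
    by (rule mult_right_le_imp_le)
  moreover have "norm (residue_term x t (Suc j) s) * (4 * t) \<le> norm (residue_term x t (Suc j) s) * norm ?a"
    using a L by (intro mult_left_mono) auto
  ultimately have "norm (residue_term x t (Suc j) s) * (4 * t) \<le> 2 * t * norm (residue_term x t j s)" by linarith
  then have "(2 * norm (residue_term x t (Suc j) s)) * (2 * t) \<le> norm (residue_term x t j s) * (2 * t)" by (simp add: mult_ac)
  then have "2 * norm (residue_term x t (Suc j) s) \<le> norm (residue_term x t j s)"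
    by (rule mult_right_le_imp_le) (use t in simp)
  then show ?thesis by simp
qed

lemma residue_term_geometric:
  assumes t: "t > 0" and L: "L \<ge> 4 * t" "L \<ge> 1 / 2 + \<bar>x\<bar>"
    and ab: "\<And>j. j \<ge> N \<Longrightarrow> norm (2 + of_nat j - s - \<i> * of_real x) \<ge> L" "\<And>j. j \<ge> N \<Longrightarrow> norm (2 + of_nat j - s + \<i> * of_real x) \<ge> L"
  shows "norm (residue_term x t (N + m) s) \<le> norm (residue_term x t N s) * (1 / 2) ^ m"
proof (induction m)
  case (Suc m)
  have "norm (residue_term x t (Suc (N + m)) s) \<le> norm (residue_term x t (N + m) s) / 2"
    by (rule residue_term_halves[OF t L ab]) auto
  then show ?case using Suc by simp
qed simp

lemma holomorphic_residue_term: "residue_term x t j holomorphic_on A"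
  unfolding residue_term_def by (intro holomorphic_intros)

lemma residue_term_bound_cball:
  assumes t: "t > 0"
  obtains M N where "\<And>n (s::complex). n \<ge> N \<Longrightarrow> norm s \<le> R \<Longrightarrow> norm (residue_term x t n s) \<le> M * (1 / 2) ^ n"
proof -
  define L where "L = max (4 * t) (1 / 2 + \<bar>x\<bar>)"
  define N where "N = nat \<lceil>R + \<bar>x\<bar> + L\<rceil>"
  have big: "norm (2 + of_nat j - s + \<i> * of_real y) \<ge> L" if "norm s \<le> R" "j \<ge> N" "\<bar>y\<bar> = \<bar>x\<bar>" for j s y
  proof -
    have "real j \<ge> R + \<bar>x\<bar> + L" using that(2) unfolding N_def by linarith
    moreover have "norm (2 + of_nat j - s + \<i> * of_real y) \<ge> norm (2 + of_nat j :: complex) - norm (s - \<i> * of_real y)"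
      using norm_triangle_ineq2[of "2 + of_nat j" "s - \<i> * of_real y"] by (simp add: algebra_simps)
    moreover have "norm (s - \<i> * of_real y) \<le> R + \<bar>x\<bar>"
      using norm_triangle_ineq4[of s "\<i> * of_real y"] that by (simp add: norm_mult)
    moreover have "norm (2 + of_nat j :: complex) = 2 + real j"
      using norm_of_nat[of "2 + j", where 'a = complex] by simp
    ultimately show ?thesis by linarith
  qed
  have "compact (residue_term x t N ` cball 0 R)"
    by (intro compact_continuous_image holomorphic_on_imp_continuous_on holomorphic_residue_term compact_cball)
  then obtain M where M: "\<And>s. s \<in> cball 0 R \<Longrightarrow> norm (residue_term x t N s) \<le> M"
    using compact_imp_bounded bounded_iff by (metis imageI)
  show ?thesis
  proof (rule that[of N "M * 2 ^ N"])
    fix n and s :: complex assume n: "N \<le> n" and s: "norm s \<le> R"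
    have "norm (residue_term x t (N + (n - N)) s) \<le> norm (residue_term x t N s) * (1 / 2) ^ (n - N)"
    proof (rule residue_term_geometric[OF t])
      show "4 * t \<le> L" "1 / 2 + \<bar>x\<bar> \<le> L" by (auto simp: L_def)
      show "norm (2 + of_nat j - s - \<i> * of_real x) \<ge> L" if "j \<ge> N" for j using big[OF s that, of "- x"] by simp
      show "norm (2 + of_nat j - s + \<i> * of_real x) \<ge> L" if "j \<ge> N" for j using big[OF s that, of x] by simp
    qed
    also have "\<dots> \<le> M * (1 / 2) ^ (n - N)" using M[of s] s by (intro mult_right_mono) auto
    also have "\<dots> = M * 2 ^ N * (1 / 2) ^ n" using n by (simp add: power_diff power_divide)
    finally show "norm (residue_term x t n s) \<le> M * 2 ^ N * (1 / 2) ^ n" using n by simp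
  qed
qed

lemma residue_term_summable:
  assumes t: "t > 0"
  shows "summable (\<lambda>j. norm (residue_term x t j s))"
proof -
  obtain M N where "\<And>n z. n \<ge> N \<Longrightarrow> norm z \<le> norm s \<Longrightarrow> norm (residue_term x t n z) \<le> M * (1 / 2) ^ n"
    by (rule residue_term_bound_cball[OF t, of "norm s" x]) blast
  then have "\<forall>n\<ge>N. norm (norm (residue_term x t n s)) \<le> M * (1 / 2) ^ n" by simp
  moreover have "summable (\<lambda>n. M * (1 / 2) ^ n :: real)" by (intro summable_mult summable_geometric) simp
  ultimately show ?thesis by (intro summable_comparison_test[of "\<lambda>n. norm (residue_term x t n s)"] exI)
qed

lemma holomorphic_residue_series:
  assumes t: "t > 0"
  shows "residue_series x t holomorphic_on UNIV"
proof (rule holomorphic_uniform_sequence[OF open_UNIV, of "\<lambda>n s. \<Sum>j<n. residue_term x t j s"])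
  show "(\<lambda>s. \<Sum>j<n. residue_term x t j s) holomorphic_on UNIV" for n
    by (intro holomorphic_intros holomorphic_residue_term)
  fix s0 :: complex
  obtain M N where MN: "\<And>n z. n \<ge> N \<Longrightarrow> norm z \<le> norm s0 + 1 \<Longrightarrow> norm (residue_term x t n z) \<le> M * (1 / 2) ^ n"
    by (rule residue_term_bound_cball[OF t, of "norm s0 + 1" x]) blast
  have "norm z \<le> norm s0 + 1" if "z \<in> cball s0 1" for z
    using that norm_triangle_ineq2[of z s0] by (simp add: dist_norm norm_minus_commute)
  then have "eventually (\<lambda>n. \<forall>z\<in>cball s0 1. norm (residue_term x t n z) \<le> M * (1 / 2) ^ n) sequentially"
    unfolding eventually_sequentially using MN by blast
  then have "uniform_limit (cball s0 1) (\<lambda>n s. \<Sum>j<n. residue_term x t j s) (residue_series x t) sequentially"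
    unfolding residue_series_def
    by (rule Weierstrass_m_test_ev) (intro summable_mult summable_geometric, simp)
  then show "\<exists>d>0. cball s0 d \<subseteq> UNIV \<and> uniform_limit (cball s0 d) (\<lambda>n s. \<Sum>j<n. residue_term x t j s) (residue_series x t) sequentially"
    by (intro exI[of _ 1]) auto
qed

text \<open>The difference equation that this series shares with \<open>stieltjes_K\<close>.\<close>

lemma residue_series_plus_1:
  assumes t: "t > 0"
  shows "residue_series x t (s + 1) = residue_term x t 0 (s + 1) - of_real t * residue_series x t s"
proof -
  note sm = summable_norm_cancel[OF residue_term_summable[OF t]]
  have "residue_series x t (s + 1) = residue_term x t 0 (s + 1) + (\<Sum>j. residue_term x t (Suc j) (s + 1))"
    unfolding residue_series_def using suminf_split_head[OF sm, of x "s + 1"] by simp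
  also have "(\<Sum>j. residue_term x t (Suc j) (s + 1)) = - of_real t * residue_series x t s"
    unfolding residue_term_plus_1 residue_series_def by (rule suminf_mult[OF sm])
  finally show ?thesis by simp
qed

lemma norm_residue_series_le:
  assumes t: "t > 0" and im: "\<bar>Im s\<bar> \<ge> 4 * t + 1 / 2 + 2 * \<bar>x\<bar>"
  shows "norm (residue_series x t s) \<le> 2 * norm (residue_term x t 0 s)"
proof -
  \<comment> \<open>A lower bound for \<open>|Im s| - |x|\<close>, hence for the distance of \<open>s\<close> from all poles.\<close>
  define L where "L = 4 * t + 1 / 2 + \<bar>x\<bar>"
  have "norm (residue_term x t (0 + m) s) \<le> norm (residue_term x t 0 s) * (1 / 2) ^ m" for m
  proof (rule residue_term_geometric[OF t, of L])
    show "4 * t \<le> L" "1 / 2 + \<bar>x\<bar> \<le> L" using t by (auto simp: L_def)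
    show "norm (2 + of_nat j - s - \<i> * of_real x) \<ge> L" for j
      using abs_Im_le_cmod[of "2 + of_nat j - s - \<i> * of_real x"] im by (simp add: L_def; linarith)
    show "norm (2 + of_nat j - s + \<i> * of_real x) \<ge> L" for j
      using abs_Im_le_cmod[of "2 + of_nat j - s + \<i> * of_real x"] im by (simp add: L_def; linarith)
  qed
  then have le: "norm (residue_term x t m s) \<le> norm (residue_term x t 0 s) * (1 / 2) ^ m" for m by simp
  have "norm (residue_series x t s) \<le> (\<Sum>j. norm (residue_term x t j s))"
    unfolding residue_series_def by (rule summable_norm[OF residue_term_summable[OF t]])
  also have "\<dots> \<le> (\<Sum>j. norm (residue_term x t 0 s) * (1 / 2) ^ j)"
    by (intro suminf_le le residue_term_summable t summable_mult summable_geometric) simp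
  also have "\<dots> = 2 * norm (residue_term x t 0 s)"
    by (subst suminf_mult) (auto simp: suminf_geometric intro: summable_geometric)
  finally show ?thesis .
qed

section \<open>The Stieltjes transform of the Macdonald function\<close>

text \<open>Bounds both \<open>mellin_K x\<close> and, up to the factor \<open>1/t\<close>, \<open>stieltjes_K x t\<close> on the vertical line \<open>Re s = \<sigma>\<close>.\<close>

definition mellin_majorant :: "real \<Rightarrow> real" where
  "mellin_majorant \<sigma> = (LBINT v. exp (\<sigma> * v) * exp (- (1 / 2) * exp v) * macdonald 0 (exp v / 2))"

lemma mellin_majorant_nonneg: "mellin_majorant \<sigma> \<ge> 0"
  unfolding mellin_majorant_def by (intro Bochner_Integration.integral_nonneg) (simp add: macdonald_0_nonneg)

lemma mellin_majorant_le:
  assumes "0 < a" "a \<le> \<sigma>" "\<sigma> \<le> b"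
  shows "mellin_majorant \<sigma> \<le> mellin_majorant a + mellin_majorant b"
proof -
  have i: "integrable lborel (\<lambda>v. exp (\<tau> * v) * exp (- (1 / 2) * exp v) * macdonald 0 (exp v / 2))" if "\<tau> > 0" for \<tau> :: real
    by (rule macdonald_0_mellin_integrable[OF that])
  have le: "exp (\<sigma> * v) \<le> exp (a * v) + exp (b * v)" for v
  proof (cases "v \<ge> 0")
    case True
    then have "exp (\<sigma> * v) \<le> exp (b * v)" using assms by (simp add: mult_right_mono)
    then show ?thesis by (smt (verit) exp_gt_zero)
  next
    case False
    then have "exp (\<sigma> * v) \<le> exp (a * v)" using assms by (simp add: mult_right_mono_neg)
    then show ?thesis by (smt (verit) exp_gt_zero)
  qed
  have "mellin_majorant \<sigma> \<le> (LBINT v. exp (a * v) * exp (- (1 / 2) * exp v) * macdonald 0 (exp v / 2) + exp (b * v) * exp (- (1 / 2) * exp v) * macdonald 0 (exp v / 2))"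
    unfolding mellin_majorant_def
  proof (intro integral_mono Bochner_Integration.integrable_add i)
    fix v
    have "exp (\<sigma> * v) * (exp (- (1 / 2) * exp v) * macdonald 0 (exp v / 2)) \<le> (exp (a * v) + exp (b * v)) * (exp (- (1 / 2) * exp v) * macdonald 0 (exp v / 2))"
      by (intro mult_right_mono le mult_nonneg_nonneg macdonald_0_nonneg) simp
    then show "exp (\<sigma> * v) * exp (- (1 / 2) * exp v) * macdonald 0 (exp v / 2) \<le> exp (a * v) * exp (- (1 / 2) * exp v) * macdonald 0 (exp v / 2) + exp (b * v) * exp (- (1 / 2) * exp v) * macdonald 0 (exp v / 2)"
      by (simp add: algebra_simps)
  qed (use assms in auto)
  also have "\<dots> = mellin_majorant a + mellin_majorant b"
    unfolding mellin_majorant_def by (rule Bochner_Integration.integral_add) (rule i, use assms in linarith)+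
  finally show ?thesis .
qed

lemma norm_mellin_K_le:
  assumes s: "Re s > 0"
  shows "norm (mellin_K x s) \<le> mellin_majorant (Re s)"
proof -
  have "norm (mellin_K x s) \<le> (LBINT v. norm (exp (s * of_real v) * of_real (exp (- (1 / 2) * exp v)) * of_real (macdonald x (exp v / 2))))"
    unfolding macdonald_mellin[OF s, symmetric] by (rule integral_norm_bound)
  also have "\<dots> \<le> mellin_majorant (Re s)"
    unfolding mellin_majorant_def
  proof (intro integral_mono integrable_norm macdonald_mellin_exp(1) macdonald_0_mellin_integrable s)
    show "norm (exp (s * of_real v) * of_real (exp (- (1 / 2) * exp v)) * complex_of_real (macdonald x (exp v / 2)))
      \<le> exp (Re s * v) * exp (- (1 / 2) * exp v) * macdonald 0 (exp v / 2)" for v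
      unfolding norm_mult norm_of_real norm_exp_eq_Re
      by (intro mult_mono abs_macdonald_le) auto
  qed simp
  finally show ?thesis .
qed

context
  fixes x t :: real
  assumes t: "t > 0"
begin

lemma stieltjes_density_le:
  "norm (complex_of_real (exp (- (1 / 2) * exp v) * macdonald x (exp v / 2) / (t + exp v))) \<le> 1 / t * (exp (- (1 / 2) * exp v) * macdonald 0 (exp v / 2))"
proof -
  have "t + exp v \<ge> t" "t + exp v > 0" using t by (auto intro: add_pos_pos)
  have "norm (complex_of_real (exp (- (1 / 2) * exp v) * macdonald x (exp v / 2) / (t + exp v))) = (exp (- (1 / 2) * exp v) * \<bar>macdonald x (exp v / 2)\<bar>) / (t + exp v)"
    unfolding norm_of_real using \<open>t + exp v > 0\<close> by (simp add: abs_mult)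
  also have "\<dots> \<le> (exp (- (1 / 2) * exp v) * macdonald 0 (exp v / 2)) / t"
    using t abs_macdonald_le[of "exp v / 2" x] by (intro frac_le mult_left_mono mult_nonneg_nonneg macdonald_0_nonneg) auto
  finally show ?thesis by simp
qed

lemma stieltjes_majorant_integrable:
  assumes s: "\<sigma> > 0"
  shows "integrable lborel (\<lambda>v. exp (\<sigma> * v) * norm (complex_of_real (exp (- (1 / 2) * exp v) * macdonald x (exp v / 2) / (t + exp v))))"
proof (rule Bochner_Integration.integrable_bound)
  show "integrable lborel (\<lambda>v. 1 / t * (exp (\<sigma> * v) * exp (- (1 / 2) * exp v) * macdonald 0 (exp v / 2)))"
    by (intro integrable_mult_right macdonald_0_mellin_integrable s)
  show "AE v in lborel. norm (exp (\<sigma> * v) * norm (complex_of_real (exp (- (1 / 2) * exp v) * macdonald x (exp v / 2) / (t + exp v))))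
     \<le> norm (1 / t * (exp (\<sigma> * v) * exp (- (1 / 2) * exp v) * macdonald 0 (exp v / 2)))"
  proof (rule AE_I2)
    fix v
    have "exp (\<sigma> * v) * norm (complex_of_real (exp (- (1 / 2) * exp v) * macdonald x (exp v / 2) / (t + exp v)))
      \<le> exp (\<sigma> * v) * (1 / t * (exp (- (1 / 2) * exp v) * macdonald 0 (exp v / 2)))"
      by (intro mult_left_mono stieltjes_density_le) simp
    then show "norm (exp (\<sigma> * v) * norm (complex_of_real (exp (- (1 / 2) * exp v) * macdonald x (exp v / 2) / (t + exp v))))
     \<le> norm (1 / t * (exp (\<sigma> * v) * exp (- (1 / 2) * exp v) * macdonald 0 (exp v / 2)))"
      using t macdonald_0_nonneg[of "exp v / 2"] by (simp add: abs_mult mult_ac)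
  qed
qed (simp add: )

lemma stieltjes_K_integrable:
  assumes s: "Re s > 0"
  shows "integrable lborel (\<lambda>v. exp (s * of_real v) * complex_of_real (exp (- (1 / 2) * exp v) * macdonald x (exp v / 2) / (t + exp v)))"
proof (rule Bochner_Integration.integrable_bound[OF stieltjes_majorant_integrable[OF s]])
  have e: "norm (exp (s * of_real v) * c) = norm (exp (Re s * v) * norm c)" for v and c :: complex
    by (simp add: norm_mult)
  show "AE v in lborel. norm (exp (s * of_real v) * complex_of_real (exp (- (1 / 2) * exp v) * macdonald x (exp v / 2) / (t + exp v)))
    \<le> norm (exp (Re s * v) * norm (complex_of_real (exp (- (1 / 2) * exp v) * macdonald x (exp v / 2) / (t + exp v))))"
    unfolding e by (intro AE_I2 order_refl)
qed measurable

lemma holomorphic_stieltjes_K: "stieltjes_K x t holomorphic_on {s. Re s > 0}"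
  unfolding stieltjes_K_def by (rule holomorphic_laplace_integral[OF _ stieltjes_majorant_integrable]) measurable

lemma norm_stieltjes_K_le:
  assumes s: "Re s > 0"
  shows "norm (stieltjes_K x t s) \<le> 1 / t * mellin_majorant (Re s)"
proof -
  have "norm (stieltjes_K x t s) \<le> (LBINT v. norm (exp (s * of_real v) * complex_of_real (exp (- (1 / 2) * exp v) * macdonald x (exp v / 2) / (t + exp v))))"
    unfolding stieltjes_K_def by (rule integral_norm_bound)
  also have "\<dots> \<le> (LBINT v. 1 / t * (exp (Re s * v) * exp (- (1 / 2) * exp v) * macdonald 0 (exp v / 2)))"
  proof (intro integral_mono integrable_norm stieltjes_K_integrable s integrable_mult_right macdonald_0_mellin_integrable)
    fix v
    have "exp (Re s * v) * norm (complex_of_real (exp (- (1 / 2) * exp v) * macdonald x (exp v / 2) / (t + exp v)))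
      \<le> exp (Re s * v) * (1 / t * (exp (- (1 / 2) * exp v) * macdonald 0 (exp v / 2)))"
      by (intro mult_left_mono stieltjes_density_le) simp
    then show "norm (exp (s * of_real v) * complex_of_real (exp (- (1 / 2) * exp v) * macdonald x (exp v / 2) / (t + exp v)))
       \<le> 1 / t * (exp (Re s * v) * exp (- (1 / 2) * exp v) * macdonald 0 (exp v / 2))"
      unfolding norm_mult norm_exp_eq_Re by (simp add: mult_ac)
  qed
  also have "\<dots> = 1 / t * mellin_majorant (Re s)" unfolding mellin_majorant_def by (rule integral_mult_right_zero)
  finally show ?thesis .
qed

text \<open>Multiplying the integrand by \<open>u + t\<close> cancels the denominator.\<close>

lemma stieltjes_K_plus_1:
  assumes s: "Re s > 0"
  shows "stieltjes_K x t (s + 1) = mellin_K x s - of_real t * stieltjes_K x t s"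
proof -
  let ?\<phi> = "\<lambda>v. complex_of_real (exp (- (1 / 2) * exp v) * macdonald x (exp v / 2) / (t + exp v))"
  have i1: "integrable lborel (\<lambda>v. exp ((s + 1) * of_real v) * ?\<phi> v)" by (rule stieltjes_K_integrable) (use s in simp)
  have i0: "integrable lborel (\<lambda>v. of_real t * (exp (s * of_real v) * ?\<phi> v))"
    by (intro integrable_mult_right stieltjes_K_integrable s)
  have "stieltjes_K x t (s + 1) + of_real t * stieltjes_K x t s = (LBINT v. exp ((s + 1) * of_real v) * ?\<phi> v + of_real t * (exp (s * of_real v) * ?\<phi> v))"
    unfolding stieltjes_K_def integral_mult_right_zero[symmetric]
    by (rule Bochner_Integration.integral_add[symmetric, OF i1 i0])
  also have "\<dots> = (LBINT v. exp (s * of_real v) * of_real (exp (- (1 / 2) * exp v)) * of_real (macdonald x (exp v / 2)))"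
  proof (rule Bochner_Integration.integral_cong[OF refl])
    fix v
    have nz: "t + exp v \<noteq> 0" using t by (smt (verit) exp_gt_zero)
    have "exp ((s + 1) * of_real v) = exp (s * of_real v) * of_real (exp v)"
      by (simp add: distrib_right exp_add exp_of_real)
    moreover have "E * V * c + T * (E * c) = E * ((T + V) * c)" for E V T c :: complex
      by (simp add: algebra_simps)
    ultimately have "exp ((s + 1) * of_real v) * ?\<phi> v + of_real t * (exp (s * of_real v) * ?\<phi> v) = exp (s * of_real v) * (of_real (t + exp v) * ?\<phi> v)"
      by (simp only: of_real_add)
    also have "of_real (t + exp v) * ?\<phi> v = complex_of_real (exp (- (1 / 2) * exp v) * macdonald x (exp v / 2))"
      using nz unfolding of_real_mult[symmetric] by simp
    finally show "exp ((s + 1) * of_real v) * ?\<phi> v + of_real t * (exp (s * of_real v) * ?\<phi> v) = exp (s * of_real v) * of_real (exp (- (1 / 2) * exp v)) * of_real (macdonald x (exp v / 2))"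
      by (simp add: mult_ac)
  qed
  also have "\<dots> = mellin_K x s" by (rule macdonald_mellin[OF s])
  finally show ?thesis by (simp add: algebra_simps)
qed

lemma mellin_K_sin_pair:
  assumes s: "Re s > 0"
  shows "mellin_K x s * sin_pair x s = of_real (pi\<^sup>2 * sqrt pi) * residue_term x t 0 (s + 1)"
proof -
  have G: "Gamma z * sin (of_real pi * z) = of_real pi * rGamma (1 - z)" if "Re z > 0" for z
  proof -
    have "Gamma z \<noteq> 0" using Re_pos_not_nonpos_Int[OF that] by (simp add: Gamma_eq_zero_iff)
    moreover have "rGamma z * rGamma (1 - z) = sin (of_real pi * z) / of_real pi" by (rule rGamma_reflection_complex)
    ultimately show ?thesis by (simp add: rGamma_inverse_Gamma[of z] field_simps)
  qed
  have e: "2 + of_nat 0 - (s + 1) - \<i> * of_real x = 1 - (s + \<i> * of_real x)" "2 + of_nat 0 - (s + 1) + \<i> * of_real x = 1 - (s - \<i> * of_real x)"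
    "s + 1 - 1 / 2 - of_nat 0 = s + 1 / 2" by simp_all
  have "mellin_K x s * sin_pair x s = of_real (sqrt pi) * (Gamma (s + \<i> * of_real x) * sin (of_real pi * (s + \<i> * of_real x)))
    * (Gamma (s - \<i> * of_real x) * sin (of_real pi * (s - \<i> * of_real x))) * rGamma (s + 1 / 2)"
    unfolding mellin_K_def sin_pair_def by (simp only: mult_ac)
  also have "\<dots> = of_real (sqrt pi) * (of_real pi * rGamma (1 - (s + \<i> * of_real x))) * (of_real pi * rGamma (1 - (s - \<i> * of_real x))) * rGamma (s + 1 / 2)"
    by (subst (1 2) G) (use s in auto)
  also have "\<dots> = of_real (pi\<^sup>2 * sqrt pi) * residue_term x t 0 (s + 1)"
    unfolding residue_term_def e by (simp add: power2_eq_square mult_ac)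
  finally show ?thesis .
qed

text \<open>The function \<open>W = S * sin_pair - c * residue_series\<close> satisfies \<open>W(s+1) = -t W(s)\<close>, so \<open>D = t\<^bsup>1-s\<^esup> W\<close> is antiperiodic.
  Subtracting multiples of the two sines leaves an \<open>f\<close> that vanishes at \<open>1 \<plusminus> ix\<close>, and \<open>antiperiodic_vanishes\<close> applies to it. For the
  growth condition, high up in the strip \<open>2 \<le> Re s \<le> 3\<close> the series is dominated by its first term, which is \<open>sin_pair\<close> times
  the bounded function \<open>mellin_K x (s-1)\<close>.\<close>

theorem stieltjes_K_residue_series:
  assumes x: "x \<noteq> 0" and s: "Re s > 0"
  shows "stieltjes_K x t s * sin_pair x s = of_real (pi\<^sup>2 * sqrt pi) * (residue_series x t s
     + exp ((s - 1) * of_real (ln t)) * (\<i> / of_real (sinh (2 * pi * x)) *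
        (exp (\<i> * of_real (x * ln t)) * residue_series x t (1 - \<i> * of_real x) * sin (of_real pi * (s - \<i> * of_real x))
         - exp (- \<i> * of_real (x * ln t)) * residue_series x t (1 + \<i> * of_real x) * sin (of_real pi * (s + \<i> * of_real x)))))"
proof -
  let ?c = "complex_of_real (pi\<^sup>2 * sqrt pi)"
  let ?sh = "complex_of_real (sinh (2 * pi * x))"
  let ?P = "\<lambda>s. sin (of_real pi * (s + \<i> * of_real x))" and ?M = "\<lambda>s. sin (of_real pi * (s - \<i> * of_real x))"
  \<comment> \<open>The multiples of the two sines that interpolate \<open>D\<close> at \<open>1 - ix\<close> and \<open>1 + ix\<close>; at each of these points one sine vanishes.\<close>
  define \<alpha> where "\<alpha> = \<i> / ?sh * ?c * (exp (\<i> * of_real (x * ln t)) * residue_series x t (1 - \<i> * of_real x))"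
  define \<beta> where "\<beta> = - \<i> / ?sh * ?c * (exp (- \<i> * of_real (x * ln t)) * residue_series x t (1 + \<i> * of_real x))"
  define W where "W = (\<lambda>s. stieltjes_K x t s * sin_pair x s - ?c * residue_series x t s)"
  define D where "D = (\<lambda>s. exp ((1 - s) * of_real (ln t)) * W s)"
  define f where "f = (\<lambda>s. D s - \<alpha> * ?M s - \<beta> * ?P s)"
  have elnt: "exp (complex_of_real (ln t)) = of_real t" using t by (simp add: exp_of_real)
  have W1: "W (s + 1) = - of_real t * W s" if "Re s > 0" for s
  proof -
    have "W (s + 1) = (mellin_K x s - of_real t * stieltjes_K x t s) * sin_pair x s - ?c * (residue_term x t 0 (s + 1) - of_real t * residue_series x t s)"
      unfolding W_def sin_pair_plus_1 stieltjes_K_plus_1[OF that] residue_series_plus_1[OF t] ..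
    then show ?thesis unfolding W_def using mellin_K_sin_pair[OF that] by (simp add: algebra_simps)
  qed
  have D1: "D (s + 1) = - D s" if "Re s > 0" for s
  proof -
    have "exp ((1 - s) * of_real (ln t)) = exp (of_real (ln t)) * exp ((1 - (s + 1)) * complex_of_real (ln t))"
      unfolding exp_add[symmetric] by (simp add: algebra_simps)
    then show ?thesis unfolding D_def W1[OF that] elnt by simp
  qed
  have sh: "?sh \<noteq> 0" using x by simp
  have snh: "sin (of_real pi * (1 - 2 * (\<i> * of_real x))) = \<i> * ?sh" "sin (of_real pi * (1 + 2 * (\<i> * of_real x))) = - \<i> * ?sh"
  proof -
    have a: "sin (\<i> * complex_of_real (2 * pi * x)) = \<i> * ?sh"
      by (simp add: sin_i_times sinh_def scaleR_conv_of_real exp_minus flip: exp_of_real)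
    have "of_real pi * (1 - 2 * (\<i> * of_real x)) = of_real pi - \<i> * complex_of_real (2 * pi * x)"
      "of_real pi * (1 + 2 * (\<i> * of_real x)) = of_real pi + \<i> * complex_of_real (2 * pi * x)"
      by (simp_all add: algebra_simps)
    then show "sin (of_real pi * (1 - 2 * (\<i> * of_real x))) = \<i> * ?sh" "sin (of_real pi * (1 + 2 * (\<i> * of_real x))) = - \<i> * ?sh"
      by (simp_all only: sin_diff sin_add a) (simp_all add: a)
  qed
  have rot: "(u / h * c * X) * (u * h) = - (c * X)" if "h \<noteq> 0" "u * u = - 1" for u h c X :: complex
  proof -
    have "(u / h * c * X) * (u * h) = (u * u) * (c * X)" using that(1) by simp
    then show ?thesis unfolding that(2) by simp
  qed
  have "f s = 0"
  proof (rule antiperiodic_vanishes[OF x _ _ _ _ _ s])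
    show "f holomorphic_on {s. Re s > 0}"
      unfolding f_def D_def W_def sin_pair_def
      by (intro holomorphic_intros holomorphic_stieltjes_K holomorphic_on_subset[OF holomorphic_residue_series[OF t]]) auto
    show "f (s + 1) = - f s" if "Re s > 0" for s
    proof -
      have "?P (s + 1) = - ?P s" "?M (s + 1) = - ?M s"
        using sin_pi_plus_1[of "s + \<i> * of_real x"] sin_pi_plus_1[of "s - \<i> * of_real x"] by (simp_all add: algebra_simps)
      then show ?thesis unfolding f_def D1[OF that] by simp
    qed
    have spi: "sin (complex_of_real pi) = 0" by (simp flip: sin_of_real)
    show "f (1 + \<i> * of_real x) = 0"
    proof -
      have m: "?M (1 + \<i> * of_real x) = 0" using spi by simp
      have p: "?P (1 + \<i> * of_real x) = - \<i> * ?sh" using snh(2) by (simp add: algebra_simps)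
      have "sin_pair x (1 + \<i> * of_real x) = 0" unfolding sin_pair_def m by simp
      then have "D (1 + \<i> * of_real x) = - (?c * (exp (- \<i> * of_real (x * ln t)) * residue_series x t (1 + \<i> * of_real x)))"
        unfolding D_def W_def by (simp add: mult_ac)
      moreover have "\<beta> * (- \<i> * ?sh) = - (?c * (exp (- \<i> * of_real (x * ln t)) * residue_series x t (1 + \<i> * of_real x)))"
        unfolding \<beta>_def by (rule rot[OF sh]) simp
      ultimately show ?thesis unfolding f_def m p by simp
    qed
    show "f (1 - \<i> * of_real x) = 0"
    proof -
      have m: "?P (1 - \<i> * of_real x) = 0" using spi by simp
      have p: "?M (1 - \<i> * of_real x) = \<i> * ?sh" using snh(1) by (simp add: algebra_simps)
      have "sin_pair x (1 - \<i> * of_real x) = 0" unfolding sin_pair_def m by simp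
      then have "D (1 - \<i> * of_real x) = - (?c * (exp (\<i> * of_real (x * ln t)) * residue_series x t (1 - \<i> * of_real x)))"
        unfolding D_def W_def by (simp add: mult_ac)
      moreover have "\<alpha> * (\<i> * ?sh) = - (?c * (exp (\<i> * of_real (x * ln t)) * residue_series x t (1 - \<i> * of_real x)))"
        unfolding \<alpha>_def by (rule rot[OF sh]) simp
      ultimately show ?thesis unfolding f_def m p by simp
    qed
    \<comment> \<open>In the strip \<open>2 \<le> Re s \<le> 3\<close> the exponent of \<open>t\<^bsup>1-s\<^esup>\<close> has real part between \<open>-2\<close> and \<open>-1\<close>, and both \<open>t < 1\<close> and \<open>t > 1\<close> occur.\<close>
    define T where "T = exp (- 1 * ln t) + exp (- 2 * ln t)"
    define B where "B = 1 / t * (mellin_majorant 2 + mellin_majorant 3) + 2 * (mellin_majorant 1 + mellin_majorant 2)"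
    show "norm (f s) \<le> (T * B + norm \<alpha> + norm \<beta>) * norm (sin_pair x s)"
      if s: "2 \<le> Re s" "Re s \<le> 3" and Y: "\<bar>Im s\<bar> \<ge> 4 * t + 1 / 2 + 2 * \<bar>x\<bar> + 1" for s
    proof -
      have 1: "norm (stieltjes_K x t s) \<le> 1 / t * (mellin_majorant 2 + mellin_majorant 3)"
      proof -
        have "norm (stieltjes_K x t s) \<le> 1 / t * mellin_majorant (Re s)" by (rule norm_stieltjes_K_le) (use s in linarith)
        also have "\<dots> \<le> 1 / t * (mellin_majorant 2 + mellin_majorant 3)"
          by (intro mult_left_mono mellin_majorant_le) (use s t in auto)
        finally show ?thesis .
      qed
      have "norm (residue_series x t s) \<le> 2 * norm (residue_term x t 0 s)"
        by (rule norm_residue_series_le[OF t]) (use Y in linarith)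
      then have "norm (?c * residue_series x t s) \<le> 2 * norm (?c * residue_term x t 0 s)"
        unfolding norm_mult by (simp add: mult_left_mono mult.left_commute)
      also have "?c * residue_term x t 0 s = mellin_K x (s - 1) * sin_pair x (s - 1)"
        using mellin_K_sin_pair[of "s - 1"] s by simp
      also have "sin_pair x (s - 1) = sin_pair x s" using sin_pair_plus_1[of x "s - 1"] by simp
      also have "norm (mellin_K x (s - 1) * sin_pair x s) \<le> (mellin_majorant 1 + mellin_majorant 2) * norm (sin_pair x s)"
        unfolding norm_mult using norm_mellin_K_le[of "s - 1" x] mellin_majorant_le[of 1 "Re (s - 1)" 2] s
        by (intro mult_right_mono) auto
      finally have 2: "norm (?c * residue_series x t s) \<le> 2 * (mellin_majorant 1 + mellin_majorant 2) * norm (sin_pair x s)" by (simp only: mult.assoc)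
      have "norm (W s) \<le> norm (stieltjes_K x t s) * norm (sin_pair x s) + norm (?c * residue_series x t s)"
        unfolding W_def norm_mult[symmetric] by (rule norm_triangle_ineq4)
      also have "\<dots> \<le> (1 / t * (mellin_majorant 2 + mellin_majorant 3)) * norm (sin_pair x s) + 2 * (mellin_majorant 1 + mellin_majorant 2) * norm (sin_pair x s)"
        by (intro add_mono mult_right_mono 1 2) auto
      finally have W: "norm (W s) \<le> B * norm (sin_pair x s)" by (simp add: B_def algebra_simps)
      have B0: "B \<ge> 0" using t mellin_majorant_nonneg by (auto simp: B_def intro!: add_nonneg_nonneg mult_nonneg_nonneg)
      have re_exponent: "Re ((1 - s) * of_real (ln t)) = (1 - Re s) * ln t" by simp
      have T: "norm (exp ((1 - s) * of_real (ln t))) \<le> T"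
      proof (cases "ln t \<ge> 0")
        case True
        then have "(1 - Re s) * ln t \<le> - 1 * ln t" using s by (intro mult_right_mono) auto
        then have "exp ((1 - Re s) * ln t) \<le> exp (- 1 * ln t)" by (simp only: exp_le_cancel_iff)
        moreover have "exp (- 2 * ln t) > 0" by (rule exp_gt_zero)
        ultimately show ?thesis unfolding T_def norm_exp_eq_Re re_exponent by linarith
      next
        case False
        then have "(1 - Re s) * ln t \<le> - 2 * ln t" using s by (intro mult_right_mono_neg) auto
        then have "exp ((1 - Re s) * ln t) \<le> exp (- 2 * ln t)" by (simp only: exp_le_cancel_iff)
        moreover have "exp (- 1 * ln t) > 0" by (rule exp_gt_zero)
        ultimately show ?thesis unfolding T_def norm_exp_eq_Re re_exponent by linarith
      qed
      have D: "norm (D s) \<le> T * B * norm (sin_pair x s)"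
        unfolding D_def norm_mult mult.assoc using B0 by (intro mult_mono T W) (auto simp: T_def)
      have big: "norm (sin (of_real pi * (s + \<i> * of_real y))) \<ge> 1" if "\<bar>y\<bar> = \<bar>x\<bar>" for y
      proof -
        have "\<bar>Im s + y\<bar> \<ge> 1" using Y that t by linarith
        then have "pi * \<bar>Im s + y\<bar> \<ge> 1 * 1" using pi_gt3 by (intro mult_mono) auto
        then have "\<bar>Im (of_real pi * (s + \<i> * of_real y))\<bar> \<ge> 1" by (simp add: abs_mult)
        then show ?thesis using norm_sin_ge order_trans by blast
      qed
      have PM: "norm (?P s) \<ge> 1" "norm (?M s) \<ge> 1" using big[of x] big[of "- x"] by simp_all
      have "norm (?M s) \<le> norm (sin_pair x s)" "norm (?P s) \<le> norm (sin_pair x s)"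
        unfolding sin_pair_def norm_mult using mult_right_mono[OF PM(1), of "norm (?M s)"] mult_left_mono[OF PM(2), of "norm (?P s)"] by auto
      then have ab: "norm (\<alpha> * ?M s) \<le> norm \<alpha> * norm (sin_pair x s)" "norm (\<beta> * ?P s) \<le> norm \<beta> * norm (sin_pair x s)"
        unfolding norm_mult by (auto intro: mult_left_mono)
      have "norm (f s) \<le> norm (D s) + norm (\<alpha> * ?M s) + norm (\<beta> * ?P s)"
        unfolding f_def using norm_triangle_ineq4[of "D s - \<alpha> * ?M s" "\<beta> * ?P s"] norm_triangle_ineq4[of "D s" "\<alpha> * ?M s"] by linarith
      also have "\<dots> \<le> T * B * norm (sin_pair x s) + norm \<alpha> * norm (sin_pair x s) + norm \<beta> * norm (sin_pair x s)"
        using D ab by linarith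
      finally show ?thesis by (simp add: algebra_simps)
    qed
  qed
  then have "exp ((1 - s) * of_real (ln t)) * W s = \<alpha> * ?M s + \<beta> * ?P s" by (simp add: f_def D_def algebra_simps)
  then have "exp ((s - 1) * of_real (ln t)) * (exp ((1 - s) * of_real (ln t)) * W s) = exp ((s - 1) * of_real (ln t)) * (\<alpha> * ?M s + \<beta> * ?P s)" by simp
  moreover have "exp ((s - 1) * complex_of_real (ln t)) * (exp ((1 - s) * of_real (ln t)) * W s) = W s"
    unfolding mult.assoc[symmetric] exp_add[symmetric] by (simp add: algebra_simps)
  ultimately have "W s = exp ((s - 1) * of_real (ln t)) * (\<alpha> * ?M s + \<beta> * ?P s)" by simp
  moreover have "\<alpha> * ?M s + \<beta> * ?P s = ?c * (\<i> / ?sh * (exp (\<i> * of_real (x * ln t)) * residue_series x t (1 - \<i> * of_real x) * ?M s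
         - exp (- \<i> * of_real (x * ln t)) * residue_series x t (1 + \<i> * of_real x) * ?P s))"
    unfolding \<alpha>_def \<beta>_def by (simp add: right_diff_distrib mult_ac)
  ultimately have "stieltjes_K x t s * sin_pair x s = ?c * residue_series x t s + exp ((s - 1) * of_real (ln t)) * (?c * (\<i> / ?sh * (exp (\<i> * of_real (x * ln t)) * residue_series x t (1 - \<i> * of_real x) * ?M s
         - exp (- \<i> * of_real (x * ln t)) * residue_series x t (1 + \<i> * of_real x) * ?P s)))"
    unfolding W_def by (simp add: diff_eq_eq add.commute)
  then show ?thesis by (simp only: distrib_left mult.left_commute)
qed

end

section \<open>Kummer's second formula\<close>

text \<open>The coefficients, up to a common factor, of \<open>\<^sub>1F\<^sub>1(\<nu>+1/2; 2\<nu>+1; t)\<close>. They are the ones of the series \<open>residue_series\<close> at \<open>1 - \<nu>\<close>,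
  for \<open>\<nu> = ix\<close>.\<close>

definition kummer_coeff :: "complex \<Rightarrow> nat \<Rightarrow> complex" where
  "kummer_coeff \<nu> j = (- 1) ^ j * rGamma (1 + of_nat j) * rGamma (1 + of_nat j + 2 * \<nu>) * rGamma (1 / 2 - \<nu> - of_nat j)"

text \<open>The coefficients of \<open>(t/4)\<^bsup>-\<nu>\<^esup> I\<^sub>\<nu>(t/2)\<close> as a power series in \<open>t\<close>.\<close>

definition bessel_coeff :: "complex \<Rightarrow> nat \<Rightarrow> complex" where
  "bessel_coeff \<nu> n = (if even n then (1 / 16) ^ (n div 2) * rGamma (of_nat (n div 2) + \<nu> + 1) / fact (n div 2) else 0)"

lemma kummer_coeff_Suc:
  "of_nat (Suc n) * (of_nat (Suc n) + 2 * \<nu>) * kummer_coeff \<nu> (Suc n) = (of_nat n + 1 / 2 + \<nu>) * kummer_coeff \<nu> n"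
proof -
  define a b c where "a = 1 + complex_of_nat n" and "b = 1 + complex_of_nat n + 2 * \<nu>" and "c = - (1 / 2) - \<nu> - of_nat n"
  have eS: "1 + of_nat (Suc n) = a + 1" "a + 1 + 2 * \<nu> = b + 1" "1 / 2 - \<nu> - of_nat (Suc n) = c"
    by (simp_all add: a_def b_def c_def)
  have e0: "1 + of_nat n = a" "a + 2 * \<nu> = b" "1 / 2 - \<nu> - of_nat n = c + 1"
    by (simp_all add: a_def b_def c_def)
  have kS: "kummer_coeff \<nu> (Suc n) = (- 1) ^ Suc n * rGamma (a + 1) * rGamma (b + 1) * rGamma c"
    unfolding kummer_coeff_def eS ..
  have k0: "kummer_coeff \<nu> n = (- 1) ^ n * rGamma a * rGamma b * rGamma (c + 1)"
    unfolding kummer_coeff_def e0 ..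
  have "a * b * kummer_coeff \<nu> (Suc n) = - ((- 1) ^ n * (a * rGamma (a + 1)) * (b * rGamma (b + 1)) * rGamma c)"
    unfolding kS by simp
  also have "\<dots> = - ((- 1) ^ n * rGamma a * rGamma b * (c * rGamma (c + 1)))"
    unfolding rGamma_plus1 ..
  also have "\<dots> = - c * kummer_coeff \<nu> n"
    unfolding k0 by simp
  finally have main: "a * b * kummer_coeff \<nu> (Suc n) = - c * kummer_coeff \<nu> n" .
  have "of_nat (Suc n) = a" "of_nat (Suc n) + 2 * \<nu> = b" "of_nat n + 1 / 2 + \<nu> = - c"
    by (simp_all add: a_def b_def c_def)
  with main show ?thesis by (simp only:)
qed

lemma bessel_coeff_Suc_Suc:
  "(of_nat n + 2) * (of_nat n + 2 + 2 * \<nu>) * bessel_coeff \<nu> (Suc (Suc n)) = bessel_coeff \<nu> n / 4"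
proof (cases "even n")
  case False then show ?thesis by (simp add: bessel_coeff_def)
next
  case True
  then obtain k where n: "n = 2 * k" by (rule evenE)
  define z where "z = of_nat k + \<nu> + 1"
  have b: "bessel_coeff \<nu> n = (1 / 16) ^ k * (z * rGamma (z + 1)) / fact k"
    unfolding rGamma_plus1 by (simp add: bessel_coeff_def n z_def)
  have k: "Suc (Suc n) div 2 = Suc k" "even (Suc (Suc n))" using n by auto
  have z1: "of_nat (Suc k) + \<nu> + 1 = z + 1" by (simp add: z_def)
  have b2: "bessel_coeff \<nu> (Suc (Suc n)) = (1 / 16) ^ Suc k * rGamma (z + 1) / fact (Suc k)"
    unfolding bessel_coeff_def k(1) z1 using k(2) by simp
  have f: "of_nat n + 2 = 2 * (of_nat (Suc k) :: complex)" "of_nat n + 2 + 2 * \<nu> = 2 * z" using n by (simp_all add: z_def)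
  have nz: "of_nat (Suc k) \<noteq> (0 :: complex)" by (metis nat.distinct(1) of_nat_eq_0_iff)
  have opaque: "2 * N * (2 * z) * (q * r / (N * F)) = (16 * q) * (z * r) / F / 4" if "N \<noteq> 0" for N z q r F :: complex
    using that by simp
  have fp: "(of_nat n + 2) * (of_nat n + 2 + 2 * \<nu>) = 2 * of_nat (Suc k) * (2 * z)"
    by (simp only: f(2)) (simp only: f(1))
  have q: "16 * (1 / 16 :: complex) ^ Suc k = (1 / 16) ^ k" by simp
  show ?thesis unfolding fp b b2 fact_Suc opaque[OF nz] q ..
qed

lemma kummer_ode_algebra:
  fixes X E B :: "'a :: comm_ring"
  assumes B: "X * B2 + a * B1 = q * (X * B)" and half: "a * (h * B) = c * B" and q: "q + q = h"
  shows "X * (E * (q * B + B1 + B2)) + a * (E * (h * B + B1)) = X * (E * (h * B + B1)) + c * (E * B)"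
proof -
  have "X * (E * (q * B + B1 + B2)) + a * (E * (h * B + B1)) = E * (q * (X * B) + X * B1 + (X * B2 + a * B1) + a * (h * B))"
    by (simp add: algebra_simps)
  also have "\<dots> = E * (q * (X * B) + X * B1 + q * (X * B) + c * B)" by (simp only: B half)
  also have "\<dots> = E * ((q + q) * (X * B) + X * B1 + c * B)" by (simp add: algebra_simps)
  also have "\<dots> = X * (E * (h * B + B1)) + c * (E * B)" unfolding q by (simp add: algebra_simps)
  finally show ?thesis .
qed

text \<open>Kummer's second formula \<open>\<^sub>1F\<^sub>1(\<nu>+1/2; 2\<nu>+1; t) = \<Gamma>(\<nu>+1) (t/4)\<^bsup>-\<nu>\<^esup> e\<^bsup>t/2\<^esup> I\<^sub>\<nu>(t/2)\<close> for coefficients. The formal power series \<open>Y\<close> on the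
  right satisfies Kummer's differential equation since \<open>B\<close> satisfies Bessel's; so both sides obey the same two-term recursion, and the
  initial values agree by the duplication and reflection formulas.\<close>

lemma kummer_bessel_coeff:
  assumes nu: "Re \<nu> \<ge> 0"
  shows "of_real (sqrt pi) * exp (\<nu> * of_real (ln 4)) * kummer_coeff \<nu> n
    = cos (of_real pi * \<nu>) * fps_nth (fps_exp (1 / 2) * Abs_fps (bessel_coeff \<nu>)) n"
proof -
  define B where "B = Abs_fps (bessel_coeff \<nu>)"
  define E where "E = fps_exp (1 / 2 :: complex)"
  have B: "fps_X * fps_deriv (fps_deriv B) + fps_const (2 * \<nu> + 1) * fps_deriv B = fps_const (1 / 4) * (fps_X * B)"
  proof (rule fps_ext)
    fix n
    show "fps_nth (fps_X * fps_deriv (fps_deriv B) + fps_const (2 * \<nu> + 1) * fps_deriv B) n = fps_nth (fps_const (1 / 4) * (fps_X * B)) n"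
    proof (cases n)
      case 0 then show ?thesis by (simp add: B_def bessel_coeff_def)
    next
      case (Suc m)
      then show ?thesis using bessel_coeff_Suc_Suc[of m \<nu>] by (simp add: B_def algebra_simps)
    qed
  qed
  have E: "fps_deriv E = fps_const (1 / 2) * E" by (simp add: E_def)
  define Y where "Y = E * B"
  have Y1: "fps_deriv Y = E * (fps_const (1 / 2) * B + fps_deriv B)"
    unfolding Y_def by (simp add: E algebra_simps)
  have Y2: "fps_deriv (fps_deriv Y) = E * (fps_const (1 / 4) * B + fps_deriv B + fps_deriv (fps_deriv B))"
  proof -
    have c: "fps_const (1 / 2) * (fps_const (1 / 2) * F) = fps_const (1 / 4 :: complex) * F" for F
      by (simp add: mult.assoc[symmetric])
    have h: "fps_const (1 / 2 :: complex) * F + fps_const (1 / 2) * F = F" for F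
      by (simp add: distrib_right[symmetric] fps_const_add del: fps_const_add)
    have "fps_deriv (fps_deriv Y) = E * (fps_const (1 / 2) * (fps_const (1 / 2) * B) + (fps_const (1 / 2) * fps_deriv B + fps_const (1 / 2) * fps_deriv B) + fps_deriv (fps_deriv B))"
      unfolding Y1 by (simp add: E algebra_simps)
    then show ?thesis unfolding c h .
  qed
  have ode: "fps_X * fps_deriv (fps_deriv Y) + fps_const (2 * \<nu> + 1) * fps_deriv Y = fps_X * fps_deriv Y + fps_const (\<nu> + 1 / 2) * Y"
  proof -
    have half: "fps_const (2 * \<nu> + 1) * (fps_const (1 / 2) * B) = fps_const (\<nu> + 1 / 2) * B"
    proof -
      have "(2 * \<nu> + 1) * (1 / 2) = \<nu> + 1 / 2" by (simp add: field_simps)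
      then show ?thesis by (simp only: mult.assoc[symmetric] fps_const_mult)
    qed
    have q: "fps_const (1 / 4) + fps_const (1 / 4) = fps_const (1 / 2 :: complex)" by simp
    show ?thesis unfolding Y2 unfolding Y1 unfolding Y_def by (rule kummer_ode_algebra[OF B half q])
  qed
  have Yrec: "of_nat (Suc n) * (of_nat (Suc n) + 2 * \<nu>) * fps_nth Y (Suc n) = (of_nat n + 1 / 2 + \<nu>) * fps_nth Y n" for n
  proof -
    have x: "fps_nth (fps_X * fps_deriv F) n = of_nat n * fps_nth F n" for F :: "complex fps"
      by (cases n) auto
    have d: "fps_nth (fps_deriv Y) n = of_nat (Suc n) * fps_nth Y (Suc n)" by (simp del: of_nat_Suc)
    have "of_nat n * fps_nth (fps_deriv Y) n + (2 * \<nu> + 1) * fps_nth (fps_deriv Y) n = of_nat n * fps_nth Y n + (\<nu> + 1 / 2) * fps_nth Y n"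
      using arg_cong[OF ode, of "\<lambda>F. fps_nth F n"] unfolding fps_add_nth x fps_mult_left_const_nth .
    then show ?thesis unfolding d by (simp add: algebra_simps)
  qed
  have base: "of_real (sqrt pi) * exp (\<nu> * of_real (ln 4)) * kummer_coeff \<nu> 0 = cos (of_real pi * \<nu>) * fps_nth Y 0"
  proof -
    have n: "1 / 2 + \<nu> \<notin> \<int>\<^sub>\<le>\<^sub>0" "1 / 2 + \<nu> + 1 / 2 \<notin> \<int>\<^sub>\<le>\<^sub>0" "1 + 2 * \<nu> \<notin> \<int>\<^sub>\<le>\<^sub>0"
      using nu by (auto intro!: Re_pos_not_nonpos_Int)
    define g h k where "g = Gamma (1 / 2 + \<nu>)" and "h = Gamma (1 + \<nu>)" and "k = Gamma (1 + 2 * \<nu>)"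
    have nz: "g \<noteq> 0" "h \<noteq> 0" "k \<noteq> 0" using n by (simp_all add: g_def h_def k_def Gamma_eq_zero_iff add_ac)
    have "Gamma (1 / 2 + \<nu>) * Gamma (1 / 2 + \<nu> + 1 / 2) = exp ((1 - 2 * (1 / 2 + \<nu>)) * of_real (ln 2)) * of_real (sqrt pi) * Gamma (2 * (1 / 2 + \<nu>))"
      by (rule Gamma_legendre_duplication) (use n in auto)
    moreover have "1 / 2 + \<nu> + 1 / 2 = 1 + \<nu>" "2 * (1 / 2 + \<nu>) = 1 + 2 * \<nu>" "1 - (1 + 2 * \<nu>) = - 2 * \<nu>" by simp_all
    ultimately have dup: "g * h = exp (- 2 * \<nu> * of_real (ln 2)) * of_real (sqrt pi) * k"
      unfolding g_def h_def k_def by (simp only:)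
    have l4: "ln 4 = 2 * ln (2::real)" using ln_realpow[of 2 2] by simp
    have ee: "exp (\<nu> * of_real (ln 4)) * exp (- 2 * \<nu> * complex_of_real (ln 2)) = 1"
      unfolding l4 exp_add[symmetric] by simp
    have sq: "complex_of_real (sqrt pi) * of_real (sqrt pi) = of_real pi" unfolding of_real_mult[symmetric] by simp
    have r1: "rGamma (1 / 2 + \<nu>) * rGamma (1 - (1 / 2 + \<nu>)) = sin (of_real pi * (1 / 2 + \<nu>)) / of_real pi"
      by (rule rGamma_reflection_complex)
    have r2: "sin (of_real pi * (1 / 2 + \<nu>)) = cos (of_real pi * \<nu>)"
    proof -
      have "of_real pi * (1 / 2 + \<nu>) = of_real (pi / 2) + of_real pi * \<nu>" by (simp add: algebra_simps)
      then show ?thesis by (simp only: sin_add sin_of_real cos_of_real sin_pi_half cos_pi_half) simp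
    qed
    have r3: "1 - (1 / 2 + \<nu>) = 1 / 2 - \<nu>" by simp
    have refl: "rGamma (1 / 2 - \<nu>) * of_real pi = g * cos (of_real pi * \<nu>)"
    proof -
      have "r * p = u * v" if "inverse u * r = v / p" "u \<noteq> 0" "p \<noteq> 0" for r p u v :: complex
        using that by (simp add: field_simps)
      moreover have "inverse g * rGamma (1 / 2 - \<nu>) = cos (of_real pi * \<nu>) / of_real pi"
        using r1 unfolding r2 r3 by (simp only: g_def rGamma_inverse_Gamma[of "1 / 2 + \<nu>", symmetric])
      ultimately show ?thesis using nz(1) by simp
    qed
    have rk: "rGamma (1 + 2 * \<nu>) = exp (- 2 * \<nu> * of_real (ln 2)) * of_real (sqrt pi) / (g * h)"
    proof -
      have "inverse w = e * r / (u * v)" if "u * v = e * r * w" "u \<noteq> 0" "v \<noteq> 0" "w \<noteq> 0" for u v w e r :: complex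
      proof -
        from that have "e \<noteq> 0" "r \<noteq> 0" by auto
        then show ?thesis using that by (simp add: field_simps)
      qed
      from this[OF dup nz] show ?thesis by (simp only: k_def rGamma_inverse_Gamma)
    qed
    have "of_real (sqrt pi) * exp (\<nu> * of_real (ln 4)) * kummer_coeff \<nu> 0
      = (exp (\<nu> * of_real (ln 4)) * exp (- 2 * \<nu> * complex_of_real (ln 2))) * (complex_of_real (sqrt pi) * of_real (sqrt pi)) * rGamma (1 / 2 - \<nu>) / (g * h)"
      unfolding kummer_coeff_def by (simp add: rk)
    also have "\<dots> = (rGamma (1 / 2 - \<nu>) * of_real pi) / (g * h)" unfolding ee sq by simp
    also have "\<dots> = cos (of_real pi * \<nu>) / h" unfolding refl using nz by simp
    also have "\<dots> = cos (of_real pi * \<nu>) * fps_nth Y 0"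
    proof -
      have "fps_nth Y 0 = inverse h"
        by (simp add: Y_def E_def B_def bessel_coeff_def h_def rGamma_inverse_Gamma add.commute)
      then show ?thesis by (simp only: divide_inverse)
    qed
    finally show ?thesis .
  qed
  have "of_real (sqrt pi) * exp (\<nu> * of_real (ln 4)) * kummer_coeff \<nu> n = cos (of_real pi * \<nu>) * fps_nth Y n"
  proof (induction n)
    case 0 show ?case by (rule base)
  next
    case (Suc n)
    have nz: "of_nat (Suc n) * (of_nat (Suc n) + 2 * \<nu>) \<noteq> 0"
      using nu by (auto simp: complex_eq_iff)
    have "of_nat (Suc n) * (of_nat (Suc n) + 2 * \<nu>) * (of_real (sqrt pi) * exp (\<nu> * of_real (ln 4)) * kummer_coeff \<nu> (Suc n))
      = of_real (sqrt pi) * exp (\<nu> * of_real (ln 4)) * (of_nat (Suc n) * (of_nat (Suc n) + 2 * \<nu>) * kummer_coeff \<nu> (Suc n))"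
      by (simp only: mult_ac)
    also have "\<dots> = (of_nat n + 1 / 2 + \<nu>) * (of_real (sqrt pi) * exp (\<nu> * of_real (ln 4)) * kummer_coeff \<nu> n)"
      unfolding kummer_coeff_Suc by (simp only: mult_ac)
    also have "\<dots> = cos (of_real pi * \<nu>) * ((of_nat n + 1 / 2 + \<nu>) * fps_nth Y n)"
      unfolding Suc by (simp only: mult_ac)
    also have "\<dots> = of_nat (Suc n) * (of_nat (Suc n) + 2 * \<nu>) * (cos (of_real pi * \<nu>) * fps_nth Y (Suc n))"
      unfolding Yrec[symmetric] by (simp only: mult_ac)
    finally show ?case using nz by (metis mult_left_cancel)
  qed
  then show ?thesis by (simp only: Y_def E_def B_def)
qed

lemma bessel_coeff_sums:
  assumes t: "t > 0"
  shows "summable (\<lambda>n. norm (bessel_coeff (\<i> * of_real x) n * of_real t ^ n))"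
    and "exp (\<i> * of_real (x * (ln t - ln 4))) * (\<Sum>n. bessel_coeff (\<i> * of_real x) n * of_real t ^ n) = bessel_exp x (ln t)"
proof -
  let ?f = "\<lambda>n. bessel_coeff (\<i> * of_real x) n * of_real t ^ n"
  let ?p = "exp (\<i> * of_real (x * (ln t - ln 4)))"
  have trm: "bessel_term x k (ln t) = ?p * ?f (2 * k)" for k
  proof -
    have "exp ((2 * of_nat k + \<i> * of_real x) * of_real (ln t - ln 4)) = ?p * exp (of_nat (2 * k) * of_real (ln t - ln 4))"
      unfolding exp_add[symmetric] by (simp add: algebra_simps)
    also have "exp (of_nat (2 * k) * complex_of_real (ln t - ln 4)) = of_real (t / 4) ^ (2 * k)"
      unfolding exp_of_nat_mult exp_of_real using t by (simp add: exp_diff)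
    also have "complex_of_real (t / 4) ^ (2 * k) = (1 / 16) ^ k * of_real t ^ (2 * k)"
      by (simp add: power_mult power_divide)
    finally show ?thesis unfolding bessel_term_def by (simp add: bessel_coeff_def mult_ac)
  qed
  have p1: "norm ?p = 1" "?p \<noteq> 0" by simp_all
  have mono: "strict_mono (\<lambda>k::nat. 2 * k)" by (auto simp: strict_mono_def)
  have rng: "n \<notin> range (\<lambda>k. 2 * k) \<Longrightarrow> ?f n = 0" for n by (auto simp: bessel_coeff_def elim!: evenE)
  have s2: "summable (\<lambda>k. norm (?f (2 * k)))"
    using bessel_term_summable_norm[of x "ln t"] unfolding trm norm_mult p1 by simp
  show "summable (\<lambda>n. norm (?f n))"
    using s2 summable_mono_reindex[OF mono, of "\<lambda>n. norm (?f n)"] rng by simp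
  have "(\<Sum>k. ?f (2 * k)) = (\<Sum>n. ?f n)"
    by (rule suminf_mono_reindex[OF mono rng])
  moreover have "bessel_exp x (ln t) = ?p * (\<Sum>k. ?f (2 * k))"
    unfolding bessel_exp_suminf trm
    by (rule suminf_mult[OF summable_norm_cancel[OF s2]])
  ultimately show "?p * (\<Sum>n. ?f n) = bessel_exp x (ln t)" by simp
qed

lemma residue_series_bessel:
  assumes t: "t > 0"
  shows "of_real (sqrt pi) * (exp (\<i> * of_real (x * ln t)) * residue_series x t (1 - \<i> * of_real x))
    = of_real (cosh (pi * x) * exp (t / 2)) * bessel_exp x (ln t)"
proof -
  let ?\<nu> = "\<i> * complex_of_real x"
  let ?b = "\<lambda>n. bessel_coeff ?\<nu> n * of_real t ^ n"
  let ?e = "\<lambda>n. fps_nth (fps_exp (1 / 2)) n * complex_of_real t ^ n"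
  have trm: "residue_term x t j (1 - ?\<nu>) = kummer_coeff ?\<nu> j * of_real t ^ j" for j
  proof -
    have e: "2 + of_nat j - (1 - ?\<nu>) - \<i> * of_real x = 1 + of_nat j" "2 + of_nat j - (1 - ?\<nu>) + \<i> * of_real x = 1 + of_nat j + 2 * ?\<nu>"
      "1 - ?\<nu> - 1 / 2 - of_nat j = 1 / 2 - ?\<nu> - of_nat j" by simp_all
    have "(- complex_of_real t) ^ j = (- 1) ^ j * of_real t ^ j" by (rule power_minus)
    then show ?thesis unfolding residue_term_def kummer_coeff_def e by (simp only: mult_ac)
  qed
  have c: "cos (of_real pi * ?\<nu>) = of_real (cosh (pi * x))"
  proof -
    have a: "of_real pi * ?\<nu> = \<i> * of_real (pi * x)" by simp
    show ?thesis unfolding a cos_i_times by (simp add: cosh_def scaleR_conv_of_real exp_minus flip: exp_of_real)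
  qed
  have ee: "?e n = complex_of_real (t / 2) ^ n /\<^sub>R fact n" for n
    by (simp add: power_divide scaleR_conv_of_real field_simps)
  have es: "?e sums exp (of_real (t / 2))"
    unfolding ee by (rule exp_converges)
  have en: "summable (\<lambda>n. norm (?e n))"
    unfolding ee by (rule summable_norm_exp)
  note bs = bessel_coeff_sums[OF t, of x]
  have "(\<lambda>k. \<Sum>i\<le>k. ?e i * ?b (k - i)) sums ((\<Sum>n. ?e n) * (\<Sum>n. ?b n))"
    by (rule Cauchy_product_sums[OF en bs(1)])
  moreover have "(\<Sum>i\<le>k. ?e i * ?b (k - i)) = fps_nth (fps_exp (1 / 2) * Abs_fps (bessel_coeff ?\<nu>)) k * of_real t ^ k" for k
    unfolding fps_mult_nth sum_distrib_right atLeast0AtMost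
    by (intro sum.cong refl) (simp add: power_add[symmetric] mult_ac)
  ultimately have "(\<lambda>k. fps_nth (fps_exp (1 / 2) * Abs_fps (bessel_coeff ?\<nu>)) k * of_real t ^ k) sums (exp (of_real (t / 2)) * (\<Sum>n. ?b n))"
    using sums_unique[OF es] by simp
  then have "(\<lambda>k. cos (of_real pi * ?\<nu>) * (fps_nth (fps_exp (1 / 2) * Abs_fps (bessel_coeff ?\<nu>)) k * of_real t ^ k)) sums (cos (of_real pi * ?\<nu>) * (exp (of_real (t / 2)) * (\<Sum>n. ?b n)))"
    by (rule sums_mult)
  moreover have "cos (of_real pi * ?\<nu>) * (fps_nth (fps_exp (1 / 2) * Abs_fps (bessel_coeff ?\<nu>)) k * of_real t ^ k) = of_real (sqrt pi) * exp (?\<nu> * of_real (ln 4)) * residue_term x t k (1 - ?\<nu>)" for k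
    unfolding trm using kummer_bessel_coeff[of ?\<nu> k] by (simp add: mult.assoc[symmetric])
  ultimately have a: "(\<lambda>k. of_real (sqrt pi) * exp (?\<nu> * of_real (ln 4)) * residue_term x t k (1 - ?\<nu>)) sums (cos (of_real pi * ?\<nu>) * (exp (of_real (t / 2)) * (\<Sum>n. ?b n)))"
    by (simp only:)
  have "(\<lambda>k. of_real (sqrt pi) * exp (?\<nu> * of_real (ln 4)) * residue_term x t k (1 - ?\<nu>)) sums (of_real (sqrt pi) * exp (?\<nu> * of_real (ln 4)) * residue_series x t (1 - ?\<nu>))"
    unfolding residue_series_def by (rule sums_mult[OF summable_sums[OF summable_norm_cancel[OF residue_term_summable[OF t]]]])
  then have 1: "of_real (sqrt pi) * exp (?\<nu> * of_real (ln 4)) * residue_series x t (1 - ?\<nu>) = cos (of_real pi * ?\<nu>) * (exp (of_real (t / 2)) * (\<Sum>n. ?b n))"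
    using a by (rule sums_unique2)
  have split: "exp (\<i> * of_real (x * ln t)) = exp (\<i> * of_real (x * (ln t - ln 4))) * exp (?\<nu> * of_real (ln 4))"
    unfolding exp_add[symmetric] by (simp add: algebra_simps)
  have "of_real (sqrt pi) * (exp (\<i> * of_real (x * ln t)) * residue_series x t (1 - ?\<nu>))
     = exp (\<i> * of_real (x * (ln t - ln 4))) * (of_real (sqrt pi) * exp (?\<nu> * of_real (ln 4)) * residue_series x t (1 - ?\<nu>))"
    unfolding split by (simp only: mult_ac)
  also have "\<dots> = of_real (cosh (pi * x)) * exp (of_real (t / 2)) * (exp (\<i> * of_real (x * (ln t - ln 4))) * (\<Sum>n. ?b n))"
    unfolding 1 c by (simp only: mult_ac)
  also have "\<dots> = of_real (cosh (pi * x) * exp (t / 2)) * bessel_exp x (ln t)"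
    unfolding bs(2) by (simp only: exp_of_real of_real_mult)
  finally show ?thesis .
qed

section \<open>The inversion kernel as a Stieltjes transform\<close>

lemma residue_term_uminus: "residue_term (- x) t j s = residue_term x t j s"
  unfolding residue_term_def by (simp add: mult_ac)

lemma residue_series_uminus: "residue_series (- x) t s = residue_series x t s"
  unfolding residue_series_def residue_term_uminus ..

lemma bessel_exp_uminus: "bessel_exp (- x) w = cnj (bessel_exp x w)"
proof -
  have "bessel_term (- x) k w = cnj (bessel_term x k w)" for k
    unfolding bessel_term_def by (simp add: exp_cnj cnj_rGamma del: of_real_diff)
  moreover have "(\<lambda>k. cnj (bessel_term x k w)) sums cnj (bessel_exp x w)"
    unfolding sums_cnj bessel_exp_suminf
    by (rule summable_sums[OF summable_norm_cancel[OF bessel_term_summable_norm]])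
  ultimately show ?thesis unfolding bessel_exp_suminf[of "- x"] by (simp add: sums_iff)
qed

text \<open>Shifting the arguments of the reciprocal Gamma functions by \<open>j\<close> produces the Pochhammer symbols. The upper parameter 1 cancels the
  factorial.\<close>

lemma residue_series_hyp_2F2:
  assumes t: "t > 0" and e: "0 < \<epsilon>" "\<epsilon> < 1 / 2"
  shows "residue_series x t (of_real \<epsilon>) = rGamma (of_real (2 - \<epsilon>) - \<i> * of_real x) * rGamma (of_real (2 - \<epsilon>) + \<i> * of_real x)
     * rGamma (of_real (\<epsilon> - 1 / 2))
     * hyp_2F2 1 (of_real (3 / 2 - \<epsilon>)) (of_real (2 - \<epsilon>) - \<i> * of_real x) (of_real (2 - \<epsilon>) + \<i> * of_real x) (of_real t)"
proof -
  define a b c where "a = complex_of_real (2 - \<epsilon>) - \<i> * of_real x" and "b = complex_of_real (2 - \<epsilon>) + \<i> * of_real x"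
    and "c = complex_of_real (\<epsilon> - 1 / 2)"
  have ab: "a \<notin> \<int>\<^sub>\<le>\<^sub>0" "b \<notin> \<int>\<^sub>\<le>\<^sub>0" using e by (auto intro!: Re_pos_not_nonpos_Int simp: a_def b_def)
  have c: "c \<notin> \<int>\<^sub>\<le>\<^sub>0"
  proof
    assume "c \<in> \<int>\<^sub>\<le>\<^sub>0"
    then obtain n where n: "c = of_int n" "n \<le> 0" by (rule nonpos_Ints_cases)
    then have "\<epsilon> - 1 / 2 = real_of_int n" unfolding c_def by (metis of_real_eq_iff of_real_of_int_eq)
    then have "-1 < n" "n < 0" using e by linarith+
    then show False by simp
  qed
  have nz: "rGamma a \<noteq> 0" "rGamma b \<noteq> 0" "rGamma c \<noteq> 0" using ab c by (simp_all add: rGamma_eq_zero_iff)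
  have poch_nz: "pochhammer a j \<noteq> 0" "pochhammer b j \<noteq> 0" for j
    using pochhammer_rGamma[of a j] pochhammer_rGamma[of b j] nz by auto
  let ?h = "\<lambda>j. (pochhammer 1 j * pochhammer (of_real (3 / 2 - \<epsilon>)) j) / (pochhammer a j * pochhammer b j) * (complex_of_real t ^ j / fact j)"
  have trm: "residue_term x t j (of_real \<epsilon>) = (rGamma a * rGamma b * rGamma c) * ?h j" for j
  proof -
    have e1: "2 + of_nat j - of_real \<epsilon> - \<i> * of_real x = a + of_nat j" "2 + of_nat j - of_real \<epsilon> + \<i> * of_real x = b + of_nat j"
      "of_real \<epsilon> - 1 / 2 - of_nat j = c - of_nat j" by (simp_all add: a_def b_def c_def)
    have ra: "rGamma (a + of_nat j) = rGamma a / pochhammer a j" and rb: "rGamma (b + of_nat j) = rGamma b / pochhammer b j"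
      using pochhammer_rGamma[of a j] pochhammer_rGamma[of b j] poch_nz by (simp_all add: field_simps)
    have "pochhammer (c - of_nat j) j = (- 1) ^ j * pochhammer (of_real (3 / 2 - \<epsilon>)) j"
      using pochhammer_minus[of "of_nat j - c" j] by (simp add: c_def)
    then have rc: "rGamma (c - of_nat j) = (- 1) ^ j * pochhammer (of_real (3 / 2 - \<epsilon>)) j * rGamma c"
      using pochhammer_rGamma[of "c - of_nat j" j] by simp
    have sg: "(- complex_of_real t) ^ j * (- 1) ^ j = of_real t ^ j" by (simp flip: power_mult_distrib)
    have p1: "pochhammer 1 j = (fact j :: complex)" by (simp add: pochhammer_fact)
    have "residue_term x t j (of_real \<epsilon>) = ((- of_real t) ^ j * (- 1) ^ j) * (rGamma a / pochhammer a j) * (rGamma b / pochhammer b j) * (pochhammer (of_real (3 / 2 - \<epsilon>)) j * rGamma c)"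
      unfolding residue_term_def e1 ra rb rc by (simp only: mult_ac)
    then show ?thesis unfolding sg p1 by simp
  qed
  have s: "summable ?h"
  proof -
    have "summable (\<lambda>j. (rGamma a * rGamma b * rGamma c) * ?h j)"
      using summable_norm_cancel[OF residue_term_summable[OF t, of x "of_real \<epsilon>"]] unfolding trm .
    then show ?thesis using nz by (subst (asm) summable_cmult_iff) simp
  qed
  have "residue_series x t (of_real \<epsilon>) = (rGamma a * rGamma b * rGamma c) * (\<Sum>j. ?h j)"
    unfolding residue_series_def trm by (rule suminf_mult[OF s])
  then show ?thesis unfolding hyp_2F2_def a_def[symmetric] b_def[symmetric] c_def[symmetric] .
qed

text \<open>In \<open>stieltjes_K_residue_series\<close> at \<open>s = \<epsilon>\<close> the two sines \<open>sin(\<pi>(\<epsilon>\<plusminus>ix))\<close> are conjugate, as are the two values of the series at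
  \<open>1 \<mp> ix\<close>. Dividing by the sine product therefore leaves the imaginary part of \<open>I\<^bsub>ix\<^esub>(t/2)/sin(\<pi>(\<epsilon>+ix))\<close> in the second summand, and the
  reflection formula turns the first one into \<open>|\<Gamma>(\<epsilon>-1+ix)|\<^sup>2\<close> times the hypergeometric function.\<close>

theorem inversion_kernel_stieltjes:
  assumes x: "x \<noteq> 0" and t: "t > 0" and e: "0 < \<epsilon>" "\<epsilon> < 1 / 2"
  shows "inversion_kernel \<epsilon> x t = of_real (x * sinh (pi * x) / pi\<^sup>2) * stieltjes_K x t (of_real \<epsilon>)"
proof -
  define P where "P = sin (of_real pi * (of_real \<epsilon> + \<i> * of_real x))"
  define H where "H = hyp_2F2 1 (of_real (3 / 2 - \<epsilon>)) (of_real (2 - \<epsilon>) - \<i> * of_real x) (of_real (2 - \<epsilon>) + \<i> * of_real x) (of_real t)"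
  define I where "I = bessel_exp x (ln t)"
  define G where "G = Gamma (of_real (\<epsilon> - 1) + \<i> * of_real x)"
  have M: "sin (of_real pi * (of_real \<epsilon> - \<i> * of_real x)) = cnj P"
  proof -
    have "cnj (of_real pi * (of_real \<epsilon> + \<i> * of_real x)) = of_real pi * (of_real \<epsilon> - \<i> * of_real x)" by simp
    then show ?thesis unfolding P_def cnj_sin by (simp only:)
  qed
  have P0: "P \<noteq> 0" unfolding P_def sin_pi_eq_0 using x by (auto simp: complex_eq_iff)
  have sp: "sin_pair x (of_real \<epsilon>) = P * cnj P" unfolding sin_pair_def M by (simp only: P_def)
  have sinhx: "sinh (pi * x) \<noteq> 0" "sinh (2 * pi * x) = 2 * sinh (pi * x) * cosh (pi * x)"
  proof -
    show "sinh (pi * x) \<noteq> 0" using x by simp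
    have "2 * pi * x = pi * x + pi * x" by simp
    then show "sinh (2 * pi * x) = 2 * sinh (pi * x) * cosh (pi * x)" by (simp only: sinh_add) simp
  qed
  let ?C = "cosh (pi * x) * exp (t / 2)"
  have A: "of_real (sqrt pi) * (exp (\<i> * of_real (x * ln t)) * residue_series x t (1 - \<i> * of_real x)) = of_real ?C * I"
    unfolding I_def by (rule residue_series_bessel[OF t])
  have A': "of_real (sqrt pi) * (exp (- \<i> * of_real (x * ln t)) * residue_series x t (1 + \<i> * of_real x)) = of_real ?C * cnj I"
    using residue_series_bessel[OF t, of "- x"] unfolding I_def residue_series_uminus bessel_exp_uminus by simp
  have S: "stieltjes_K x t (of_real \<epsilon>) * (P * cnj P) = of_real (pi\<^sup>2) * (of_real (sqrt pi) * residue_series x t (of_real \<epsilon>)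
     + of_real (t powr (\<epsilon> - 1)) * (\<i> / of_real (sinh (2 * pi * x)) * (of_real ?C * I * cnj P - of_real ?C * cnj I * P)))"
  proof -
    have tp: "exp ((of_real \<epsilon> - 1) * of_real (ln t)) = complex_of_real (t powr (\<epsilon> - 1))"
      using t by (simp add: powr_def flip: exp_of_real)
    have "stieltjes_K x t (of_real \<epsilon>) * (P * cnj P) = of_real (pi\<^sup>2 * sqrt pi) * (residue_series x t (of_real \<epsilon>)
       + of_real (t powr (\<epsilon> - 1)) * (\<i> / of_real (sinh (2 * pi * x)) *
        (exp (\<i> * of_real (x * ln t)) * residue_series x t (1 - \<i> * of_real x) * cnj P
         - exp (- \<i> * of_real (x * ln t)) * residue_series x t (1 + \<i> * of_real x) * P)))"
      using stieltjes_K_residue_series[OF t x, of "of_real \<epsilon>"] e unfolding sp M tp P_def[symmetric] by simp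
    also have "\<dots> = of_real (pi\<^sup>2) * (of_real (sqrt pi) * residue_series x t (of_real \<epsilon>)
       + of_real (t powr (\<epsilon> - 1)) * (\<i> / of_real (sinh (2 * pi * x)) *
        ((of_real (sqrt pi) * (exp (\<i> * of_real (x * ln t)) * residue_series x t (1 - \<i> * of_real x))) * cnj P
         - (of_real (sqrt pi) * (exp (- \<i> * of_real (x * ln t)) * residue_series x t (1 + \<i> * of_real x))) * P)))"
      unfolding of_real_mult by (simp only: distrib_left right_diff_distrib mult_ac)
    finally show ?thesis unfolding A A' .
  qed
  have E: "of_real (pi\<^sup>2) * residue_series x t (of_real \<epsilon>) = P * cnj P * of_real ((cmod G)\<^sup>2 / Gamma (\<epsilon> - 1 / 2)) * H"
  proof -
    have r: "of_real pi * rGamma (1 - z) = Gamma z * sin (of_real pi * z)" if "Im z \<noteq> 0" for z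
    proof -
      have "z \<notin> \<int>\<^sub>\<le>\<^sub>0" using that by (auto elim!: nonpos_Ints_cases)
      then have "Gamma z \<noteq> 0" by (simp add: Gamma_eq_zero_iff)
      moreover have "rGamma z * rGamma (1 - z) = sin (of_real pi * z) / of_real pi" by (rule rGamma_reflection_complex)
      ultimately show ?thesis by (simp add: rGamma_inverse_Gamma[of z] field_simps)
    qed
    have cG: "cnj G = Gamma (of_real (\<epsilon> - 1) - \<i> * of_real x)" unfolding G_def cnj_Gamma by simp
    have s1: "sin (of_real pi * (of_real (\<epsilon> - 1) + \<i> * of_real x)) = - P"
      using sin_pi_plus_1[of "of_real (\<epsilon> - 1) + \<i> * of_real x"] by (simp add: P_def)
    have s2: "sin (of_real pi * (of_real (\<epsilon> - 1) - \<i> * of_real x)) = - cnj P"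
      using sin_pi_plus_1[of "of_real (\<epsilon> - 1) - \<i> * of_real x"] by (simp flip: M)
    have "of_real pi * rGamma (1 - (of_real (\<epsilon> - 1) + \<i> * of_real x)) = G * (- P)"
      unfolding G_def s1[symmetric] by (rule r) (use x in simp)
    moreover have "1 - (of_real (\<epsilon> - 1) + \<i> * of_real x) = of_real (2 - \<epsilon>) - \<i> * of_real x" by simp
    ultimately have r1: "of_real pi * rGamma (of_real (2 - \<epsilon>) - \<i> * of_real x) = G * (- P)" by (simp only:)
    have "of_real pi * rGamma (1 - (of_real (\<epsilon> - 1) - \<i> * of_real x)) = cnj G * (- cnj P)"
      unfolding cG s2[symmetric] by (rule r) (use x in simp)
    moreover have "1 - (of_real (\<epsilon> - 1) - \<i> * of_real x) = of_real (2 - \<epsilon>) + \<i> * of_real x" by simp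
    ultimately have r2: "of_real pi * rGamma (of_real (2 - \<epsilon>) + \<i> * of_real x) = cnj G * (- cnj P)" by (simp only:)
    have r3: "rGamma (complex_of_real (\<epsilon> - 1 / 2)) = of_real (1 / Gamma (\<epsilon> - 1 / 2))"
      unfolding rGamma_inverse_Gamma Gamma_complex_of_real by (simp add: inverse_eq_divide)
    have "of_real (pi\<^sup>2) * residue_series x t (of_real \<epsilon>) = (of_real pi * rGamma (of_real (2 - \<epsilon>) - \<i> * of_real x)) * (of_real pi * rGamma (of_real (2 - \<epsilon>) + \<i> * of_real x))
      * rGamma (of_real (\<epsilon> - 1 / 2)) * H"
      unfolding residue_series_hyp_2F2[OF t e] H_def power2_eq_square of_real_mult by (simp only: mult_ac)
    also have "\<dots> = P * cnj P * ((G * cnj G) * of_real (1 / Gamma (\<epsilon> - 1 / 2))) * H"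
      unfolding r1 r2 r3 by (simp add: mult_ac)
    also have "G * cnj G = of_real ((cmod G)\<^sup>2)" by (rule complex_norm_square[symmetric])
    finally show ?thesis by simp
  qed
  have im: "I * cnj P - cnj I * P = 2 * \<i> * of_real (Im (I / P)) * (P * cnj P)"
  proof -
    have "z - cnj z = 2 * \<i> * of_real (Im z)" for z by (simp add: complex_eq_iff)
    then have "(I / P - cnj (I / P)) * (P * cnj P) = 2 * \<i> * of_real (Im (I / P)) * (P * cnj P)" by (simp only:)
    moreover have "(I / P - cnj (I / P)) * (P * cnj P) = I * cnj P - cnj I * P"
      using P0 by (simp add: left_diff_distrib)
    ultimately show ?thesis by (simp only:)
  qed
  have bI: "bessel_I (\<i> * of_real x) (of_real (t / 2)) = I"
    unfolding I_def bessel_exp_def using t by simp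
  define k1 where "k1 = (cmod G)\<^sup>2 / Gamma (\<epsilon> - 1 / 2)"
  define k2 where "k2 = Im (I / P)"
  have K: "inversion_kernel \<epsilon> x t = of_real (x * sinh (pi * x) / (pi * sqrt pi) * k1) * H - of_real (x * exp (t / 2) * t powr (\<epsilon> - 1) * k2)"
    unfolding inversion_kernel_def G_def[symmetric] P_def[symmetric] H_def[symmetric] bI k1_def k2_def by (simp add: mult_ac)
  have S2: "stieltjes_K x t (of_real \<epsilon>) * (P * cnj P) = (of_real (sqrt pi * k1) * H - of_real (pi\<^sup>2 / sinh (pi * x) * (exp (t / 2) * t powr (\<epsilon> - 1) * k2))) * (P * cnj P)"
  proof -
    have c: "\<i> / of_real (sinh (2 * pi * x)) * (of_real ?C * I * cnj P - of_real ?C * cnj I * P) = - of_real (exp (t / 2) * k2 / sinh (pi * x)) * (P * cnj P)"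
    proof -
      have fac: "of_real ?C * I * cnj P - of_real ?C * cnj I * P = of_real ?C * (I * cnj P - cnj I * P)" by (simp add: algebra_simps)
      have op: "\<i> / s * (c * (2 * \<i> * k * Q)) = - (2 * c * k / s) * Q" for s c k Q :: complex
      proof -
        have "\<i> / s * (c * (2 * \<i> * k * Q)) = (\<i> * \<i>) * (2 * c * k / s * Q)" by (simp only: divide_inverse mult_ac)
        then show ?thesis by simp
      qed
      have "2 * of_real ?C * of_real k2 / of_real (sinh (2 * pi * x)) = complex_of_real (2 * ?C * k2 / sinh (2 * pi * x))" by simp
      also have "2 * ?C * k2 / sinh (2 * pi * x) = exp (t / 2) * k2 / sinh (pi * x)"
        using sinhx(1) unfolding sinhx(2) by simp
      finally have re: "2 * of_real ?C * of_real k2 / of_real (sinh (2 * pi * x)) = complex_of_real (exp (t / 2) * k2 / sinh (pi * x))" .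
      show ?thesis unfolding fac im k2_def[symmetric] op re ..
    qed
    have "stieltjes_K x t (of_real \<epsilon>) * (P * cnj P) = of_real (sqrt pi) * (of_real (pi\<^sup>2) * residue_series x t (of_real \<epsilon>))
      + of_real (pi\<^sup>2) * (of_real (t powr (\<epsilon> - 1)) * (- of_real (exp (t / 2) * k2 / sinh (pi * x)) * (P * cnj P)))"
      unfolding S c by (simp add: algebra_simps)
    also have "\<dots> = (of_real (sqrt pi * k1) * H - of_real (pi\<^sup>2 / sinh (pi * x) * (exp (t / 2) * t powr (\<epsilon> - 1) * k2))) * (P * cnj P)"
      unfolding E k1_def by (simp add: algebra_simps)
    finally show ?thesis .
  qed
  have "P * cnj P \<noteq> 0" using P0 by simp
  then have S3: "stieltjes_K x t (of_real \<epsilon>) = of_real (sqrt pi * k1) * H - of_real (pi\<^sup>2 / sinh (pi * x) * (exp (t / 2) * t powr (\<epsilon> - 1) * k2))"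
    using S2 by (metis mult_right_cancel)
  have "x * sinh (pi * x) / pi\<^sup>2 * (sqrt pi * k1) = x * sinh (pi * x) / (pi * sqrt pi) * k1"
    using real_sqrt_mult_self[of pi] by (simp add: power2_eq_square divide_simps)
  moreover have "x * sinh (pi * x) / pi\<^sup>2 * (pi\<^sup>2 / sinh (pi * x) * (exp (t / 2) * t powr (\<epsilon> - 1) * k2)) = x * exp (t / 2) * t powr (\<epsilon> - 1) * k2"
    using sinhx(1) by simp
  ultimately show ?thesis unfolding K S3 right_diff_distrib mult.assoc[symmetric, of "complex_of_real (x * sinh (pi * x) / pi\<^sup>2)"] of_real_mult[symmetric]
    by (simp only:)
qed

section \<open>Integrating the inversion kernel against the index transform\<close>

lemma measurable_stieltjes_K [measurable]:
  assumes [measurable]: "f \<in> borel_measurable M"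
  shows "(\<lambda>y. stieltjes_K x (f y) s) \<in> borel_measurable M"
  unfolding stieltjes_K_def by measurable

lemma stieltjes_K_real:
  "stieltjes_K x t (of_real \<epsilon>) = of_real (LBINT v. exp (\<epsilon> * v) * (exp (- (exp v / 2)) * macdonald x (exp v / 2)) / (t + exp v))"
  unfolding stieltjes_K_def integral_complex_of_real[symmetric]
  by (intro Bochner_Integration.integral_cong) (auto simp flip: exp_of_real)

text \<open>The Kontorovich-Lebedev kernel \<open>\<integral>\<^sub>0\<^sup>\<infinity> K\<^bsub>ix\<^esub>(u/2) K\<^bsub>i\<tau>\<^esub>(u/2) u\<^bsup>\<epsilon>-1\<^esup> du\<close>; for \<open>\<epsilon> = 0\<close> the integral does not converge at the origin, where the
  Macdonald functions oscillate without decay.\<close>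

definition KL_kernel :: "real \<Rightarrow> real \<Rightarrow> real \<Rightarrow> real" where
  "KL_kernel \<epsilon> x \<tau> = (LBINT v. exp (\<epsilon> * v) * macdonald x (exp v / 2) * macdonald \<tau> (exp v / 2))"

context
  fixes \<gamma> :: "real \<Rightarrow> complex"
  assumes meas [measurable]: "\<gamma> \<in> borel_measurable borel"
    and L1: "integrable lborel (\<lambda>\<tau>. cosh (pi * \<tau>) powr (- 1 / 2) * norm (\<gamma> \<tau>))"
begin

text \<open>The integral in \<open>G_transform \<gamma>\<close> at the point \<open>t = e\<^bsup>w\<^esup>\<close>.\<close>

definition index_integral :: "real \<Rightarrow> complex" where
  "index_integral w = (LBINT \<tau>. of_real (Re (bessel_exp \<tau> w)) * (\<gamma> \<tau> / of_real (cosh (pi * \<tau>))))"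

definition L1_norm :: real where
  "L1_norm = (LBINT \<tau>. cosh (pi * \<tau>) powr (- 1 / 2) * norm (\<gamma> \<tau>))"

lemma measurable_index_integral [measurable]:
  assumes [measurable]: "f \<in> borel_measurable M"
  shows "(\<lambda>y. index_integral (f y)) \<in> borel_measurable M"
  unfolding index_integral_def by measurable

lemma norm_index_integrand_le:
  "norm (of_real (Re (bessel_exp \<tau> w)) * (\<gamma> \<tau> / of_real (cosh (pi * \<tau>)))) \<le> Re (bessel_exp 0 w) * (cosh (pi * \<tau>) powr (- 1 / 2) * norm (\<gamma> \<tau>))"
proof -
  have c: "cosh (pi * \<tau>) > 0" by simp
  have "\<bar>Re (bessel_exp \<tau> w)\<bar> \<le> norm (rGamma (1 + \<i> * of_real \<tau>)) * Re (bessel_exp 0 w)"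
    using abs_Re_le_cmod norm_bessel_exp_le order_trans by blast
  also have "\<dots> \<le> cosh (pi * \<tau>) powr (1 / 2) * Re (bessel_exp 0 w)"
    by (intro mult_right_mono norm_rGamma_imaginary_bound Re_bessel_exp_0_nonneg)
  finally have "\<bar>Re (bessel_exp \<tau> w)\<bar> * (norm (\<gamma> \<tau>) / cosh (pi * \<tau>)) \<le> cosh (pi * \<tau>) powr (1 / 2) * Re (bessel_exp 0 w) * (norm (\<gamma> \<tau>) / cosh (pi * \<tau>))"
    using c by (intro mult_right_mono) (auto simp: less_imp_le)
  also have "\<dots> = Re (bessel_exp 0 w) * ((cosh (pi * \<tau>) powr (1 / 2) / cosh (pi * \<tau>)) * norm (\<gamma> \<tau>))" by simp
  also have "cosh (pi * \<tau>) powr (1 / 2) / cosh (pi * \<tau>) = cosh (pi * \<tau>) powr (1 / 2 - 1)"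
    using c by (subst powr_diff) simp
  also have "(1 / 2 - 1 :: real) = - 1 / 2" by simp
  finally show ?thesis using c by (simp add: norm_mult norm_divide)
qed

lemma norm_index_integral_le: "norm (index_integral w) \<le> L1_norm * Re (bessel_exp 0 w)"
proof -
  have i: "integrable lborel (\<lambda>\<tau>. Re (bessel_exp 0 w) * (cosh (pi * \<tau>) powr (- 1 / 2) * norm (\<gamma> \<tau>)))"
    by (intro integrable_mult_right L1)
  have i2: "integrable lborel (\<lambda>\<tau>. of_real (Re (bessel_exp \<tau> w)) * (\<gamma> \<tau> / of_real (cosh (pi * \<tau>))))"
  proof (rule Bochner_Integration.integrable_bound[OF i])
    show "AE \<tau> in lborel. norm (of_real (Re (bessel_exp \<tau> w)) * (\<gamma> \<tau> / of_real (cosh (pi * \<tau>)))) \<le> norm (Re (bessel_exp 0 w) * (cosh (pi * \<tau>) powr (- 1 / 2) * norm (\<gamma> \<tau>)))"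
      unfolding real_norm_def by (intro AE_I2 order_trans[OF norm_index_integrand_le abs_ge_self])
  qed measurable
  have "norm (index_integral w) \<le> (LBINT \<tau>. norm (of_real (Re (bessel_exp \<tau> w)) * (\<gamma> \<tau> / of_real (cosh (pi * \<tau>)))))"
    unfolding index_integral_def by (rule integral_norm_bound)
  also have "\<dots> \<le> (LBINT \<tau>. Re (bessel_exp 0 w) * (cosh (pi * \<tau>) powr (- 1 / 2) * norm (\<gamma> \<tau>)))"
    by (intro integral_mono integrable_norm i i2 norm_index_integrand_le)
  also have "\<dots> = Re (bessel_exp 0 w) * L1_norm" unfolding L1_norm_def by (rule integral_mult_right_zero)
  finally show ?thesis by (simp add: mult.commute)
qed

lemma index_integral_stieltjes:
  fixes u :: real
  assumes u: "u > 0"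
  shows "(LBINT w. of_real (exp w * exp (- (exp w / 2)) / (exp w + u)) * index_integral w)
    = of_real (exp (u / 2)) * (LBINT \<tau>. \<gamma> \<tau> / of_real (cosh (pi * \<tau>)) * of_real (macdonald \<tau> (u / 2)))"
proof -
  define a where "a = (\<lambda>w. exp w * exp (- (exp w / 2)) / (exp w + u))"
  have a0: "a w \<ge> 0" for w using u by (simp add: a_def less_imp_le add_pos_pos)
  define f where "f = (\<lambda>\<tau> w. of_real (a w) * (of_real (Re (bessel_exp \<tau> w)) * (\<gamma> \<tau> / of_real (cosh (pi * \<tau>)))))"
  define D where "D = (\<lambda>\<tau> w. (cosh (pi * \<tau>) powr (- 1 / 2) * norm (\<gamma> \<tau>)) * (exp w * exp (- (exp w / 2)) * Re (bessel_exp 0 w) / (exp w + u)))"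
  have m: "case_prod f \<in> borel_measurable (borel \<Otimes>\<^sub>M borel)"
    unfolding f_def a_def by (simp add: case_prod_beta) measurable
  have Dn: "norm (f \<tau> w) \<le> D \<tau> w" for \<tau> w
  proof -
    have "norm (f \<tau> w) \<le> a w * (Re (bessel_exp 0 w) * (cosh (pi * \<tau>) powr (- 1 / 2) * norm (\<gamma> \<tau>)))"
      unfolding f_def norm_mult[of "of_real (a w)"] norm_of_real abs_of_nonneg[OF a0]
      by (rule mult_left_mono[OF norm_index_integrand_le a0])
    then show ?thesis unfolding D_def a_def by (simp add: mult_ac)
  qed
  have Di: "integrable lborel (D \<tau>)" for \<tau>
    unfolding D_def by (intro integrable_mult_right bessel_stieltjes u)
  have DE: "(LBINT w. D \<tau> w) = (cosh (pi * \<tau>) powr (- 1 / 2) * norm (\<gamma> \<tau>)) * (exp (u / 2) * macdonald 0 (u / 2))" for \<tau>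
    unfolding D_def integral_mult_right_zero bessel_stieltjes(2)[OF u] ..
  have Ei: "integrable lborel (\<lambda>\<tau>. (cosh (pi * \<tau>) powr (- 1 / 2) * norm (\<gamma> \<tau>)) * (exp (u / 2) * macdonald 0 (u / 2)))"
    by (intro integrable_mult_left L1)
  note fub = fubini_dominated[OF m Di Dn eq_refl[OF DE] Ei]
  have fw: "(LBINT w. f \<tau> w) = of_real (exp (u / 2)) * (\<gamma> \<tau> / of_real (cosh (pi * \<tau>)) * of_real (macdonald \<tau> (u / 2)))" for \<tau>
  proof -
    have "(LBINT w. f \<tau> w) = (LBINT w. (\<gamma> \<tau> / of_real (cosh (pi * \<tau>))) * complex_of_real (exp w * exp (- (exp w / 2)) * Re (bessel_exp \<tau> w) / (exp w + u)))"
      by (intro Bochner_Integration.integral_cong) (auto simp: f_def a_def mult_ac)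
    also have "\<dots> = (\<gamma> \<tau> / of_real (cosh (pi * \<tau>))) * of_real (exp (u / 2) * macdonald \<tau> (u / 2))"
      unfolding integral_mult_right_zero integral_complex_of_real bessel_stieltjes(2)[OF u] ..
    finally show ?thesis by simp
  qed
  have "(LBINT w. of_real (a w) * index_integral w) = (LBINT w. LBINT \<tau>. f \<tau> w)"
    unfolding f_def integral_mult_right_zero index_integral_def ..
  also have "\<dots> = (LBINT \<tau>. LBINT w. f \<tau> w)" by (rule fub(3)[symmetric])
  also have "\<dots> = of_real (exp (u / 2)) * (LBINT \<tau>. \<gamma> \<tau> / of_real (cosh (pi * \<tau>)) * of_real (macdonald \<tau> (u / 2)))"
    unfolding fw integral_mult_right_zero ..
  finally show ?thesis unfolding a_def .
qed

text \<open>Exchange the integral over \<open>w\<close> with the one that defines \<open>stieltjes_K\<close>, apply \<open>index_integral_stieltjes\<close>, whose exponential cancels the one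
  in \<open>stieltjes_K\<close>, and exchange again. The majorants use only \<open>I\<^sub>0\<close> and \<open>K\<^sub>0\<close>, so that both exchanges come down to the finiteness of
  \<open>KL_kernel \<epsilon> 0 0\<close>.\<close>

lemma stieltjes_index_integral:
  fixes \<epsilon> x :: real
  assumes e: "\<epsilon> > 0"
  shows "integrable lborel (\<lambda>w. of_real (exp w * exp (- (exp w / 2))) * stieltjes_K x (exp w) (of_real \<epsilon>) * index_integral w)"
    and "(LBINT w. of_real (exp w * exp (- (exp w / 2))) * stieltjes_K x (exp w) (of_real \<epsilon>) * index_integral w)
      = (LBINT \<tau>. \<gamma> \<tau> / of_real (cosh (pi * \<tau>)) * of_real (KL_kernel \<epsilon> x \<tau>))"
    and "integrable lborel (\<lambda>\<tau>. \<gamma> \<tau> / of_real (cosh (pi * \<tau>)) * of_real (KL_kernel \<epsilon> x \<tau>))"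
proof -
  define h where "h = (\<lambda>v. exp (\<epsilon> * v) * (exp (- (exp v / 2)) * macdonald x (exp v / 2)))"
  define f where "f = (\<lambda>v w. complex_of_real (h v) * (of_real (exp w * exp (- (exp w / 2)) / (exp w + exp v)) * index_integral w))"
  define D where "D = (\<lambda>v w. L1_norm * \<bar>h v\<bar> * (exp w * exp (- (exp w / 2)) * Re (bessel_exp 0 w) / (exp w + exp v)))"
  have m: "case_prod f \<in> borel_measurable (borel \<Otimes>\<^sub>M borel)"
    unfolding f_def h_def by (simp add: case_prod_beta) measurable
  have L0: "L1_norm \<ge> 0" unfolding L1_norm_def by (intro Bochner_Integration.integral_nonneg) simp
  have Dn: "norm (f v w) \<le> D v w" for v w
  proof -
    have p: "exp w * exp (- (exp w / 2)) / (exp w + exp v) \<ge> 0" by (simp add: less_imp_le add_pos_pos)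
    then have "norm (f v w) = \<bar>h v\<bar> * (exp w * exp (- (exp w / 2)) / (exp w + exp v) * norm (index_integral w))"
      unfolding f_def norm_mult norm_of_real by simp
    also have "\<dots> \<le> \<bar>h v\<bar> * (exp w * exp (- (exp w / 2)) / (exp w + exp v) * (L1_norm * Re (bessel_exp 0 w)))"
      by (intro mult_left_mono norm_index_integral_le p) auto
    finally show ?thesis unfolding D_def by (simp add: mult_ac)
  qed
  have Di: "integrable lborel (D v)" for v
    unfolding D_def by (intro integrable_mult_right bessel_stieltjes exp_gt_zero)
  have DE: "(LBINT w. D v w) \<le> L1_norm * (exp (\<epsilon> * v) * macdonald 0 (exp v / 2) * macdonald 0 (exp v / 2))" for v
  proof -
    have "(LBINT w. D v w) = L1_norm * \<bar>h v\<bar> * (exp (exp v / 2) * macdonald 0 (exp v / 2))"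
      unfolding D_def integral_mult_right_zero bessel_stieltjes(2)[OF exp_gt_zero] ..
    also have "\<bar>h v\<bar> = exp (\<epsilon> * v) * (exp (- (exp v / 2)) * \<bar>macdonald x (exp v / 2)\<bar>)"
      by (simp add: h_def abs_mult)
    also have "L1_norm * (exp (\<epsilon> * v) * (exp (- (exp v / 2)) * \<bar>macdonald x (exp v / 2)\<bar>)) * (exp (exp v / 2) * macdonald 0 (exp v / 2))
      = (exp (- (exp v / 2)) * exp (exp v / 2)) * (L1_norm * (exp (\<epsilon> * v) * \<bar>macdonald x (exp v / 2)\<bar> * macdonald 0 (exp v / 2)))"
      by (simp only: mult_ac)
    also have "exp (- (exp v / 2)) * exp (exp v / 2) = 1" unfolding exp_add[symmetric] by simp
    also have "1 * (L1_norm * (exp (\<epsilon> * v) * \<bar>macdonald x (exp v / 2)\<bar> * macdonald 0 (exp v / 2)))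
      \<le> L1_norm * (exp (\<epsilon> * v) * macdonald 0 (exp v / 2) * macdonald 0 (exp v / 2))"
      unfolding mult_1_left using L0 by (intro mult_left_mono mult_right_mono macdonald_0_nonneg abs_macdonald_le) auto
    finally show ?thesis .
  qed
  have Ei: "integrable lborel (\<lambda>v. L1_norm * (exp (\<epsilon> * v) * macdonald 0 (exp v / 2) * macdonald 0 (exp v / 2)))"
    by (intro integrable_mult_right macdonald_product e)
  note fub = fubini_dominated[OF m Di Dn DE Ei]
  have fv: "(LBINT v. f v w) = of_real (exp w * exp (- (exp w / 2))) * stieltjes_K x (exp w) (of_real \<epsilon>) * index_integral w" for w
  proof -
    have "(LBINT v. f v w) = (LBINT v. (of_real (exp w * exp (- (exp w / 2))) * index_integral w) * complex_of_real (h v / (exp w + exp v)))"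
      by (intro Bochner_Integration.integral_cong) (auto simp: f_def mult_ac)
    also have "\<dots> = (of_real (exp w * exp (- (exp w / 2))) * index_integral w) * stieltjes_K x (exp w) (of_real \<epsilon>)"
      unfolding integral_mult_right_zero integral_complex_of_real stieltjes_K_real h_def ..
    finally show ?thesis by (simp only: mult_ac)
  qed
  show "integrable lborel (\<lambda>w. of_real (exp w * exp (- (exp w / 2))) * stieltjes_K x (exp w) (of_real \<epsilon>) * index_integral w)"
    using fub(2) unfolding fv .
  define g where "g = (\<lambda>\<tau> v. \<gamma> \<tau> / of_real (cosh (pi * \<tau>)) * of_real (exp (\<epsilon> * v) * macdonald x (exp v / 2) * macdonald \<tau> (exp v / 2)))"
  define D' where "D' = (\<lambda>\<tau> v. (cosh (pi * \<tau>) powr (- 1 / 2) * norm (\<gamma> \<tau>)) * (exp (\<epsilon> * v) * macdonald 0 (exp v / 2) * macdonald 0 (exp v / 2)))"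
  have m': "case_prod g \<in> borel_measurable (borel \<Otimes>\<^sub>M borel)"
    unfolding g_def by (simp add: case_prod_beta) measurable
  have Dn': "norm (g \<tau> v) \<le> D' \<tau> v" for \<tau> v
  proof -
    have c: "cosh (pi * \<tau>) \<ge> 1" by (rule cosh_real_ge_1)
    have "norm (\<gamma> \<tau> / of_real (cosh (pi * \<tau>))) = cosh (pi * \<tau>) powr (- 1) * norm (\<gamma> \<tau>)"
      using c by (simp add: norm_divide powr_minus_divide)
    also have "\<dots> \<le> cosh (pi * \<tau>) powr (- 1 / 2) * norm (\<gamma> \<tau>)"
      using c by (intro mult_right_mono powr_mono) auto
    finally have 1: "norm (\<gamma> \<tau> / of_real (cosh (pi * \<tau>))) \<le> cosh (pi * \<tau>) powr (- 1 / 2) * norm (\<gamma> \<tau>)" .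
    have "norm (complex_of_real (exp (\<epsilon> * v) * macdonald x (exp v / 2) * macdonald \<tau> (exp v / 2))) = exp (\<epsilon> * v) * \<bar>macdonald x (exp v / 2)\<bar> * \<bar>macdonald \<tau> (exp v / 2)\<bar>"
      unfolding norm_of_real by (simp add: abs_mult)
    also have "\<dots> \<le> exp (\<epsilon> * v) * macdonald 0 (exp v / 2) * macdonald 0 (exp v / 2)"
      by (intro mult_mono abs_macdonald_le mult_nonneg_nonneg macdonald_0_nonneg) auto
    finally show ?thesis unfolding g_def D'_def norm_mult[of "\<gamma> \<tau> / of_real (cosh (pi * \<tau>))"]
      using 1 by (intro mult_mono) (auto intro!: mult_nonneg_nonneg macdonald_0_nonneg)
  qed
  have Di': "integrable lborel (D' \<tau>)" for \<tau>
    unfolding D'_def by (intro integrable_mult_right macdonald_product e)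
  have DE': "(LBINT v. D' \<tau> v) = (cosh (pi * \<tau>) powr (- 1 / 2) * norm (\<gamma> \<tau>)) * KL_kernel \<epsilon> 0 0" for \<tau>
    unfolding D'_def integral_mult_right_zero KL_kernel_def ..
  have Ei': "integrable lborel (\<lambda>\<tau>. (cosh (pi * \<tau>) powr (- 1 / 2) * norm (\<gamma> \<tau>)) * KL_kernel \<epsilon> 0 0)"
    by (intro integrable_mult_left L1)
  note fub' = fubini_dominated[OF m' Di' Dn' eq_refl[OF DE'] Ei']
  have gv: "(LBINT v. g \<tau> v) = \<gamma> \<tau> / of_real (cosh (pi * \<tau>)) * of_real (KL_kernel \<epsilon> x \<tau>)" for \<tau>
    unfolding g_def integral_mult_right_zero integral_complex_of_real KL_kernel_def ..
  show "integrable lborel (\<lambda>\<tau>. \<gamma> \<tau> / of_real (cosh (pi * \<tau>)) * of_real (KL_kernel \<epsilon> x \<tau>))"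
    using fub'(1) unfolding gv .
  have fw: "(LBINT w. f v w) = (LBINT \<tau>. g \<tau> v)" for v
  proof -
    have "(LBINT w. f v w) = of_real (h v) * (of_real (exp (exp v / 2)) * (LBINT \<tau>. \<gamma> \<tau> / of_real (cosh (pi * \<tau>)) * of_real (macdonald \<tau> (exp v / 2))))"
      unfolding f_def integral_mult_right_zero index_integral_stieltjes[OF exp_gt_zero] ..
    also have "\<dots> = of_real (h v * exp (exp v / 2)) * (LBINT \<tau>. \<gamma> \<tau> / of_real (cosh (pi * \<tau>)) * of_real (macdonald \<tau> (exp v / 2)))"
      by simp
    also have "h v * exp (exp v / 2) = exp (\<epsilon> * v) * macdonald x (exp v / 2)"
    proof -
      have "h v * exp (exp v / 2) = (exp (- (exp v / 2)) * exp (exp v / 2)) * (exp (\<epsilon> * v) * macdonald x (exp v / 2))"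
        unfolding h_def by (simp only: mult_ac)
      also have "exp (- (exp v / 2)) * exp (exp v / 2) = 1" unfolding exp_add[symmetric] by simp
      finally show ?thesis by simp
    qed
    also have "of_real (exp (\<epsilon> * v) * macdonald x (exp v / 2)) * (LBINT \<tau>. \<gamma> \<tau> / of_real (cosh (pi * \<tau>)) * of_real (macdonald \<tau> (exp v / 2))) = (LBINT \<tau>. g \<tau> v)"
      unfolding integral_mult_right_zero[symmetric] g_def
      by (intro Bochner_Integration.integral_cong) (auto simp: mult_ac)
    finally show ?thesis .
  qed
  show "(LBINT w. of_real (exp w * exp (- (exp w / 2))) * stieltjes_K x (exp w) (of_real \<epsilon>) * index_integral w)
      = (LBINT \<tau>. \<gamma> \<tau> / of_real (cosh (pi * \<tau>)) * of_real (KL_kernel \<epsilon> x \<tau>))"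
    unfolding fv[symmetric] fub(3)[symmetric] fw gv[symmetric] by (rule fub'(3)[symmetric])
qed

theorem inversion_kernel_G_transform:
  fixes \<epsilon> x :: real
  assumes e: "0 < \<epsilon>" "\<epsilon> < 1 / 2" and x: "x \<noteq> 0"
  shows "set_integrable lborel {0<..} (\<lambda>t. inversion_kernel \<epsilon> x t * G_transform \<gamma> t)"
    and "(LBINT t:{0<..}. inversion_kernel \<epsilon> x t * G_transform \<gamma> t)
      = of_real (x * sinh (pi * x) / pi\<^sup>2 * sqrt pi) * (LBINT \<tau>. \<gamma> \<tau> / of_real (cosh (pi * \<tau>)) * of_real (KL_kernel \<epsilon> x \<tau>))"
proof -
  define c where "c = complex_of_real (x * sinh (pi * x) / pi\<^sup>2 * sqrt pi)"
  \<comment> \<open>Agrees with the integrand for \<open>t > 0\<close>, and its measurability on all of \<open>\<real>\<close> is evident.\<close>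
  define F where "F = (\<lambda>t. c * (of_real (exp (- (t / 2))) * stieltjes_K x t (of_real \<epsilon>) * index_integral (ln t)))"
  have F: "inversion_kernel \<epsilon> x t * G_transform \<gamma> t = F t" if "t > 0" for t
  proof -
    have "bessel_I (\<i> * of_real \<tau>) (of_real (t / 2)) = bessel_exp \<tau> (ln t)" for \<tau>
      unfolding bessel_exp_def using that by simp
    then have "G_transform \<gamma> t = of_real (sqrt pi * exp (- t / 2)) * index_integral (ln t)"
      unfolding G_transform_def index_integral_def by simp
    then show ?thesis unfolding inversion_kernel_stieltjes[OF x that e] F_def c_def by (simp add: mult_ac)
  qed
  have Fm: "F \<in> borel_measurable borel" unfolding F_def by measurable
  have eF: "exp w *\<^sub>R F (exp w) = c * (of_real (exp w * exp (- (exp w / 2))) * stieltjes_K x (exp w) (of_real \<epsilon>) * index_integral w)" for w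
    unfolding F_def by (simp add: scaleR_conv_of_real mult_ac)
  have i: "integrable lborel (\<lambda>w. exp w *\<^sub>R F (exp w))"
    unfolding eF by (intro integrable_mult_right stieltjes_index_integral e)
  have "set_integrable lborel {0<..} F" by (rule exp_substitution(1)[OF Fm i])
  then show "set_integrable lborel {0<..} (\<lambda>t. inversion_kernel \<epsilon> x t * G_transform \<gamma> t)"
    by (rule set_integrable_cong[THEN iffD1, rotated -1]) (auto simp: F)
  have "(LBINT t:{0<..}. inversion_kernel \<epsilon> x t * G_transform \<gamma> t) = (LBINT t:{0<..}. F t)"
    by (rule set_lebesgue_integral_cong) (auto simp: F)
  also have "\<dots> = (LBINT w. exp w *\<^sub>R F (exp w))" by (rule exp_substitution(2)[OF Fm i])
  also have "\<dots> = c * (LBINT \<tau>. \<gamma> \<tau> / of_real (cosh (pi * \<tau>)) * of_real (KL_kernel \<epsilon> x \<tau>))"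
    unfolding eF integral_mult_right_zero stieltjes_index_integral(2)[OF e(1)] ..
  finally show "(LBINT t:{0<..}. inversion_kernel \<epsilon> x t * G_transform \<gamma> t)
      = of_real (x * sinh (pi * x) / pi\<^sup>2 * sqrt pi) * (LBINT \<tau>. \<gamma> \<tau> / of_real (cosh (pi * \<tau>)) * of_real (KL_kernel \<epsilon> x \<tau>))"
    unfolding c_def .
qed

end

section \<open>The Kontorovich-Lebedev kernel as an approximate identity\<close>

lemma arctan_integral_real_line:
  "integrable lborel (\<lambda>v::real. 1 / (1 + v\<^sup>2))" "(LBINT v::real. 1 / (1 + v\<^sup>2)) = pi"
proof -
  let ?f = "\<lambda>v::real. 1 / (1 + v\<^sup>2)"
  have "(\<integral>\<^sup>+ v. ennreal (?f v) * indicator {0..} v \<partial>lborel) = ennreal (pi / 2 - arctan 0)"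
  proof (rule nn_integral_FTC_atLeast)
    show "DERIV arctan v :> ?f v" for v using DERIV_arctan[of v] by (simp add: divide_inverse)
    show "?f \<in> borel_measurable borel" by measurable
  qed (auto intro: tendsto_arctan_at_top)
  then have n: "(\<integral>\<^sup>+ v. ennreal (indicator {0..} v *\<^sub>R ?f v) \<partial>lborel) = ennreal (pi / 2)"
    by (subst nn_integral_cong[where v = "\<lambda>v. ennreal (?f v) * indicator {0..} v"]) (auto split: split_indicator)
  have "has_bochner_integral lborel (\<lambda>v. indicator {0..} v *\<^sub>R ?f v) (pi / 2)"
    by (rule has_bochner_integral_nn_integral[OF _ _ _ n]) auto
  from has_bochner_integral_even_function[OF this] have "has_bochner_integral lborel ?f pi" by simp
  then show "integrable lborel ?f" "(LBINT v. ?f v) = pi" by (auto simp: has_bochner_integral_iff)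
qed

text \<open>The regular part of \<open>|\<Gamma>((\<epsilon>+iy)/2)|\<^sup>2\<close>: splitting off the pole at the origin leaves the Poisson-type factor \<open>4/(\<epsilon>\<^sup>2+y\<^sup>2)\<close>.\<close>

definition Gamma_modulus :: "real \<Rightarrow> real \<Rightarrow> real" where
  "Gamma_modulus \<epsilon> y = (cmod (Gamma (Complex (1 + \<epsilon> / 2) (y / 2))))\<^sup>2"

lemma KL_kernel_eq:
  assumes e: "\<epsilon> > 0"
  shows "KL_kernel \<epsilon> x \<tau> = 2 * 4 powr \<epsilon> / Gamma (1 + \<epsilon>) * (\<epsilon> / (\<epsilon>\<^sup>2 + (x - \<tau>)\<^sup>2))
    * (Gamma_modulus \<epsilon> (x + \<tau>) * Gamma_modulus \<epsilon> (x - \<tau>)) / (\<epsilon>\<^sup>2 + (x + \<tau>)\<^sup>2)"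
proof -
  have G: "Gamma (of_real (\<epsilon> / 2) + \<i> * of_real (y / 2)) * Gamma (of_real (\<epsilon> / 2) - \<i> * of_real (y / 2)) = of_real (4 * Gamma_modulus \<epsilon> y / (\<epsilon>\<^sup>2 + y\<^sup>2))" for y
  proof -
    define z where "z = Complex (\<epsilon> / 2) (y / 2)"
    have z: "of_real (\<epsilon> / 2) + \<i> * of_real (y / 2) = z" "of_real (\<epsilon> / 2) - \<i> * of_real (y / 2) = cnj z"
      by (simp_all add: z_def complex_eq_iff)
    have zn: "z \<notin> \<int>\<^sub>\<le>\<^sub>0" by (rule Re_pos_not_nonpos_Int) (use e in \<open>simp add: z_def\<close>)
    then have z0: "z \<noteq> 0" by auto
    have z1: "z + 1 = Complex (1 + \<epsilon> / 2) (y / 2)" by (simp add: z_def complex_eq_iff)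
    have "Gamma z = Gamma (z + 1) / z" using Gamma_plus1[OF zn] z0 by simp
    then have "(cmod (Gamma z))\<^sup>2 = Gamma_modulus \<epsilon> y / (cmod z)\<^sup>2"
      unfolding z1 by (simp add: norm_divide power_divide Gamma_modulus_def)
    also have "(cmod z)\<^sup>2 = (\<epsilon>\<^sup>2 + y\<^sup>2) / 4" by (simp add: z_def cmod_power2 power_divide add_divide_distrib)
    finally have "(cmod (Gamma z))\<^sup>2 = 4 * Gamma_modulus \<epsilon> y / (\<epsilon>\<^sup>2 + y\<^sup>2)" by simp
    then show ?thesis unfolding z cnj_Gamma[symmetric] complex_norm_square[symmetric] by (simp only:)
  qed
  define P where "P = 4 * Gamma_modulus \<epsilon> (x + \<tau>) / (\<epsilon>\<^sup>2 + (x + \<tau>)\<^sup>2)"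
  define M where "M = 4 * Gamma_modulus \<epsilon> (x - \<tau>) / (\<epsilon>\<^sup>2 + (x - \<tau>)\<^sup>2)"
  have "complex_of_real (KL_kernel \<epsilon> x \<tau>) = of_real (4 powr \<epsilon> / 8) * Gamma (of_real \<epsilon>) * (of_real P / Gamma (of_real \<epsilon>)) * (of_real M / Gamma (of_real \<epsilon>))"
    unfolding KL_kernel_def macdonald_product(2)[OF e] G P_def M_def ..
  also have "\<dots> = of_real (4 powr \<epsilon> / 8 * Gamma \<epsilon> * (P / Gamma \<epsilon>) * (M / Gamma \<epsilon>))"
    unfolding Gamma_complex_of_real by simp
  finally have "KL_kernel \<epsilon> x \<tau> = 4 powr \<epsilon> / 8 * Gamma \<epsilon> * (P / Gamma \<epsilon>) * (M / Gamma \<epsilon>)"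
    using of_real_eq_iff by blast
  also have "\<dots> = 4 powr \<epsilon> / 8 * (P * M) / Gamma \<epsilon>" using Gamma_real_pos[OF e] by simp
  also have "Gamma \<epsilon> = Gamma (1 + \<epsilon>) / \<epsilon>"
    using Gamma_plus1[of \<epsilon>] e by (simp add: add.commute) (metis Gamma_plus1 add.commute less_irrefl nonpos_Ints_of_int nonpos_Ints_nonpos not_less nonzero_mult_div_cancel_left)
  finally show ?thesis unfolding P_def M_def by (simp add: mult_ac)
qed

lemma Gamma_modulus_even: "Gamma_modulus \<epsilon> (- y) = Gamma_modulus \<epsilon> y"
proof -
  have "Complex (1 + \<epsilon> / 2) (- y / 2) = cnj (Complex (1 + \<epsilon> / 2) (y / 2))" by (simp add: complex_eq_iff)
  then show ?thesis unfolding Gamma_modulus_def by (simp only: cnj_Gamma[symmetric] complex_mod_cnj)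
qed

lemma KL_kernel_even: "\<epsilon> > 0 \<Longrightarrow> KL_kernel \<epsilon> x (- \<tau>) = KL_kernel \<epsilon> x \<tau>"
  by (simp add: KL_kernel_eq mult_ac)

lemma KL_kernel_abs: "\<epsilon> > 0 \<Longrightarrow> KL_kernel \<epsilon> \<bar>x\<bar> \<tau> = KL_kernel \<epsilon> x \<tau>"
proof (cases "x \<ge> 0")
  case False
  assume e: "\<epsilon> > 0"
  have "- x + \<tau> = - (x - \<tau>)" "- x - \<tau> = - (x + \<tau>)" by simp_all
  then have "KL_kernel \<epsilon> (- x) \<tau> = KL_kernel \<epsilon> x \<tau>"
    unfolding KL_kernel_eq[OF e] by (simp only: Gamma_modulus_even power2_minus) (simp add: mult_ac)
  then show ?thesis using False by simp
qed simp

lemma norm_Gamma_le: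
  assumes z: "Re z > 0"
  shows "norm (Gamma z) \<le> Gamma (Re z)"
proof -
  have "norm (Gamma z) \<le> (LBINT v. norm (exp (z * of_real v) * complex_of_real (exp (- exp v))))"
    unfolding Gamma_exp_integral_1(2)[OF z, symmetric] by (rule integral_norm_bound)
  also have "\<dots> = (LBINT v. exp (Re z * v) * exp (- 1 * exp v))" by (simp add: norm_mult)
  also have "\<dots> = Gamma (Re z)" using Gamma_exp_integral_real(2)[OF z, of 1] by simp
  finally show ?thesis .
qed

lemma Gamma_modulus_1: "Gamma_modulus 0 (2 * y) * sinh (pi * y) = pi * y"
proof -
  have z: "Complex (1 + 0 / 2) (2 * y / 2) = 1 + \<i> * of_real y" by (simp add: complex_eq_iff)
  have "(norm (rGamma (1 + \<i> * of_real y)))\<^sup>2 * (pi * y) = sinh (pi * y)" by (rule norm_rGamma_imaginary)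
  moreover have "Gamma (1 + \<i> * of_real y) \<noteq> 0"
    using Re_pos_not_nonpos_Int[of "1 + \<i> * of_real y"] by (simp add: Gamma_eq_zero_iff)
  ultimately show ?thesis unfolding Gamma_modulus_def z rGamma_inverse_Gamma norm_inverse
    by (simp add: power_inverse field_simps)
qed

lemma tendsto_Gamma_modulus:
  assumes "(a \<longlongrightarrow> 0) F" "(b \<longlongrightarrow> y) F"
  shows "((\<lambda>n. Gamma_modulus (a n) (b n)) \<longlongrightarrow> Gamma_modulus 0 y) F"
proof -
  have "Complex (1 + 0 / 2) (y / 2) \<notin> \<int>\<^sub>\<le>\<^sub>0" by (rule Re_pos_not_nonpos_Int) simp
  then show ?thesis unfolding Gamma_modulus_def
    by (intro tendsto_power tendsto_norm tendsto_Gamma tendsto_Complex tendsto_intros assms) auto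
qed

text \<open>By evenness it suffices to integrate over \<open>\<tau> \<ge> 0\<close>, where only the peak at \<open>X = |x|\<close> lies. The substitution \<open>\<tau> = X + \<epsilon>v\<close> turns the
  Poisson kernel into \<open>1/(1+v\<^sup>2)\<close>, which is also the majorant: the second factor \<open>1/(\<epsilon>\<^sup>2+(X+\<tau>)\<^sup>2)\<close> is at most \<open>1/X\<^sup>2\<close> there.\<close>

lemma KL_kernel_approximate_identity:
  fixes H :: "real \<Rightarrow> complex"
  assumes cont: "continuous_on UNIV H" and bound: "\<And>\<tau>. norm (H \<tau>) \<le> B" and even: "\<And>\<tau>. H (- \<tau>) = H \<tau>"
    and int: "\<And>\<epsilon>. 0 < \<epsilon> \<Longrightarrow> integrable lborel (\<lambda>\<tau>. H \<tau> * of_real (KL_kernel \<epsilon> x \<tau>))"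
    and x: "x \<noteq> 0"
  shows "((\<lambda>\<epsilon>. LBINT \<tau>. H \<tau> * of_real (KL_kernel \<epsilon> x \<tau>)) \<longlongrightarrow> of_real (pi\<^sup>2 / (x * sinh (pi * x))) * H x) (at_right 0)"
proof -
  define X where "X = \<bar>x\<bar>"
  have X: "X > 0" using x by (simp add: X_def)
  have [measurable]: "H \<in> borel_measurable borel" using cont by (rule borel_measurable_continuous_onI)
  have B0: "B \<ge> 0" using bound[of 0] norm_ge_zero order_trans by blast
  \<comment> \<open>The integrand over \<open>\<tau> \<ge> 0\<close> after the substitution \<open>\<tau> = X + \<epsilon>v\<close>.\<close>
  define k where "k = (\<lambda>\<epsilon> v. indicator {0..} (X + \<epsilon> * v) *\<^sub>R (H (X + \<epsilon> * v) * of_real (2 * 4 powr \<epsilon> / Gamma (1 + \<epsilon>) * (1 / (1 + v\<^sup>2))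
     * (Gamma_modulus \<epsilon> (2 * X + \<epsilon> * v) * Gamma_modulus \<epsilon> (- (\<epsilon> * v))) / (\<epsilon>\<^sup>2 + (2 * X + \<epsilon> * v)\<^sup>2))))"
  have I: "(LBINT \<tau>. H \<tau> * of_real (KL_kernel \<epsilon> x \<tau>)) = 2 * (LBINT v. k \<epsilon> v)" if e: "\<epsilon> > 0" for \<epsilon>
  proof -
    let ?f = "\<lambda>\<tau>. H \<tau> * of_real (KL_kernel \<epsilon> x \<tau>)"
    have "integrable lborel (\<lambda>\<tau>. indicator {0..} \<tau> *\<^sub>R ?f \<tau>)"
      by (rule integrable_mult_indicator[OF _ int[OF e]]) simp
    then have "has_bochner_integral lborel (\<lambda>\<tau>. indicator {0..} \<tau> *\<^sub>R ?f \<tau>) (LBINT \<tau>. indicator {0..} \<tau> *\<^sub>R ?f \<tau>)"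
      by (rule has_bochner_integral_integrable)
    then have "has_bochner_integral lborel ?f (2 *\<^sub>R (LBINT \<tau>. indicator {0..} \<tau> *\<^sub>R ?f \<tau>))"
      by (rule has_bochner_integral_even_function) (simp add: even KL_kernel_even[OF e])
    then have "(LBINT \<tau>. ?f \<tau>) = 2 * (LBINT \<tau>. indicator {0..} \<tau> *\<^sub>R ?f \<tau>)"
      by (simp add: has_bochner_integral_iff scaleR_conv_of_real)
    also have "(LBINT \<tau>. indicator {0..} \<tau> *\<^sub>R ?f \<tau>) = \<epsilon> *\<^sub>R (LBINT v. indicator {0..} (X + \<epsilon> * v) *\<^sub>R ?f (X + \<epsilon> * v))"
      using lborel_integral_real_affine[of \<epsilon> "\<lambda>\<tau>. indicator {0..} \<tau> *\<^sub>R ?f \<tau>" X] e by simp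
    also have "\<dots> = (LBINT v. \<epsilon> *\<^sub>R (indicator {0..} (X + \<epsilon> * v) *\<^sub>R ?f (X + \<epsilon> * v)))"
      by (rule integral_scaleR_right[symmetric])
    also have "\<dots> = (LBINT v. k \<epsilon> v)"
    proof (rule Bochner_Integration.integral_cong[OF refl])
      fix v
      have K: "KL_kernel \<epsilon> x (X + \<epsilon> * v) = 2 * 4 powr \<epsilon> / Gamma (1 + \<epsilon>) * (\<epsilon> / (\<epsilon>\<^sup>2 + (\<epsilon> * v)\<^sup>2))
         * (Gamma_modulus \<epsilon> (2 * X + \<epsilon> * v) * Gamma_modulus \<epsilon> (- (\<epsilon> * v))) / (\<epsilon>\<^sup>2 + (2 * X + \<epsilon> * v)\<^sup>2)"
      proof -
        have "KL_kernel \<epsilon> x (X + \<epsilon> * v) = KL_kernel \<epsilon> X (X + \<epsilon> * v)"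
          unfolding X_def by (rule KL_kernel_abs[OF e, symmetric])
        moreover have "X + (X + \<epsilon> * v) = 2 * X + \<epsilon> * v" "X - (X + \<epsilon> * v) = - (\<epsilon> * v)" by simp_all
        ultimately show ?thesis by (simp only: KL_kernel_eq[OF e] power2_minus)
      qed
      have q: "\<epsilon> * (\<epsilon> / (\<epsilon>\<^sup>2 + (\<epsilon> * v)\<^sup>2)) = 1 / (1 + v\<^sup>2)"
      proof -
        have "\<epsilon>\<^sup>2 + (\<epsilon> * v)\<^sup>2 = (\<epsilon> * \<epsilon>) * (1 + v\<^sup>2)" by (simp add: algebra_simps power2_eq_square)
        then show ?thesis using e by simp
      qed
      have eK: "\<epsilon> * KL_kernel \<epsilon> x (X + \<epsilon> * v) = 2 * 4 powr \<epsilon> / Gamma (1 + \<epsilon>) * (\<epsilon> * (\<epsilon> / (\<epsilon>\<^sup>2 + (\<epsilon> * v)\<^sup>2)))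
         * (Gamma_modulus \<epsilon> (2 * X + \<epsilon> * v) * Gamma_modulus \<epsilon> (- (\<epsilon> * v))) / (\<epsilon>\<^sup>2 + (2 * X + \<epsilon> * v)\<^sup>2)"
        unfolding K by (simp add: mult_ac)
      have s: "\<epsilon> *\<^sub>R (i *\<^sub>R (h * of_real K)) = i *\<^sub>R (h * of_real (\<epsilon> * K))" for i K :: real and h :: complex
        by (simp add: scaleR_conv_of_real mult_ac)
      show "\<epsilon> *\<^sub>R (indicator {0..} (X + \<epsilon> * v) *\<^sub>R ?f (X + \<epsilon> * v)) = k \<epsilon> v"
        unfolding s eK q k_def ..
    qed
    finally show ?thesis .
  qed
  have "continuous_on {1..3/2} (Gamma :: real \<Rightarrow> real)" by (intro continuous_intros; auto elim!: nonpos_Ints_cases)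
  then have "compact ((Gamma :: real \<Rightarrow> real) ` {1..3/2})" by (intro compact_continuous_image) auto
  then obtain C1 where C1: "\<And>a. a \<in> {1..3/2} \<Longrightarrow> \<bar>Gamma a\<bar> \<le> (C1::real)"
    using compact_imp_bounded bounded_iff by (metis imageI real_norm_def)
  have "continuous_on {1..3/2} (rGamma :: real \<Rightarrow> real)" by (intro continuous_intros)
  then have "compact ((rGamma :: real \<Rightarrow> real) ` {1..3/2})" by (intro compact_continuous_image) auto
  then obtain C2 where C2: "\<And>a. a \<in> {1..3/2} \<Longrightarrow> \<bar>rGamma a\<bar> \<le> (C2::real)"
    using compact_imp_bounded bounded_iff by (metis imageI real_norm_def)
  have C0: "C1 \<ge> 0" "C2 \<ge> 0" using C1[of 1] C2[of 1] by auto
  have mod: "0 \<le> Gamma_modulus \<epsilon> y" "Gamma_modulus \<epsilon> y \<le> C1\<^sup>2" if "0 < \<epsilon>" "\<epsilon> < 1 / 2" for \<epsilon> y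
  proof -
    show "0 \<le> Gamma_modulus \<epsilon> y" by (simp add: Gamma_modulus_def)
    have "cmod (Gamma (Complex (1 + \<epsilon> / 2) (y / 2))) \<le> Gamma (1 + \<epsilon> / 2)"
      using norm_Gamma_le[of "Complex (1 + \<epsilon> / 2) (y / 2)"] that by simp
    also have "\<dots> \<le> C1" using C1[of "1 + \<epsilon> / 2"] that by simp
    finally show "Gamma_modulus \<epsilon> y \<le> C1\<^sup>2" unfolding Gamma_modulus_def by (rule power_mono) simp
  qed
  have kb: "norm (k \<epsilon> v) \<le> (B * (2 * 4 * C2 * (C1\<^sup>2 * C1\<^sup>2) / X\<^sup>2)) * (1 / (1 + v\<^sup>2))" if e: "0 < \<epsilon>" "\<epsilon> < 1 / 2" for \<epsilon> v
  proof (cases "X + \<epsilon> * v \<ge> 0")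
    case False
    then show ?thesis using B0 C0 by (simp add: k_def)
  next
    case True
    have "4 powr \<epsilon> \<le> 4 powr (1::real)" using e by (intro powr_mono) auto
    then have p4: "4 powr \<epsilon> \<le> 4" by simp
    have g: "0 \<le> 1 / Gamma (1 + \<epsilon>)" "1 / Gamma (1 + \<epsilon>) \<le> C2"
      using C2[of "1 + \<epsilon>"] e Gamma_real_pos[of "1 + \<epsilon>"] by (auto simp: rGamma_inverse_Gamma inverse_eq_divide)
    have "X\<^sup>2 \<le> (2 * X + \<epsilon> * v)\<^sup>2" using True X by (intro power_mono) auto
    then have d: "X\<^sup>2 \<le> \<epsilon>\<^sup>2 + (2 * X + \<epsilon> * v)\<^sup>2" using zero_le_power2[of \<epsilon>] by linarith
    have X2: "X\<^sup>2 > 0" using X by simp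
    have "norm (k \<epsilon> v) = norm (H (X + \<epsilon> * v)) * (2 * 4 powr \<epsilon> * (1 / Gamma (1 + \<epsilon>)) * (1 / (1 + v\<^sup>2))
     * (Gamma_modulus \<epsilon> (2 * X + \<epsilon> * v) * Gamma_modulus \<epsilon> (- (\<epsilon> * v))) / (\<epsilon>\<^sup>2 + (2 * X + \<epsilon> * v)\<^sup>2))"
    proof -
      have "0 \<le> 2 * 4 powr \<epsilon> * (1 / Gamma (1 + \<epsilon>)) * (1 / (1 + v\<^sup>2))
     * (Gamma_modulus \<epsilon> (2 * X + \<epsilon> * v) * Gamma_modulus \<epsilon> (- (\<epsilon> * v))) / (\<epsilon>\<^sup>2 + (2 * X + \<epsilon> * v)\<^sup>2)"
        using g(1) mod(1)[OF e] by (intro divide_nonneg_nonneg mult_nonneg_nonneg add_nonneg_nonneg) auto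
      moreover have op: "a / G * w * m / d = a * (1 / G) * w * m / d" for a G w m d :: real by simp
      moreover have "norm (i *\<^sub>R (h * of_real r)) = norm h * r" if "i = 1" "0 \<le> r" for i r :: real and h :: complex
        using that by (simp add: norm_mult)
      moreover have "indicator {0..} (X + \<epsilon> * v) = (1 :: real)" using True by simp
      ultimately show ?thesis unfolding k_def op by blast
    qed
    also have "\<dots> \<le> B * (2 * 4 * C2 * (1 / (1 + v\<^sup>2)) * (C1\<^sup>2 * C1\<^sup>2) / X\<^sup>2)"
      using mod[OF e] g d X2 p4 C0 B0 add_pos_nonneg[OF zero_less_one zero_le_power2, of v]
      by (intro mult_mono bound frac_le mult_nonneg_nonneg) (auto intro!: add_nonneg_nonneg divide_nonneg_nonneg mult_nonneg_nonneg)
    finally show ?thesis by (simp add: mult_ac)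
  qed
  define L where "L = of_real (2 * (Gamma_modulus 0 (2 * X) * 1) / (2 * X)\<^sup>2) * H X"
  have G0: "Gamma_modulus 0 0 = 1" by (simp add: Gamma_modulus_def flip: one_complex.code)
  have conv: "(\<lambda>n. LBINT v. k (Y n) v) \<longlonglongrightarrow> L * of_real pi"
    if Y: "Y \<longlonglongrightarrow> 0" "\<And>n. 0 < Y n" "\<And>n. Y n < 1 / 2" for Y
  proof -
    have "(\<lambda>n. LBINT v. k (Y n) v) \<longlonglongrightarrow> (LBINT v. L * of_real (1 / (1 + v\<^sup>2)))"
    proof (rule integral_dominated_convergence[where w = "\<lambda>v. (B * (2 * 4 * C2 * (C1\<^sup>2 * C1\<^sup>2) / X\<^sup>2)) * (1 / (1 + v\<^sup>2))"])
      show "integrable lborel (\<lambda>v. (B * (2 * 4 * C2 * (C1\<^sup>2 * C1\<^sup>2) / X\<^sup>2)) * (1 / (1 + v\<^sup>2)))"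
        by (intro integrable_mult_right arctan_integral_real_line)
      show "AE v in lborel. norm (k (Y n) v) \<le> (B * (2 * 4 * C2 * (C1\<^sup>2 * C1\<^sup>2) / X\<^sup>2)) * (1 / (1 + v\<^sup>2))" for n
        by (intro AE_I2 kb Y)
      show "AE v in lborel. (\<lambda>n. k (Y n) v) \<longlonglongrightarrow> L * of_real (1 / (1 + v\<^sup>2))"
      proof (rule AE_I2)
        fix v
        have Yv: "(\<lambda>n. Y n * v) \<longlonglongrightarrow> 0" using tendsto_mult_left_zero[OF Y(1)] .
        have 1: "(\<lambda>n. X + Y n * v) \<longlonglongrightarrow> X" using tendsto_add[OF tendsto_const Yv, of X] by simp
        have 2: "(\<lambda>n. 2 * X + Y n * v) \<longlonglongrightarrow> 2 * X" using tendsto_add[OF tendsto_const Yv, of "2 * X"] by simp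
        have 3: "(\<lambda>n. - (Y n * v)) \<longlonglongrightarrow> 0" using tendsto_minus[OF Yv] by simp
        have "isCont H X" using cont by (simp add: continuous_on_eq_continuous_at)
        then have H: "(\<lambda>n. H (X + Y n * v)) \<longlonglongrightarrow> H X" using 1 by (rule isCont_tendsto_compose)
        have p: "(\<lambda>n. 4 powr (Y n)) \<longlonglongrightarrow> 4 powr (0::real)" by (intro tendsto_intros Y) simp
        have g: "(\<lambda>n. Gamma (1 + Y n)) \<longlonglongrightarrow> Gamma (1 + 0 :: real)"
          by (intro tendsto_Gamma tendsto_intros Y) (auto elim!: nonpos_Ints_cases)
        have "(\<lambda>n. 2 * 4 powr (Y n) / Gamma (1 + Y n) * (1 / (1 + v\<^sup>2))
          * (Gamma_modulus (Y n) (2 * X + Y n * v) * Gamma_modulus (Y n) (- (Y n * v))) / ((Y n)\<^sup>2 + (2 * X + Y n * v)\<^sup>2))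
          \<longlonglongrightarrow> 2 * 4 powr (0::real) / Gamma (1 + 0) * (1 / (1 + v\<^sup>2)) * (Gamma_modulus 0 (2 * X) * Gamma_modulus 0 0) / (0\<^sup>2 + (2 * X)\<^sup>2)"
          using X by (intro tendsto_intros p g tendsto_Gamma_modulus Y 2 3) auto
        from tendsto_mult[OF H tendsto_of_real[OF this]]
        have lim: "(\<lambda>n. H (X + Y n * v) * of_real (2 * 4 powr (Y n) / Gamma (1 + Y n) * (1 / (1 + v\<^sup>2))
          * (Gamma_modulus (Y n) (2 * X + Y n * v) * Gamma_modulus (Y n) (- (Y n * v))) / ((Y n)\<^sup>2 + (2 * X + Y n * v)\<^sup>2)))
          \<longlonglongrightarrow> L * of_real (1 / (1 + v\<^sup>2))"
          unfolding L_def G0 by (simp add: mult_ac)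
        have "eventually (\<lambda>n. X + Y n * v > 0) sequentially" using 1 X by (rule order_tendstoD)
        then have "eventually (\<lambda>n. H (X + Y n * v) * of_real (2 * 4 powr (Y n) / Gamma (1 + Y n) * (1 / (1 + v\<^sup>2))
          * (Gamma_modulus (Y n) (2 * X + Y n * v) * Gamma_modulus (Y n) (- (Y n * v))) / ((Y n)\<^sup>2 + (2 * X + Y n * v)\<^sup>2)) = k (Y n) v) sequentially"
          by eventually_elim (simp add: k_def)
        then show "(\<lambda>n. k (Y n) v) \<longlonglongrightarrow> L * of_real (1 / (1 + v\<^sup>2))" by (rule Lim_transform_eventually[OF lim])
      qed
      have [measurable]: "(\<lambda>v. Gamma_modulus (Y n) (a + Y n * v)) \<in> borel_measurable borel"
        "(\<lambda>v. Gamma_modulus (Y n) (- (Y n * v))) \<in> borel_measurable borel" for n a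
      proof -
        have 1: "continuous_on {z. Re z > 0} (Gamma :: complex \<Rightarrow> complex)"
          by (rule continuous_on_Gamma) (auto dest: Re_pos_not_nonpos_Int)
        have 2: "continuous_on UNIV (\<lambda>y. Complex (1 + Y n / 2) (y / 2))"
          by (intro continuous_on_Complex continuous_intros) auto
        have 3: "(\<lambda>y. Complex (1 + Y n / 2) (y / 2)) ` UNIV \<subseteq> {z. Re z > 0}"
          using Y(2)[of n] by (auto intro: add_pos_pos)
        have "continuous_on UNIV (\<lambda>y. Gamma (Complex (1 + Y n / 2) (y / 2)))"
          by (rule continuous_on_compose2[OF 1 2 3])
        then have "continuous_on UNIV (\<lambda>y. Gamma_modulus (Y n) y)"
          unfolding Gamma_modulus_def by (intro continuous_on_power continuous_on_norm)
        then have [measurable]: "(\<lambda>y. Gamma_modulus (Y n) y) \<in> borel_measurable borel" by (rule borel_measurable_continuous_onI)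
        show "(\<lambda>v. Gamma_modulus (Y n) (a + Y n * v)) \<in> borel_measurable borel"
          "(\<lambda>v. Gamma_modulus (Y n) (- (Y n * v))) \<in> borel_measurable borel" by measurable
      qed
      show "k (Y n) \<in> borel_measurable lborel" for n unfolding k_def by measurable
      show "(\<lambda>v. L * of_real (1 / (1 + v\<^sup>2))) \<in> borel_measurable lborel" by measurable
    qed
    also have "(LBINT v. L * of_real (1 / (1 + v\<^sup>2))) = L * of_real pi"
      unfolding integral_mult_right_zero integral_complex_of_real arctan_integral_real_line(2) ..
    finally show ?thesis .
  qed
  have val: "2 * (L * of_real pi) = of_real (pi\<^sup>2 / (x * sinh (pi * x))) * H x"
  proof -
    have HX: "H X = H x" using even[of x] by (cases "x \<ge> 0") (auto simp: X_def)
    have xs: "x * sinh (pi * x) = X * sinh (pi * X)" by (cases "x \<ge> 0") (auto simp: X_def)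
    have s0: "sinh (pi * X) > 0" using X by simp
    then have "Gamma_modulus 0 (2 * X) = pi * X / sinh (pi * X)" using Gamma_modulus_1[of X]
      by (simp only: nonzero_eq_divide_eq[OF less_imp_neq[OF s0, symmetric]])
    then have "2 * (2 * (Gamma_modulus 0 (2 * X) * 1) / (2 * X)\<^sup>2 * pi) = pi\<^sup>2 / (X * sinh (pi * X))"
      using X s0 by (simp add: power2_eq_square field_simps)
    moreover have "2 * (L * of_real pi) = of_real (2 * (2 * (Gamma_modulus 0 (2 * X) * 1) / (2 * X)\<^sup>2 * pi)) * H X"
      unfolding L_def by simp
    ultimately show ?thesis unfolding HX xs by (simp only:)
  qed
  show ?thesis
    unfolding tendsto_at_iff_sequentially
  proof (intro allI impI)
    fix Z :: "nat \<Rightarrow> real" assume Z: "\<forall>i. Z i \<in> {0<..} - {0}" "Z \<longlonglongrightarrow> 0"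
    have "eventually (\<lambda>n. Z n < 1 / 2) sequentially" by (rule order_tendstoD(2)[OF Z(2)]) simp
    then obtain N where N: "\<And>n. n \<ge> N \<Longrightarrow> Z n < 1 / 2" unfolding eventually_sequentially by blast
    have "(\<lambda>n. LBINT v. k (Z (n + N)) v) \<longlonglongrightarrow> L * of_real pi"
      by (rule conv) (use Z N LIMSEQ_ignore_initial_segment[OF Z(2)] in auto)
    then have "(\<lambda>n. 2 * (LBINT v. k (Z (n + N)) v)) \<longlonglongrightarrow> 2 * (L * of_real pi)" by (intro tendsto_intros)
    moreover have "2 * (LBINT v. k (Z n) v) = (LBINT \<tau>. H \<tau> * of_real (KL_kernel (Z n) x \<tau>))" for n
      using I[of "Z n"] Z(1) by simp
    ultimately have "(\<lambda>n. LBINT \<tau>. H \<tau> * of_real (KL_kernel (Z (n + N)) x \<tau>)) \<longlonglongrightarrow> of_real (pi\<^sup>2 / (x * sinh (pi * x))) * H x"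
      unfolding val by (simp only:)
    then show "((\<lambda>\<epsilon>. LBINT \<tau>. H \<tau> * of_real (KL_kernel \<epsilon> x \<tau>)) \<circ> Z) \<longlonglongrightarrow> of_real (pi\<^sup>2 / (x * sinh (pi * x))) * H x"
      unfolding o_def by (rule LIMSEQ_offset)
  qed
qed

section \<open>The inversion formula\<close>

text \<open>The case \<open>x = 0\<close> of the inversion formula, where the peaks at \<open>\<plusminus>x\<close> collide.\<close>

lemma inversion_kernel_0: "inversion_kernel \<epsilon> 0 t = 0"
  by (simp add: inversion_kernel_def)

theorem theorem4:
  fixes g :: "complex \<Rightarrow> complex" and \<nu> \<alpha> :: real
  assumes g_L1: "(\<lambda>\<tau>. g (of_real \<tau>)) \<in> weighted_L1 UNIV (\<lambda>\<tau>. cosh (pi * \<tau>) powr (- 1 / 2))"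
    and nu: "0 < \<nu>" "\<nu> < 1 / 2"
    and Gg_L1: "G_transform (\<lambda>\<tau>. g (of_real \<tau>)) \<in> weighted_L1 {0<..} (\<lambda>t. t powr (\<nu> - 1))"
    and alpha: "0 < \<alpha>" "\<alpha> < 1"
    and analytic: "(\<lambda>z. g (z / \<i>)) analytic_on strip \<alpha>"
    and even: "\<And>z. z \<in> strip \<alpha> \<Longrightarrow> g (- z / \<i>) = g (z / \<i>)"
    and zero: "g 0 = 0" "deriv g 0 = 0"
    and decay: "uniform_limit {-\<alpha><..<\<alpha>} (\<lambda>y \<sigma>. g (Complex \<sigma> y / \<i>)) (\<lambda>_. 0) at_infinity"
  shows "\<forall>x::real.
     (\<forall>\<^sub>F \<epsilon> in at_right 0. set_integrable lborel {0<..}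
        (\<lambda>t. inversion_kernel \<epsilon> x t * G_transform (\<lambda>\<tau>. g (of_real \<tau>)) t)) \<and>
     ((\<lambda>\<epsilon>. complex_of_real (cosh (pi * x) / sqrt pi) *
        (LBINT t:{0<..}. inversion_kernel \<epsilon> x t * G_transform (\<lambda>\<tau>. g (of_real \<tau>)) t))
       \<longlongrightarrow> g (of_real x)) (at_right 0)"
proof
  fix x :: real
  define \<gamma> where "\<gamma> = (\<lambda>\<tau>. g (complex_of_real \<tau>))"
  define H where "H = (\<lambda>\<tau>. \<gamma> \<tau> / of_real (cosh (pi * \<tau>)))"
  \<comment> \<open>On the imaginary axis the hypotheses say that \<open>\<gamma>\<close> is even, continuous and tends to 0, hence bounded.\<close>
  have strip: "\<i> * of_real \<tau> \<in> strip \<alpha>" for \<tau> using alpha by (simp add: strip_def)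
  have axis: "\<i> * of_real \<tau> / \<i> = complex_of_real \<tau>" "- (\<i> * of_real \<tau>) / \<i> = complex_of_real (- \<tau>)"
    "Complex 0 \<tau> / \<i> = of_real \<tau>" for \<tau>
    by (simp_all add: complex_eq_iff)
  have \<gamma>_even: "\<gamma> (- \<tau>) = \<gamma> \<tau>" for \<tau>
    using even[OF strip[of \<tau>]] unfolding axis \<gamma>_def .
  have "continuous_on (strip \<alpha>) (\<lambda>z. g (z / \<i>))"
    using analytic by (intro holomorphic_on_imp_continuous_on analytic_imp_holomorphic)
  then have "continuous_on UNIV ((\<lambda>z. g (z / \<i>)) \<circ> (\<lambda>\<tau>. \<i> * complex_of_real \<tau>))"
    by (intro continuous_on_compose continuous_intros) (auto elim!: continuous_on_subset simp: strip)
  then have \<gamma>_cont: "continuous_on UNIV \<gamma>" unfolding o_def axis \<gamma>_def .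
  then have [measurable]: "\<gamma> \<in> borel_measurable borel" by (rule borel_measurable_continuous_onI)
  have "((\<lambda>y. g (Complex 0 y / \<i>)) \<longlongrightarrow> 0) at_infinity"
    by (rule tendsto_uniform_limitI[OF decay]) (use alpha in auto)
  then have "(\<gamma> \<longlongrightarrow> 0) at_infinity" unfolding axis \<gamma>_def .
  then obtain R where R: "\<And>\<tau>. \<bar>\<tau>\<bar> \<ge> R \<Longrightarrow> norm (\<gamma> \<tau>) < 1"
    unfolding Lim_at_infinity by (metis dist_0_norm dist_commute real_norm_def zero_less_one)
  have "compact (\<gamma> ` {- R..R})"
    by (intro compact_continuous_image continuous_on_subset[OF \<gamma>_cont]) auto
  then obtain B where B: "\<And>\<tau>. \<tau> \<in> {- R..R} \<Longrightarrow> norm (\<gamma> \<tau>) \<le> B"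
    using compact_imp_bounded bounded_iff by (metis imageI)
  have \<gamma>_bound: "norm (\<gamma> \<tau>) \<le> max B 1" for \<tau>
  proof (cases "\<bar>\<tau>\<bar> \<ge> R")
    case True
    then show ?thesis using R[of \<tau>] by simp
  next
    case False
    then have "\<tau> \<in> {- R..R}" by auto
    then show ?thesis using B[of \<tau>] by simp
  qed
  have L1: "integrable lborel (\<lambda>\<tau>. cosh (pi * \<tau>) powr (- 1 / 2) * norm (\<gamma> \<tau>))"
  proof -
    have "integrable lborel (\<lambda>\<tau>. complex_of_real (cosh (pi * \<tau>) powr (- 1 / 2)) * \<gamma> \<tau>)"
      using g_L1 by (simp add: weighted_L1_def set_integrable_def \<gamma>_def)
    from integrable_norm[OF this] show ?thesis by (simp add: norm_mult)
  qed
  have ev: "eventually (\<lambda>\<epsilon>::real. 0 < \<epsilon> \<and> \<epsilon> < 1 / 2) (at_right 0)"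
    by (rule eventually_mono[OF eventually_at_right_real[of 0 "1 / 2"]]) auto
  show "(\<forall>\<^sub>F \<epsilon> in at_right 0. set_integrable lborel {0<..}
        (\<lambda>t. inversion_kernel \<epsilon> x t * G_transform (\<lambda>\<tau>. g (of_real \<tau>)) t)) \<and>
     ((\<lambda>\<epsilon>. complex_of_real (cosh (pi * x) / sqrt pi) *
        (LBINT t:{0<..}. inversion_kernel \<epsilon> x t * G_transform (\<lambda>\<tau>. g (of_real \<tau>)) t))
       \<longlongrightarrow> g (of_real x)) (at_right 0)"
  proof (cases "x = 0")
    case True
    then show ?thesis by (simp add: inversion_kernel_0 zero set_lebesgue_integral_def set_integrable_def)
  next
    case x: False
    note inversion = inversion_kernel_G_transform[of \<gamma>, OF _ L1 _ _ x]
    have "\<forall>\<^sub>F \<epsilon> in at_right 0. set_integrable lborel {0<..} (\<lambda>t. inversion_kernel \<epsilon> x t * G_transform \<gamma> t)"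
      using ev by eventually_elim (rule inversion, auto)
    moreover have "((\<lambda>\<epsilon>. complex_of_real (cosh (pi * x) / sqrt pi) * (LBINT t:{0<..}. inversion_kernel \<epsilon> x t * G_transform \<gamma> t)) \<longlongrightarrow> \<gamma> x) (at_right 0)"
    proof (rule Lim_transform_eventually)
      define c where "c = cosh (pi * x) / sqrt pi * (x * sinh (pi * x) / pi\<^sup>2 * sqrt pi)"
      show "\<forall>\<^sub>F \<epsilon> in at_right 0. of_real c * (LBINT \<tau>. H \<tau> * of_real (KL_kernel \<epsilon> x \<tau>))
        = complex_of_real (cosh (pi * x) / sqrt pi) * (LBINT t:{0<..}. inversion_kernel \<epsilon> x t * G_transform \<gamma> t)"
        using ev
      proof eventually_elim
        case (elim \<epsilon>)
        have "(LBINT t:{0<..}. inversion_kernel \<epsilon> x t * G_transform \<gamma> t) = of_real (x * sinh (pi * x) / pi\<^sup>2 * sqrt pi) * (LBINT \<tau>. H \<tau> * of_real (KL_kernel \<epsilon> x \<tau>))"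
          unfolding H_def by (rule inversion) (use elim in auto)
        then show ?case unfolding c_def of_real_mult[of "cosh (pi * x) / sqrt pi"] by (simp only: mult.assoc)
      qed
      have "((\<lambda>\<epsilon>. LBINT \<tau>. H \<tau> * of_real (KL_kernel \<epsilon> x \<tau>)) \<longlongrightarrow> of_real (pi\<^sup>2 / (x * sinh (pi * x))) * H x) (at_right 0)"
      proof (rule KL_kernel_approximate_identity[OF _ _ _ _ x])
        show "continuous_on UNIV H" unfolding H_def
          by (intro continuous_intros \<gamma>_cont) (auto simp: less_imp_neq[symmetric])
        show "norm (H \<tau>) \<le> max B 1" for \<tau>
        proof -
          have "norm (H \<tau>) = norm (\<gamma> \<tau>) / cosh (pi * \<tau>)" by (simp add: H_def norm_divide)
          also have "\<dots> \<le> norm (\<gamma> \<tau>) / 1" using cosh_real_ge_1[of "pi * \<tau>"] by (intro divide_left_mono) auto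
          finally show ?thesis using \<gamma>_bound[of \<tau>] by simp
        qed
        show "H (- \<tau>) = H \<tau>" for \<tau> by (simp add: H_def \<gamma>_even)
        show "integrable lborel (\<lambda>\<tau>. H \<tau> * of_real (KL_kernel \<epsilon> x \<tau>))" if "0 < \<epsilon>" for \<epsilon>
          unfolding H_def by (rule stieltjes_index_integral(3)[OF _ L1 that]) measurable
      qed
      then have "((\<lambda>\<epsilon>. of_real c * (LBINT \<tau>. H \<tau> * of_real (KL_kernel \<epsilon> x \<tau>))) \<longlongrightarrow> of_real c * (of_real (pi\<^sup>2 / (x * sinh (pi * x))) * H x)) (at_right 0)"
        by (intro tendsto_intros)
      moreover have "of_real c * (of_real (pi\<^sup>2 / (x * sinh (pi * x))) * H x) = \<gamma> x"
      proof -
        have "c * (pi\<^sup>2 / (x * sinh (pi * x))) = cosh (pi * x)" unfolding c_def using x by simp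
        moreover have "of_real c * (of_real (pi\<^sup>2 / (x * sinh (pi * x))) * H x) = of_real (c * (pi\<^sup>2 / (x * sinh (pi * x)))) * H x" by simp
        ultimately have "of_real c * (of_real (pi\<^sup>2 / (x * sinh (pi * x))) * H x) = of_real (cosh (pi * x)) * H x" by (simp only:)
        then show ?thesis by (simp add: H_def)
      qed
      ultimately show "((\<lambda>\<epsilon>. of_real c * (LBINT \<tau>. H \<tau> * of_real (KL_kernel \<epsilon> x \<tau>))) \<longlongrightarrow> \<gamma> x) (at_right 0)" by (simp only:)
    qed
    ultimately show ?thesis unfolding \<gamma>_def by blast
  qed
qed

end
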